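(* Let $\gamma>0$, $0<\delta<(n-1)/2$, $1\leq p<\frac{2n}{n-1-2\delta}$ and $\frac{n-1}{2}-\delta<\lambda\leq\gamma$. If $f\in I_{\lambda}(L^{p})(\mathbb{R}^{n})$, then $$(S_{R}^{\delta,\gamma}f)(x)-f(x)=o\left(1/R^{\lambda+\delta-\frac{n-1}{2}}\right)\quad\text{for a.e. } x\in\mathbb{R}^n,\ \text{as } R\to\infty .$$
   Context: Fourier transform: $\widehat f(\xi)=\int_{\mathbb{R}^n}f(x)e^{-2\pi i x\cdot\xi}\,dx$, extended to tempered distributions. For $\delta>-1$, $\gamma>0$, $R>0$ the generalized Bochner-Riesz means are defined by $(S_R^{\delta,\gamma}f)^{\wedge}(\xi)=\left(1-\frac{|\xi|^\gamma}{R^\gamma}\right)_+^{\delta}\widehat f(\xi)$. The Riesz potential $I_\lambda$ ($\lambda\in\mathbb{R}$) is given by $(I_\lambda f)^\wedge(\xi)=|\xi|^{-\lambda}\widehat f(\xi)$. The homogeneous Sobolev space $I_\lambda(L^p)(\mathbb{R}^n)$ is the image of $L^p(\mathbb{R}^n)$ under $I_\lambda$, i.e. $f\in I_\lambda(L^p)$ if and only if $I_{-\lambda}f\in L^p$. Meaning of $S_R^{\delta,\gamma}f-f$ for $f\in I_\lambda(L^p)$: with $g=I_{-\lambda}f\in L^p$, the quantity $R^\lambda\{S_R^{\delta,\gamma}f-f\}$ is the function obtained from $g$ by the Fourier multiplier $\mu(\xi/R)$, where $$\mu(\xi)=\frac{(1-|\xi|^\gamma)_+^{\delta}-1}{|\xi|^\lambda}\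 (\xi\neq0);$$ that is, $R^\lambda\{(S_R^{\delta,\gamma}f)(x)-f(x)\}=\int_{\mathbb{R}^n}R^nk(Ry)g(x-y)\,dy$, where $k$ is the (locally integrable) inverse Fourier transform of $\mu$. *)

theory Defs
  imports "HOL-Analysis.Analysis" "HOL-Library.Landau_Symbols"
begin

section \<open>Schwartz functions and tempered distributions\<close>

text \<open>Iterated partial derivatives: \<open>partials [v1, ..., vm] \<phi>\<close> is
  \<open>\<partial>_v1 ... \<partial>_vm \<phi>\<close>. Lists over the standard basis play the role of multi-indices.\<close>

fun partials :: "'a list \<Rightarrow> ('a::euclidean_space \<Rightarrow> complex) \<Rightarrow> 'a \<Rightarrow> complex" where
  "partials [] \<phi> = \<phi>"
| "partials (v # vs) \<phi> = (\<lambda>x. frechet_derivative (partials vs \<phi>) (at x) v)"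

definition schwartz :: "('a::euclidean_space \<Rightarrow> complex) set" where
  "schwartz = {\<phi>. \<forall>vs. set vs \<subseteq> Basis \<longrightarrow>
      (\<forall>x. partials vs \<phi> differentiable (at x)) \<and>
      (\<forall>N::nat. bounded (range (\<lambda>x. (1 + norm x) ^ N * norm (partials vs \<phi> x))))}"

definition schwartz_norm :: "nat \<Rightarrow> ('a::euclidean_space \<Rightarrow> complex) \<Rightarrow> real" where
  "schwartz_norm N \<phi> =
     (SUP (vs, x) \<in> {vs. set vs \<subseteq> Basis \<and> length vs \<le> N} \<times> UNIV.
        (1 + norm x) ^ N * norm (partials vs \<phi> x))"

text \<open>Distributions are functionals on all functions, of which only the values on
  \<^term>\<open>schwartz\<close> are relevant.\<close>

type_synonym 'a distribution = "('a \<Rightarrow> complex) \<Rightarrow> complex"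

definition tempered :: "'a::euclidean_space distribution \<Rightarrow> bool" where
  "tempered T \<longleftrightarrow>
     (\<forall>\<phi>\<in>schwartz. \<forall>\<psi>\<in>schwartz. T (\<lambda>x. \<phi> x + \<psi> x) = T \<phi> + T \<psi>) \<and>
     (\<forall>\<phi>\<in>schwartz. \<forall>c. T (\<lambda>x. c * \<phi> x) = c * T \<phi>) \<and>
     (\<exists>N C. \<forall>\<phi>\<in>schwartz. norm (T \<phi>) \<le> C * schwartz_norm N \<phi>)"

definition dist_of :: "('a::euclidean_space \<Rightarrow> complex) \<Rightarrow> 'a distribution" where
  "dist_of h = (\<lambda>\<phi>. LINT x|lebesgue. h x * \<phi> x)"

definition fourier :: "('a::euclidean_space \<Rightarrow> complex) \<Rightarrow> 'a \<Rightarrow> complex" where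
  "fourier \<phi> \<xi> = (LINT x|lebesgue. \<phi> x * exp (- 2 * of_real pi * \<i> * of_real (x \<bullet> \<xi>)))"

definition fourier_dist :: "'a::euclidean_space distribution \<Rightarrow> 'a distribution" where
  "fourier_dist T = (\<lambda>\<phi>. T (fourier \<phi>))"

text \<open>\<open>k\<close> is a locally integrable function which is (as a tempered distribution) the inverse
  Fourier transform of the function \<open>m\<close>; this determines \<open>k\<close> up to a null set.\<close>

definition is_inverse_fourier ::
    "('a::euclidean_space \<Rightarrow> complex) \<Rightarrow> ('a \<Rightarrow> complex) \<Rightarrow> bool" where
  "is_inverse_fourier k m \<longleftrightarrow>
     (\<forall>K. compact K \<longrightarrow> set_integrable lebesgue K k) \<and>
     (\<forall>\<phi>\<in>schwartz. integrable lebesgue (\<lambda>x. k x * \<phi> x)) \<and>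
     (\<forall>\<phi>\<in>schwartz. integrable lebesgue (\<lambda>\<xi>. m \<xi> * \<phi> \<xi>)) \<and>
     (\<forall>\<phi>\<in>schwartz. fourier_dist (dist_of k) \<phi> = dist_of m \<phi>)"

section \<open>Riesz potentials and homogeneous Sobolev spaces\<close>

definition Lp_space :: "real \<Rightarrow> ('a::euclidean_space \<Rightarrow> complex) set" where
  "Lp_space p = {g. g \<in> borel_measurable lebesgue \<and>
                    integrable lebesgue (\<lambda>x. norm (g x) powr p)}"

text \<open>\<open>f = I_lam T\<close>, i.e. the Fourier transform of \<open>f\<close> is \<open>|\<xi>|^(-lam)\<close> times that of \<open>T\<close>.
  As \<open>|\<xi>|^(-lam)\<close> is smooth only away from the origin, its product with a tempered distribution
  is taken on the complement of the origin. Thus \<open>f\<close> is determined up to a polynomial, which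
  is the usual convention for homogeneous spaces.\<close>

definition is_riesz_potential ::
    "real \<Rightarrow> 'a::euclidean_space distribution \<Rightarrow> 'a distribution \<Rightarrow> bool" where
  "is_riesz_potential lam T f \<longleftrightarrow>
     (\<forall>\<phi>\<in>schwartz. compact (closure {\<xi>. \<phi> \<xi> \<noteq> 0}) \<and> 0 \<notin> closure {\<xi>. \<phi> \<xi> \<noteq> 0} \<longrightarrow>
        fourier_dist f \<phi> = fourier_dist T (\<lambda>\<xi>. of_real (norm \<xi> powr (- lam)) * \<phi> \<xi>))"

definition homogeneous_sobolev :: "real \<Rightarrow> real \<Rightarrow> 'a::euclidean_space distribution set" where
  "homogeneous_sobolev lam p =
     {f. tempered f \<and> (\<exists>g\<in>Lp_space p. is_riesz_potential lam (dist_of g) f)}"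

text \<open>\<open>I_(-lam) f\<close> as an element of \<open>L^p\<close>. For finite \<open>p\<close> it is unique up to a null set: two
  candidates differ by a polynomial, and no nonzero polynomial is in \<open>L^p\<close>.\<close>

definition riesz_derivative ::
    "real \<Rightarrow> real \<Rightarrow> 'a::euclidean_space distribution \<Rightarrow> 'a \<Rightarrow> complex" where
  "riesz_derivative lam p f = (SOME g. g \<in> Lp_space p \<and> is_riesz_potential lam (dist_of g) f)"

section \<open>Generalized Bochner-Riesz means\<close>

definition br_multiplier :: "real \<Rightarrow> real \<Rightarrow> real \<Rightarrow> 'a::euclidean_space \<Rightarrow> real" where
  "br_multiplier \<delta> \<gamma> R \<xi> = (max 0 (1 - norm \<xi> powr \<gamma> / R powr \<gamma>)) powr \<delta>"

definition br_error_symbol :: "real \<Rightarrow> real \<Rightarrow> real \<Rightarrow> 'a::euclidean_space \<Rightarrow> complex" where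
  "br_error_symbol \<delta> \<gamma> lam \<xi> = of_real ((br_multiplier \<delta> \<gamma> 1 \<xi> - 1) / norm \<xi> powr lam)"

definition br_error_kernel :: "real \<Rightarrow> real \<Rightarrow> real \<Rightarrow> 'a::euclidean_space \<Rightarrow> complex" where
  "br_error_kernel \<delta> \<gamma> lam = (SOME k. is_inverse_fourier k (br_error_symbol \<delta> \<gamma> lam))"

definition br_error_integrand ::
    "real \<Rightarrow> real \<Rightarrow> real \<Rightarrow> real \<Rightarrow> 'a::euclidean_space distribution \<Rightarrow> real \<Rightarrow> 'a \<Rightarrow> 'a \<Rightarrow> complex"
  where
  "br_error_integrand \<delta> \<gamma> lam p f R x y =
     of_real (R ^ DIM('a)) * br_error_kernel \<delta> \<gamma> lam (R *\<^sub>R y) * riesz_derivative lam p f (x - y)"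

text \<open>The value at \<open>x\<close> of \<open>S_R f - f\<close> for \<open>f\<close> in \<^term>\<open>homogeneous_sobolev lam p\<close>. With
  \<open>g = I_(-lam) f\<close>, the Fourier transform of \<open>R^lam (S_R f - f)\<close> is the symbol
  \<open>R^lam (br_multiplier \<delta> \<gamma> R \<xi> - 1) / |\<xi>|^lam = br_error_symbol \<delta> \<gamma> lam (\<xi> / R)\<close> times that of \<open>g\<close>.\<close>

definition br_error ::
    "real \<Rightarrow> real \<Rightarrow> real \<Rightarrow> real \<Rightarrow> 'a::euclidean_space distribution \<Rightarrow> real \<Rightarrow> 'a \<Rightarrow> complex"
  where
  "br_error \<delta> \<gamma> lam p f R x =
     of_real (R powr (- lam)) * (LINT y|lebesgue. br_error_integrand \<delta> \<gamma> lam p f R x y)"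

end

theory Submission
  imports Defs "HOL-Complex_Analysis.Complex_Analysis" "HOL-Probability.Distributions"
    "HOL-Real_Asymp.Real_Asymp"
begin

text \<open>
  Write \<open>n\<close> for the dimension and \<open>a = (n + 1) / 2 + \<delta>\<close>, so that \<open>n - a = (n - 1) / 2 - \<delta>\<close> and
  \<open>0 < a < n\<close>. Everything rests on the size of the kernel \<open>k\<close> of the error symbol:
  \<open>|k(y)| \<le> C |y|^(-a)\<close> (\<open>br_error_kernel_bound\<close>). As \<open>lam + \<delta> - (n - 1) / 2 = lam + a - n\<close>, multiplying
  the error by \<open>R^(lam + \<delta> - (n - 1) / 2)\<close> turns it into
  \<open>\<integral> Q_R(y) |y|^(-a) g(x - y) dy\<close> with \<open>Q_R(y) = (R |y|)^a k(R y)\<close>, and \<open>|Q_R| \<le> C\<close> for all \<open>R\<close>.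

  For almost every \<open>x\<close> the function \<open>y \<mapsto> |y|^(-a) g(x - y)\<close> is integrable
  (\<open>weighted_Lp_integrable\<close>): near the origin because \<open>a < n\<close>, far away because \<open>|y|^(-a)\<close> belongs there
  to the dual of \<open>L^p\<close>, which is the condition \<open>p < n / (n - a) = 2 n / (n - 1 - 2 \<delta>)\<close>. What has to be
  shown is therefore that \<open>\<integral> Q_R h \<longrightarrow> 0\<close> for every integrable \<open>h\<close>. No maximal function and no
  asymptotic expansion of \<open>k\<close> enters: by the uniform bound on \<open>Q_R\<close> a dense class of \<open>h\<close> suffices
  (\<open>null_against_integrable\<close>), and for \<open>h(y) = |y|^(-a) exp(-c |x - y|^2)\<close> the integral can be moved to
  the frequency side, where a bounded symbol is averaged against a modulated Gaussian of total mass one.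
  This gives \<open>|\<integral> Q_R h| \<le> D R^(a - n)\<close>, which tends to \<open>0\<close> (\<open>dilated_kernel_limit\<close>).

  The kernel bound comes from subordinating the symbol to the classical Bochner--Riesz multipliers
  \<open>(u - |\<xi>|^2)_+^\<beta>\<close>. With \<open>s = |\<xi>|^2\<close>, the symbol equals
  \<open>\<Sum>j<J. c_j (1 - s)_+^(\<delta> + j)\<close>, which carries its singularity on the unit sphere, plus a superposition
  \<open>\<integral> (u - s)_+^(J - 1) \<Phi>(u) du\<close> (\<open>symbol_subordination\<close>). Here \<open>\<Phi>(u) = O(u^(-J))\<close> at the
  origin because \<open>lam \<le> \<gamma>\<close>, and \<open>\<Phi>(u) = O(u^(-lam / 2 - J))\<close> at infinity; the condition
  \<open>lam > (n - 1) / 2 - \<delta>\<close> is what makes the superposed kernels converge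
  (\<open>kernel_pair_superposition\<close>). The kernel of \<open>(1 - |\<xi>|^2)_+^\<beta>\<close> is \<open>O(|y|^(-(n + 1) / 2 - \<beta>))\<close>
  (\<open>br_kernel_decay\<close>): along each ray it solves a Bessel equation, whose solutions are controlled by an
  energy estimate, so that Bessel functions themselves do not occur.

  The kernel in the definition of the error is chosen by Hilbert choice among all inverse Fourier
  transforms of the symbol. That these agree almost everywhere (\<open>inverse_fourier_unique\<close>) is another
  instance of the density of Gaussians.
\<close>

section \<open>Integration on Euclidean space\<close>

lemma integral_lborel_affine:
  fixes f :: "'a::euclidean_space \<Rightarrow> 'b::{banach,second_countable_topology}"
  assumes f: "f \<in> borel_measurable borel" and c: "c \<noteq> 0"
  shows "integrable lborel f \<longleftrightarrow> integrable lborel (\<lambda>x. f (t + c *\<^sub>R x))" (is ?A)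
    and "integral\<^sup>L lborel f = \<bar>c\<bar> ^ DIM('a) *\<^sub>R (LINT x|lborel. f (t + c *\<^sub>R x))" (is ?B)
proof -
  note [measurable] = f
  show ?A
    apply (subst lborel_affine[OF c, where t = t])
    apply (subst integrable_density)
       apply simp_all
    apply (subst integrable_distr_eq)
      apply simp_all
    using c integrable_scaleR_right[of "inverse (\<bar>c\<bar> ^ DIM('a))" lborel "\<lambda>x. \<bar>c\<bar> ^ DIM('a) *\<^sub>R f (t + c *\<^sub>R x)"]
    apply (auto intro!: integrable_scaleR_right)
    done
  show ?B
    apply (subst lborel_affine[OF c, where t = t])
    apply (subst integral_density)
       apply simp_all
    apply (subst integral_distr)
      apply simp_all
    done
qed

lemma nn_integral_lborel_affine:
  fixes f :: "'a::euclidean_space \<Rightarrow> ennreal"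
  assumes f: "f \<in> borel_measurable borel" and c: "c \<noteq> 0"
  shows "(\<integral>\<^sup>+x. f x \<partial>lborel) = ennreal (\<bar>c\<bar> ^ DIM('a)) * (\<integral>\<^sup>+x. f (t + c *\<^sub>R x) \<partial>lborel)"
proof -
  note [measurable] = f
  show ?thesis
    apply (subst lborel_affine[OF c, where t = t])
    apply (subst nn_integral_density)
      apply simp_all
    apply (subst nn_integral_distr)
      apply simp_all
    apply (subst nn_integral_cmult)
     apply simp_all
    done
qed

lemma AE_lborel_affine:
  fixes P :: "'a::euclidean_space \<Rightarrow> bool"
  assumes P: "AE x in lborel. P x" and c: "c \<noteq> 0"
  shows "AE x in lborel. P (t + c *\<^sub>R x)"
proof -
  obtain N where N: "{x. \<not> P x} \<subseteq> N" "N \<in> sets borel" "emeasure lborel N = 0"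
    using P by (auto elim!: AE_E)
  note [measurable] = N(2)
  have "0 = ennreal (\<bar>c\<bar> ^ DIM('a)) * (\<integral>\<^sup>+x. indicator N (t + c *\<^sub>R x) \<partial>(lborel :: 'a measure))"
    using nn_integral_lborel_affine[of "indicator N" c t] N c by simp
  then have "(\<integral>\<^sup>+x. indicator N (t + c *\<^sub>R x) \<partial>(lborel :: 'a measure)) = 0"
    using c by (auto simp: ennreal_zero_less_mult_iff)
  then have "AE x in (lborel :: 'a measure). indicator N (t + c *\<^sub>R x) = (0::ennreal)"
    by (subst (asm) nn_integral_0_iff_AE) auto
  then show ?thesis
    using N(1) by (auto elim!: eventually_mono simp: indicator_def split: if_splits)
qed

lemma set_integrable_powr_0:
  fixes e :: real assumes "e > -1" "c > 0"
  shows "set_integrable lborel {0<..c} (\<lambda>r. r powr e)"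
proof -
  have "(\<lambda>r. r powr e) integrable_on {0..c}"
    using has_integral_powr_from_0[of e c] assms by (auto intro: has_integral_integrable)
  then have "(\<lambda>r. r powr e) absolutely_integrable_on {0..c}"
    by (intro nonnegative_absolutely_integrable_1) auto
  then have "set_integrable lborel {0..c} (\<lambda>r. r powr e)"
    unfolding set_integrable_def by (subst (asm) integrable_completion) auto
  then show ?thesis by (rule set_integrable_subset) auto
qed

lemma set_integrable_powr_inf:
  fixes e :: real assumes "e < -1" "c > 0"
  shows "set_integrable lborel {c..} (\<lambda>r. r powr e)"
proof -
  have "(\<lambda>r. r powr e) integrable_on {c..}"
    using has_integral_powr_to_inf[of e c] assms by (auto intro: has_integral_integrable)
  then have "(\<lambda>r. r powr e) absolutely_integrable_on {c..}"
    by (intro nonnegative_absolutely_integrable_1) auto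
  then show "set_integrable lborel {c..} (\<lambda>r. r powr e)"
    unfolding set_integrable_def by (subst (asm) integrable_completion) auto
qed

text \<open>
  A substitute for polar coordinates: \<open>|x|^(-s)\<close> is comparable to the integral of \<open>r^(-s-1)\<close>
  over \<open>|x| < r < 2 |x|\<close>, and after exchanging the integrals the inner one is the volume of a ball.
  The set \<open>S\<close> collects the radii that occur for points of \<open>A\<close>.
\<close>

lemma nn_integral_radial_power_le:
  fixes s :: real and S :: "real set"
  assumes s: "s > 0" and S[measurable]: "S \<in> sets borel"
    and AS: "\<And>x::'a::euclidean_space. x \<in> A \<Longrightarrow> x \<noteq> 0 \<and> {norm x<..<2 * norm x} \<subseteq> S" 
    and A[measurable]: "A \<in> sets borel" and S0: "S \<subseteq> {0<..}"
  shows "(\<integral>\<^sup>+x. ennreal (norm x powr (-s)) * indicator A x \<partial>(lborel :: 'a measure))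
     \<le> ennreal (2 powr (s+1) * unit_ball_vol DIM('a)) *
        (\<integral>\<^sup>+r. ennreal (r powr (real DIM('a) - s - 1)) * indicator S r \<partial>lborel)"
proof -
  have 1: "ennreal (norm x powr (-s)) * indicator A x
      \<le> (\<integral>\<^sup>+r. ennreal (2 powr (s+1) * r powr (-s-1)) * indicator S r * indicator (ball 0 r) x \<partial>lborel)"
    for x :: 'a
  proof (cases "x \<in> A")
    case True
    then have x: "x \<noteq> 0" "{norm x<..<2 * norm x} \<subseteq> S" using AS by auto
    \<comment> \<open>The smallest value of \<open>r^(-s-1)\<close> on the interval, times its length.\<close>
    have "norm x powr (-s) = 2 powr (s+1) * (2 * norm x) powr (-s-1) * norm x"
      using x by (simp add: powr_mult powr_diff powr_add powr_minus field_simps)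
    then have "ennreal (norm x powr (-s))
      = (\<integral>\<^sup>+r. ennreal (2 powr (s+1) * (2 * norm x) powr (-s-1)) * indicator {norm x<..<2 * norm x} r \<partial>lborel)"
      by (subst nn_integral_cmult_indicator) (auto simp: ennreal_mult)
    also have "\<dots> \<le> (\<integral>\<^sup>+r. ennreal (2 powr (s+1) * r powr (-s-1)) * indicator S r * indicator (ball 0 r) x \<partial>lborel)"
    proof (rule nn_integral_mono)
      fix r :: real
      have "(2 * norm x) powr (-s-1) \<le> r powr (-s-1)" if "norm x < r" "r < 2 * norm x"
        using that s by (intro powr_mono2') (auto intro: le_less_trans[OF norm_ge_zero])
      then show "ennreal (2 powr (s+1) * (2 * norm x) powr (-s-1)) * indicator {norm x<..<2 * norm x} r
        \<le> ennreal (2 powr (s+1) * r powr (-s-1)) * indicator S r * indicator (ball 0 r) x"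
        using x(2) by (auto simp: indicator_def intro!: ennreal_leI)
    qed
    finally show ?thesis using True by simp
  qed simp
  have "(\<integral>\<^sup>+x. ennreal (norm x powr (-s)) * indicator A x \<partial>(lborel :: 'a measure))
    \<le> (\<integral>\<^sup>+x. \<integral>\<^sup>+r. ennreal (2 powr (s+1) * r powr (-s-1)) * indicator S r * indicator (ball 0 r) x \<partial>lborel \<partial>(lborel :: 'a measure))"
    by (intro nn_integral_mono 1)
  also have "\<dots> = (\<integral>\<^sup>+x. \<integral>\<^sup>+r. ennreal (2 powr (s+1) * r powr (-s-1)) * indicator S r * indicator {p. norm (fst p) < snd p} (x,r) \<partial>lborel \<partial>(lborel :: 'a measure))"
    by (simp add: indicator_def)
  also have "\<dots> = (\<integral>\<^sup>+r. \<integral>\<^sup>+x. ennreal (2 powr (s+1) * r powr (-s-1)) * indicator S r * indicator {p. norm (fst p) < snd p} (x,r) \<partial>(lborel :: 'a measure) \<partial>lborel)"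
    by (rule lborel_pair.Fubini'[symmetric]) measurable
  also have "\<dots> = (\<integral>\<^sup>+r. ennreal (2 powr (s+1) * unit_ball_vol DIM('a)) * (ennreal (r powr (real DIM('a) - s - 1)) * indicator S r) \<partial>lborel)"
  proof (rule nn_integral_cong)
    fix r :: real
    show "(\<integral>\<^sup>+x. ennreal (2 powr (s+1) * r powr (-s-1)) * indicator S r * indicator {p. norm (fst p) < snd p} (x,r) \<partial>(lborel :: 'a measure))
      = ennreal (2 powr (s+1) * unit_ball_vol DIM('a)) * (ennreal (r powr (real DIM('a) - s - 1)) * indicator S r)"
    proof (cases "r \<in> S")
      case True
      then have r: "r > 0" using S0 by auto
      have "(\<integral>\<^sup>+x. ennreal (2 powr (s+1) * r powr (-s-1)) * indicator S r * indicator {p. norm (fst p) < snd p} (x,r) \<partial>(lborel :: 'a measure))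
        = (\<integral>\<^sup>+x. ennreal (2 powr (s+1) * r powr (-s-1)) * indicator (ball 0 r) x \<partial>(lborel :: 'a measure))"
        using True by (simp add: indicator_def)
      also have "\<dots> = ennreal (2 powr (s+1) * r powr (-s-1)) * ennreal (unit_ball_vol DIM('a) * r ^ DIM('a))"
        using r by (subst nn_integral_cmult_indicator) (auto simp: emeasure_ball)
      also have "\<dots> = ennreal (2 powr (s+1) * unit_ball_vol DIM('a)) * ennreal (r powr (real DIM('a) - s - 1))"
        using r by (auto simp: ennreal_mult[symmetric] powr_diff powr_minus powr_realpow field_simps powr_add)
      finally show ?thesis using True by simp
    qed simp
  qed
  also have "\<dots> = ennreal (2 powr (s+1) * unit_ball_vol DIM('a)) *
        (\<integral>\<^sup>+r. ennreal (r powr (real DIM('a) - s - 1)) * indicator S r \<partial>lborel)"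
    by (intro nn_integral_cmult) measurable
  finally show ?thesis .
qed

lemma nn_set_integral_finite:
  fixes f :: "real \<Rightarrow> real"
  assumes "set_integrable lborel S f" "\<And>r. f r \<ge> 0" 
  shows "(\<integral>\<^sup>+r. ennreal (f r) * indicator S r \<partial>lborel) < \<infinity>"
proof -
  have "(\<integral>\<^sup>+r. ennreal (f r) * indicator S r \<partial>lborel) = (\<integral>\<^sup>+r. ennreal (norm (indicator S r *\<^sub>R f r)) \<partial>lborel)"
    using assms(2) by (intro nn_integral_cong) (auto simp: indicator_def)
  also have "\<dots> < \<infinity>" using assms(1) unfolding set_integrable_def by (simp add: integrable_iff_bounded)
  finally show ?thesis .
qed

lemma integrable_norm_powr_near:
  fixes s :: real
  assumes s: "0 < s" "s < DIM('a)"
  shows "integrable lborel (\<lambda>x::'a::euclidean_space. norm x powr (-s) * indicator (ball 0 1) x)"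
proof (rule integrableI_bounded)
  have [measurable]: "ball (0::'a) 1 \<in> sets borel" by simp
  show "(\<lambda>x::'a. norm x powr (-s) * indicator (ball 0 1) x) \<in> borel_measurable lborel" by measurable
  have "(\<integral>\<^sup>+x. ennreal (norm (norm x powr (-s) * indicator (ball 0 1) x)) \<partial>(lborel :: 'a measure))
     = (\<integral>\<^sup>+x. ennreal (norm x powr (-s)) * indicator (ball 0 1 - {0}) x \<partial>(lborel :: 'a measure))"
    using s by (intro nn_integral_cong) (auto simp: indicator_def)
  also have "\<dots> \<le> ennreal (2 powr (s+1) * unit_ball_vol DIM('a)) *
        (\<integral>\<^sup>+r. ennreal (r powr (real DIM('a) - s - 1)) * indicator {0<..2} r \<partial>lborel)"
    using s by (intro nn_integral_radial_power_le) auto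
  also have "\<dots> < \<infinity>"
    using nn_set_integral_finite[OF set_integrable_powr_0[of "real DIM('a) - s - 1" 2]] s
    by (simp add: ennreal_mult_less_top)
  finally show "(\<integral>\<^sup>+x. ennreal (norm (norm x powr (-s) * indicator (ball 0 1) x)) \<partial>(lborel :: 'a measure)) < \<infinity>" .
qed

lemma integrable_norm_powr_far:
  fixes s :: real
  assumes s: "s > DIM('a)"
  shows "integrable lborel (\<lambda>x::'a::euclidean_space. norm x powr (-s) * indicator (- ball 0 1) x)"
proof (rule integrableI_bounded)
  have s0: "s > 0" using s by (meson DIM_positive le_less_trans of_nat_0_le_iff)
  have "(\<integral>\<^sup>+x. ennreal (norm (norm x powr (-s) * indicator (- ball 0 1) x)) \<partial>(lborel :: 'a measure))
     = (\<integral>\<^sup>+x. ennreal (norm x powr (-s)) * indicator (- ball 0 1) x \<partial>(lborel :: 'a measure))"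
    using s by (intro nn_integral_cong) (auto simp: indicator_def)
  also have "\<dots> \<le> ennreal (2 powr (s+1) * unit_ball_vol DIM('a)) *
        (\<integral>\<^sup>+r. ennreal (r powr (real DIM('a) - s - 1)) * indicator {1..} r \<partial>lborel)"
    using s0 by (intro nn_integral_radial_power_le) (auto simp: dist_norm)
  also have "\<dots> < \<infinity>"
    using nn_set_integral_finite[OF set_integrable_powr_inf[of "real DIM('a) - s - 1" 1]] s
    by (simp add: ennreal_mult_less_top)
  finally show "(\<integral>\<^sup>+x. ennreal (norm (norm x powr (-s) * indicator (- ball 0 1) x)) \<partial>(lborel :: 'a measure)) < \<infinity>" .
qed measurable

lemma integrable_decay_weight:
  "integrable lborel (\<lambda>x::'a::euclidean_space. 1 / (1 + norm x) ^ Suc DIM('a))"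
proof -
  let ?s = "real DIM('a) + 1"
  have "integrable lborel (\<lambda>x::'a. indicator (ball 0 1) x + norm x powr (-?s) * indicator (- ball 0 1) x)"
    by (intro Bochner_Integration.integrable_add integrable_norm_powr_far) 
       (auto simp: emeasure_ball intro!: integrable_real_indicator)
  then show ?thesis
  proof (rule Bochner_Integration.integrable_bound, goal_cases)
    case 2
    show ?case
    proof (rule AE_I2)
      fix x :: 'a
      show "norm (1 / (1 + norm x) ^ Suc DIM('a)) \<le> norm (indicator (ball 0 1) x + norm x powr (-?s) * indicator (- ball 0 1) x)"
      proof (cases "norm x < 1")
        case True
        have "1 \<le> (1 + norm x) ^ Suc DIM('a)" by (intro one_le_power) simp
        then have "1 / (1 + norm x) ^ Suc DIM('a) \<le> 1" by (subst divide_le_eq_1_pos) linarith+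
        then show ?thesis using True by (simp add: dist_norm del: power_Suc)
      next
        case False
        then have x: "norm x > 0" by linarith
        have "1 / (1 + norm x) ^ Suc DIM('a) \<le> 1 / norm x ^ Suc DIM('a)"
          using x by (intro divide_left_mono power_mono mult_pos_pos zero_less_power add_pos_pos) auto
        also have "\<dots> = norm x powr (-?s)"
          using x by (simp add: powr_minus powr_add powr_diff powr_realpow field_simps)
        finally show ?thesis using False by (simp add: dist_norm del: power_Suc)
      qed
    qed
  qed measurable
qed

text \<open>
  The exponent \<open>n + 1\<close> is the integer form of integrable decay used throughout for Schwartz
  functions, for functions supported in the unit ball and for Gaussians.
\<close>

lemma integrable_decay:
  fixes f :: "'a::euclidean_space \<Rightarrow> complex"
  assumes [measurable]: "f \<in> borel_measurable borel"
    and B: "\<And>x::'a. norm (f x) * (1 + norm x) ^ Suc DIM('a) \<le> B"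
  shows "integrable lborel f"
proof -
  have "integrable lborel (\<lambda>x::'a. B * (1 / (1 + norm x) ^ Suc DIM('a)))"
    by (intro integrable_mult_right integrable_decay_weight)
  then show ?thesis
  proof (rule Bochner_Integration.integrable_bound)
    show "AE x in lborel. norm (f x) \<le> norm (B * (1 / (1 + norm x) ^ Suc DIM('a)))"
    proof (rule AE_I2)
      fix x :: 'a
      have "0 < (1 + norm x) ^ Suc DIM('a)" by (intro zero_less_power) (simp add: add_pos_nonneg)
      then have "norm (f x) \<le> B / (1 + norm x) ^ Suc DIM('a)"
        using B[of x] by (subst pos_le_divide_eq)
      also have "\<dots> \<le> \<bar>B\<bar> / (1 + norm x) ^ Suc DIM('a)"
        by (intro divide_right_mono) (auto simp del: power_Suc)
      finally show "norm (f x) \<le> norm (B * (1 / (1 + norm x) ^ Suc DIM('a)))" by (simp del: power_Suc)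
    qed
  qed simp
qed

lemma vector_derivative_bound:
  fixes G :: "real \<Rightarrow> complex"
  assumes "convex S" and "\<And>t. t \<in> S \<Longrightarrow> (G has_vector_derivative G' t) (at t)"
    and "\<And>t. t \<in> S \<Longrightarrow> norm (G' t) \<le> B" and "s \<in> S" "t \<in> S"
  shows "norm (G s - G t) \<le> B * \<bar>s - t\<bar>"
proof -
  have "norm (G s - G t) \<le> B * norm (s - t)"
  proof (rule differentiable_bound[of S G "\<lambda>t x. x *\<^sub>R G' t"])
    fix t assume "t \<in> S"
    then show "(G has_derivative (\<lambda>x. x *\<^sub>R G' t)) (at t within S)"
      using assms(2) by (auto simp: has_vector_derivative_def intro: has_derivative_at_withinI)
    show "onorm (\<lambda>x. x *\<^sub>R G' t) \<le> B"
      using assms(3)[OF \<open>t \<in> S\<close>] by (intro onorm_le) (auto simp: mult.commute[of B] mult_left_mono)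
  qed (use assms in auto)
  then show ?thesis by simp
qed

lemma has_vector_derivative_iff_quotient:
  fixes f :: "real \<Rightarrow> 'b::real_normed_vector"
  shows "(f has_vector_derivative D) (at t) \<longleftrightarrow> ((\<lambda>s. (f s - f t) /\<^sub>R (s - t)) \<longlongrightarrow> D) (at t)"
proof -
  have eq: "norm ((f s - f t) - (s - t) *\<^sub>R D) / norm (s - t) = norm ((f s - f t) /\<^sub>R (s - t) - D)"
    if "s \<noteq> t" for s
  proof -
    have "(f s - f t) - (s - t) *\<^sub>R D = (s - t) *\<^sub>R ((f s - f t) /\<^sub>R (s - t) - D)"
      using that by (simp add: scaleR_diff_right)
    then show ?thesis using that by simp
  qed
  have "(f has_vector_derivative D) (at t) \<longleftrightarrow>
      ((\<lambda>s. norm ((f s - f t) - (s - t) *\<^sub>R D) / norm (s - t)) \<longlongrightarrow> 0) (at t)"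
    by (simp add: has_vector_derivative_def has_derivative_iff_norm bounded_linear_scaleR_left)
  also have "\<dots> \<longleftrightarrow> ((\<lambda>s. norm ((f s - f t) /\<^sub>R (s - t) - D)) \<longlongrightarrow> 0) (at t)"
    by (rule filterlim_cong) (auto simp: eventually_at eq[unfolded real_norm_def] intro!: exI[of _ 1])
  also have "\<dots> \<longleftrightarrow> ((\<lambda>s. (f s - f t) /\<^sub>R (s - t)) \<longlongrightarrow> D) (at t)"
    by (simp only: tendsto_norm_zero_iff Lim_null[symmetric])
  finally show ?thesis .
qed

text \<open>
  The integral of \<open>F(x + t v)\<close> over \<open>x\<close> does not depend on \<open>t\<close>, so its derivative vanishes; the decay
  of \<open>D\<close> dominates the difference quotients. Every integration by parts below is the case where \<open>F\<close> is
  a product, which is why no boundary terms are ever mentioned.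
\<close>

lemma integral_directional_derivative:
  fixes F D :: "'a::euclidean_space \<Rightarrow> complex"
  assumes der: "\<And>x. ((\<lambda>t::real. F (x + t *\<^sub>R v)) has_vector_derivative D x) (at 0)"
    and dec: "\<And>x. norm (D x) * (1 + norm x) ^ Suc DIM('a) \<le> B"
    and int: "integrable lborel F"
  shows "integrable lborel D" and "integral\<^sup>L lborel D = 0"
proof -
  define h where "h = (\<lambda>i. 1 / real (Suc i))"
  define s where "s = (\<lambda>i x. (F (x + h i *\<^sub>R v) - F x) /\<^sub>R h i)"
  have Fm[measurable]: "F \<in> borel_measurable borel" using int by simp
  have h: "h i > 0" "h i \<le> 1" for i by (auto simp: h_def)
  have h0: "h \<longlonglongrightarrow> 0" unfolding h_def by (rule LIMSEQ_Suc) (rule lim_const_over_n)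
  have sm[measurable]: "s i \<in> borel_measurable borel" for i unfolding s_def by measurable
  have lim: "(\<lambda>i. s i x) \<longlonglongrightarrow> D x" for x
  proof -
    have "((\<lambda>t. (F (x + t *\<^sub>R v) - F x) /\<^sub>R t) \<longlongrightarrow> D x) (at 0)"
      using der[of x] by (simp add: has_vector_derivative_iff_quotient)
    moreover have "filterlim h (at 0) sequentially"
      using h0 h(1) by (auto simp: filterlim_at less_imp_neq[symmetric] intro!: always_eventually)
    ultimately show ?thesis unfolding s_def by (rule filterlim_compose)
  qed
  have Dm[measurable]: "D \<in> borel_measurable borel"
    by (rule borel_measurable_LIMSEQ_metric[OF sm lim])
  show Di: "integrable lborel D" by (rule integrable_decay[OF Dm dec])
  have dert: "((\<lambda>t::real. F (x + t *\<^sub>R v)) has_vector_derivative D (x + t *\<^sub>R v)) (at t)" for x t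
  proof -
    have "((\<lambda>\<tau>::real. F ((x + t *\<^sub>R v) + \<tau> *\<^sub>R v)) has_vector_derivative D (x + t *\<^sub>R v)) (at (t - t))"
      using der[of "x + t *\<^sub>R v"] by simp
    then have "((\<lambda>\<tau>. F ((x + t *\<^sub>R v) + \<tau> *\<^sub>R v)) \<circ> (\<lambda>\<tau>. \<tau> - t) has_vector_derivative 1 *\<^sub>R D (x + t *\<^sub>R v)) (at t)"
      by (intro vector_diff_chain_at) (auto intro!: derivative_eq_intros)
    then show ?thesis by (simp add: o_def scaleR_diff_left)
  qed
  define W where "W = (\<lambda>x::'a. \<bar>B\<bar> * (1 + norm v) ^ Suc DIM('a) * (1 / (1 + norm x) ^ Suc DIM('a)))"
  have bnd: "norm (s i x) \<le> W x" for i x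
  proof -
    have "norm (F (x + h i *\<^sub>R v) - F (x + 0 *\<^sub>R v)) \<le> W x * \<bar>h i - 0\<bar>"
    proof (rule vector_derivative_bound[where S = "{0..h i}"])
      fix t assume t: "t \<in> {0..h i}"
      show "((\<lambda>t. F (x + t *\<^sub>R v)) has_vector_derivative D (x + t *\<^sub>R v)) (at t)" by (rule dert)
      let ?y = "x + t *\<^sub>R v"
      have "norm x \<le> norm ?y + norm (t *\<^sub>R v)" by (metis add_diff_cancel_right' norm_triangle_ineq4)
      moreover have "norm (t *\<^sub>R v) \<le> norm v" using t h(2)[of i] by (auto intro!: mult_left_le_one_le)
      ultimately have "norm x \<le> norm ?y + norm v" by linarith
      then have "1 + norm x \<le> (1 + norm ?y) * (1 + norm v)"
        using mult_nonneg_nonneg[OF norm_ge_zero[of ?y] norm_ge_zero[of v]]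
        unfolding distrib_left distrib_right mult_1_left mult_1_right by linarith
      then have le: "(1 + norm x) ^ Suc DIM('a) \<le> (1 + norm ?y) ^ Suc DIM('a) * (1 + norm v) ^ Suc DIM('a)"
        by (metis power_mono power_mult_distrib add_nonneg_nonneg norm_ge_zero zero_le_one)
      have "norm (D ?y) * (1 + norm x) ^ Suc DIM('a) \<le> norm (D ?y) * ((1 + norm ?y) ^ Suc DIM('a) * (1 + norm v) ^ Suc DIM('a))"
        by (intro mult_left_mono le) simp
      also have "\<dots> \<le> \<bar>B\<bar> * (1 + norm v) ^ Suc DIM('a)"
        unfolding mult.assoc[symmetric] by (intro mult_right_mono order.trans[OF dec]) auto
      finally have "norm (D ?y) * (1 + norm x) ^ Suc DIM('a) \<le> \<bar>B\<bar> * (1 + norm v) ^ Suc DIM('a)" .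
      moreover have "0 < (1 + norm x) ^ Suc DIM('a)" by (intro zero_less_power) (simp add: add_pos_nonneg)
      ultimately have "norm (D ?y) \<le> \<bar>B\<bar> * (1 + norm v) ^ Suc DIM('a) / (1 + norm x) ^ Suc DIM('a)"
        by (subst pos_le_divide_eq)
      then show "norm (D ?y) \<le> W x" by (simp add: W_def del: power_Suc)
    qed (use h[of i] in auto)
    then have "norm (F (x + h i *\<^sub>R v) - F x) / h i \<le> W x"
      using h(1)[of i] by (simp add: pos_divide_le_eq)
    then show ?thesis unfolding s_def using h(1)[of i] by (simp add: divide_inverse mult.commute)
  qed
  have "(\<lambda>i. integral\<^sup>L lborel (s i)) \<longlonglongrightarrow> integral\<^sup>L lborel D"
  proof (rule integral_dominated_convergence[where w = W])
    show "integrable lborel W" unfolding W_def by (intro integrable_mult_right integrable_decay_weight)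
  qed (use lim bnd in auto)
  moreover have "integral\<^sup>L lborel (s i) = 0" for i
  proof -
    have eq: "integrable lborel (\<lambda>x. F (x + h i *\<^sub>R v))" "(LINT x|lborel. F (x + h i *\<^sub>R v)) = integral\<^sup>L lborel F"
      using integral_lborel_affine[OF Fm, of 1 "h i *\<^sub>R v"] int by (simp_all add: add.commute)
    show ?thesis unfolding s_def using eq int by (simp add: Bochner_Integration.integral_diff)
  qed
  ultimately show "integral\<^sup>L lborel D = 0" by (simp add: LIMSEQ_const_iff)
qed

lemma has_vector_derivative_integral:
  fixes G G' :: "real \<Rightarrow> 'a::euclidean_space \<Rightarrow> complex"
  assumes der: "\<And>t x. ((\<lambda>t. G t x) has_vector_derivative G' t x) (at t)"
    and int: "\<And>t. integrable lborel (G t)"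
    and bnd: "\<And>t x. norm (G' t x) \<le> W x" and W: "integrable lborel W"
  shows "((\<lambda>t. integral\<^sup>L lborel (G t)) has_vector_derivative (integral\<^sup>L lborel (G' t))) (at t)"
  unfolding has_vector_derivative_iff_quotient
proof (subst tendsto_at_iff_sequentially, intro allI impI)
  fix X :: "nat \<Rightarrow> real" assume X: "\<forall>i. X i \<in> UNIV - {t}" "X \<longlonglongrightarrow> t"
  have [measurable]: "G t \<in> borel_measurable borel" for t using int[of t] by simp
  have lim: "(\<lambda>i. (G (X i) x - G t x) /\<^sub>R (X i - t)) \<longlonglongrightarrow> G' t x" for x
    using der[of x t] X unfolding has_vector_derivative_iff_quotient tendsto_at_iff_sequentially
    by (auto simp: o_def)
  have "(\<lambda>i. LINT x|lborel. (G (X i) x - G t x) /\<^sub>R (X i - t)) \<longlonglongrightarrow> integral\<^sup>L lborel (G' t)"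
  proof (rule integral_dominated_convergence[where w = W])
    show "AE x in lborel. norm ((G (X i) x - G t x) /\<^sub>R (X i - t)) \<le> W x" for i
    proof (rule AE_I2)
      fix x
      have "norm (G (X i) x - G t x) \<le> W x * \<bar>X i - t\<bar>"
        by (rule vector_derivative_bound[where S = UNIV and G = "\<lambda>t. G t x"]) (auto intro: der bnd)
      moreover have "X i \<noteq> t" using X by auto
      ultimately have "norm (G (X i) x - G t x) / \<bar>X i - t\<bar> \<le> W x"
        by (simp add: pos_divide_le_eq)
      then show "norm ((G (X i) x - G t x) /\<^sub>R (X i - t)) \<le> W x"
        by (simp add: divide_inverse mult.commute)
    qed
    show "G' t \<in> borel_measurable lborel"
    proof -
      have "(\<lambda>x. (G (X i) x - G t x) /\<^sub>R (X i - t)) \<in> borel_measurable borel" for i by measurable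
      from borel_measurable_LIMSEQ_metric[OF this lim] show ?thesis by simp
    qed
  qed (use lim W in auto)
  moreover have "(LINT x|lborel. (G (X i) x - G t x) /\<^sub>R (X i - t))
     = (integral\<^sup>L lborel (G (X i)) - integral\<^sup>L lborel (G t)) /\<^sub>R (X i - t)" for i
    using int by (simp only: integral_scaleR_right Bochner_Integration.integral_diff)
  ultimately show "((\<lambda>s. (integral\<^sup>L lborel (G s) - integral\<^sup>L lborel (G t)) /\<^sub>R (s - t)) \<circ> X) \<longlonglongrightarrow> integral\<^sup>L lborel (G' t)"
    by (simp only: o_def)
qed

section \<open>Bochner--Riesz kernels of the ball\<close>

definition unit_char :: "real \<Rightarrow> complex" where
  "unit_char \<theta> = exp (2 * of_real pi * \<i> * of_real \<theta>)"

lemma unit_char_eq_cis: "unit_char \<theta> = cis (2 * pi * \<theta>)"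
  by (simp add: unit_char_def cis_conv_exp mult_ac)

lemma norm_unit_char [simp]: "norm (unit_char \<theta>) = 1"
  by (simp add: unit_char_eq_cis)

lemma unit_char_0 [simp]: "unit_char 0 = 1"
  by (simp add: unit_char_def)

lemma unit_char_add: "unit_char (s + t) = unit_char s * unit_char t"
  by (simp add: unit_char_def exp_add[symmetric] distrib_left)

lemma continuous_on_unit_char [continuous_intros]:
  "continuous_on S f \<Longrightarrow> continuous_on S (\<lambda>x. unit_char (f x))"
  unfolding unit_char_def by (intro continuous_intros)

lemma borel_measurable_unit_char [measurable]: "unit_char \<in> borel_measurable borel"
  by (intro borel_measurable_continuous_onI continuous_intros)

lemma has_vector_derivative_unit_char:
  "((\<lambda>t. unit_char (a + t * b)) has_vector_derivative 2 * of_real pi * \<i> * of_real b * unit_char (a + t * b)) (at t)"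
proof -
  have "((\<lambda>z. exp (2 * of_real pi * \<i> * (of_real a + z * of_real b))) has_field_derivative
      2 * of_real pi * \<i> * of_real b * exp (2 * of_real pi * \<i> * (of_real a + of_real t * of_real b))) (at (of_real t))"
    by (auto intro!: derivative_eq_intros simp: algebra_simps)
  from has_vector_derivative_real_field[OF this] show ?thesis
    by (simp add: unit_char_def)
qed

lemma norm_of_real_unit_char: "norm (of_real r * unit_char s) = \<bar>r\<bar>"
  by (simp add: norm_mult)

lemma fourier_eq: "fourier \<phi> \<xi> = (LINT x|lebesgue. \<phi> x * unit_char (- (x \<bullet> \<xi>)))"
  by (simp add: fourier_def unit_char_def)

text \<open>
  The factor \<open>(1 - |x|^2)\<close>, instead of \<open>1 - |x|\<close>, is smooth at the origin; only the unit sphere is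
  singular.
\<close>

definition br_bump :: "real \<Rightarrow> 'a::euclidean_space \<Rightarrow> real" where
  "br_bump \<beta> x = (max 0 (1 - (norm x)\<^sup>2)) powr \<beta>"

text \<open>
  Up to a constant this is \<open>|y|^(-n/2 - \<beta>) J_(n/2 + \<beta>)(2 \<pi> |y|)\<close> with the Bessel function \<open>J\<close>.
\<close>

definition br_kernel :: "real \<Rightarrow> 'a::euclidean_space \<Rightarrow> complex" where
  "br_kernel \<beta> y = (LINT x|lborel. of_real (br_bump \<beta> x) * unit_char (x \<bullet> y))"

lemma br_bump_nonneg: "br_bump \<beta> x \<ge> 0" by (simp add: br_bump_def)

lemma br_bump_le_1: "\<beta> \<ge> 0 \<Longrightarrow> br_bump \<beta> x \<le> 1"
  unfolding br_bump_def by (rule powr_le1) auto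

lemma br_bump_eq_0: "norm x \<ge> 1 \<Longrightarrow> br_bump \<beta> x = 0"
  by (simp add: br_bump_def)

lemma measurable_br_bump [measurable]: "br_bump \<beta> \<in> borel_measurable borel"
  unfolding br_bump_def by measurable

lemma br_bump_Suc: "\<beta> > 0 \<Longrightarrow> (norm x)\<^sup>2 * br_bump \<beta> x = br_bump \<beta> x - br_bump (\<beta> + 1) x"
  by (auto simp: br_bump_def powr_add max_def algebra_simps)

lemma br_bump_mult_decay:
  fixes x :: "'a::euclidean_space"
  assumes "\<beta> \<ge> 0" and p: "norm x \<le> 1 \<Longrightarrow> norm (p x) \<le> C" and C: "C \<ge> 0"
  shows "norm (of_real (br_bump \<beta> x) * p x :: complex) * (1 + norm x) ^ Suc DIM('a) \<le> C * 2 ^ Suc DIM('a)"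
proof (cases "norm x \<le> 1")
  case True
  have "norm (of_real (br_bump \<beta> x) * p x :: complex) = br_bump \<beta> x * norm (p x)"
    by (simp add: norm_mult br_bump_nonneg)
  also have "\<dots> \<le> 1 * C"
    using br_bump_le_1[OF assms(1), of x] p True br_bump_nonneg[of \<beta> x] by (intro mult_mono) auto
  finally have "norm (of_real (br_bump \<beta> x) * p x :: complex) \<le> C" by simp
  moreover have "(1 + norm x) ^ Suc DIM('a) \<le> 2 ^ Suc DIM('a)" using True by (intro power_mono) auto
  ultimately show ?thesis using C by (intro mult_mono) auto
qed (use br_bump_eq_0[of x \<beta>] C in auto)

lemma integrable_br_bump_mult:
  fixes p :: "'a::euclidean_space \<Rightarrow> complex"
  assumes "\<beta> \<ge> 0" and [measurable]: "p \<in> borel_measurable borel" and p: "\<And>x. norm x \<le> 1 \<Longrightarrow> norm (p x) \<le> C" 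
  shows "integrable lborel (\<lambda>x. of_real (br_bump \<beta> x) * p x)"
proof (rule integrable_decay)
  have C: "C \<ge> 0" using p[of 0] order_trans[OF norm_ge_zero] by simp
  fix x :: 'a show "norm (of_real (br_bump \<beta> x) * p x :: complex) * (1 + norm x) ^ Suc DIM('a) \<le> C * 2 ^ Suc DIM('a)"
    by (rule br_bump_mult_decay) (use assms C in auto)
qed measurable

text \<open>
  The additional order makes the kink at the origin differentiable: there the difference quotients
  are \<open>O(|h|^\<beta>)\<close>.
\<close>

lemma DERIV_pos_part_powr:
  fixes \<beta> :: real assumes \<beta>: "\<beta> > 0"
  shows "((\<lambda>u. (max 0 u) powr (\<beta> + 1)) has_real_derivative (\<beta> + 1) * (max 0 u) powr \<beta>) (at u)"
proof -
  consider "u < 0" | "u > 0" | "u = 0" by linarith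
  then show ?thesis
  proof cases
    case 1
    have "((\<lambda>u. 0::real) has_real_derivative 0) (at u)" by simp
    then have "((\<lambda>u. (max 0 u) powr (\<beta> + 1)) has_real_derivative 0) (at u)"
    proof (rule has_field_derivative_transform_within[where d = "- u"])
      fix x assume "dist x u < - u"
      then have "x < 0" by (auto simp: dist_real_def)
      then show "0 = max 0 x powr (\<beta> + 1)" by simp
    qed (use 1 in auto)
    then show ?thesis using 1 by simp
  next
    case 2
    have "((\<lambda>u. u powr (\<beta> + 1)) has_real_derivative (\<beta> + 1) * u powr \<beta>) (at u)"
      using has_real_derivative_powr[OF 2, of "\<beta> + 1"] by simp
    then have "((\<lambda>u. (max 0 u) powr (\<beta> + 1)) has_real_derivative (\<beta> + 1) * u powr \<beta>) (at u)"
    proof (rule has_field_derivative_transform_within[where d = u])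
      fix x assume "dist x u < u"
      then have "x > 0" by (auto simp: dist_real_def)
      then show "x powr (\<beta> + 1) = max 0 x powr (\<beta> + 1)" by simp
    qed (use 2 in auto)
    then show ?thesis using 2 by simp
  next
    case 3
    have "((\<lambda>h. (max 0 h powr (\<beta> + 1)) / h) \<longlongrightarrow> 0) (at 0)"
    proof (rule Lim_null_comparison)
      show "((\<lambda>h. \<bar>h\<bar> powr \<beta>) \<longlongrightarrow> 0) (at (0::real))"
        using \<beta> by (auto intro!: tendsto_eq_intros)
      show "\<forall>\<^sub>F h in at 0. norm (max 0 h powr (\<beta> + 1) / h) \<le> \<bar>h\<bar> powr \<beta>"
        using \<beta> by (auto simp: max_def powr_add intro!: always_eventually)
    qed
    then show ?thesis using 3 \<beta> by (simp add: has_field_derivative_iff)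
  qed
qed

lemma has_vector_derivative_br_bump:
  fixes x v :: "'a::euclidean_space"
  assumes \<beta>: "\<beta> > 0"
  shows "((\<lambda>t. complex_of_real (br_bump (\<beta> + 1) (x + t *\<^sub>R v))) has_vector_derivative
      of_real (- 2 * (\<beta> + 1) * (x \<bullet> v) * br_bump \<beta> x)) (at 0)"
proof -
  have eq: "(norm (x + t *\<^sub>R v))\<^sup>2 = (norm x)\<^sup>2 + 2 * t * (x \<bullet> v) + t\<^sup>2 * (norm v)\<^sup>2" for t
    unfolding power2_norm_eq_inner
    by (simp add: inner_add_left inner_add_right inner_commute power2_eq_square algebra_simps)
  have "((\<lambda>t. 1 - (norm (x + t *\<^sub>R v))\<^sup>2) has_real_derivative (- 2 * (x \<bullet> v))) (at 0)"
    unfolding eq by (auto intro!: derivative_eq_intros)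
  from DERIV_chain2[OF DERIV_pos_part_powr[OF \<beta>] this]
  have "((\<lambda>t. br_bump (\<beta> + 1) (x + t *\<^sub>R v)) has_real_derivative - 2 * (\<beta> + 1) * (x \<bullet> v) * br_bump \<beta> x) (at 0)"
    unfolding br_bump_def by (rule DERIV_cong) (simp add: algebra_simps)
  then show ?thesis
    by (intro has_vector_derivative_of_real) (simp add: has_real_derivative_iff_has_vector_derivative)
qed

text \<open>
  The product rule for one coordinate of the field \<open>(1 - |x|^2)_+^(\<beta>+1) exp(2 \<pi> \<i> t x \<bullet> e) x\<close>; here
  \<open>B1\<close>, \<open>B0\<close> are the powers with exponents \<open>\<beta> + 1\<close> and \<open>\<beta>\<close>, \<open>E\<close> is the wave and \<open>r\<close> the coordinate.
\<close>

lemma coordinate_wave_product_rule: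
  fixes B1 B0 r \<beta> :: real and K E :: complex
  shows "of_real B1 * (of_real r * (K * E) + 1 * E) + of_real (-2 * (\<beta> + 1) * r * B0) * (of_real r * E)
    = of_real B1 * E + of_real B1 * (of_real r * K * E) + of_real B0 * (of_real (-2 * (\<beta> + 1) * r\<^sup>2) * E)"
  by (simp add: power2_eq_square algebra_simps)

text \<open>
  Summation over the coordinates, which assembles the divergence of the same field.
\<close>

lemma sum_coordinate_wave_terms:
  fixes B1 B0 c t :: real and I E :: complex and f g h :: "'b \<Rightarrow> real"
  assumes "finite S"
  shows "(\<Sum>b\<in>S. of_real B1 * E + of_real B1 * (of_real (f b) * (I * of_real (t * g b)) * E) + of_real B0 * (of_real (- 2 * c * h b) * E))
    = of_real (real (card S)) * (of_real B1 * E) + of_real B1 * (I * of_real t * of_real (\<Sum>b\<in>S. f b * g b) * E)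
      + of_real B0 * (- 2 * of_real c * of_real (\<Sum>b\<in>S. h b) * E)"
  using assms by (induction S) (simp_all add: algebra_simps)

subsection \<open>The ordinary differential equation along rays\<close>

text \<open>
  Eliminating \<open>\<psi>\<close> gives Bessel's equation \<open>\<phi>'' + (2 A / t) \<phi>' + 4 \<pi>\<^sup>2 \<phi> = 0\<close>. The function
  \<open>v = t\<^sup>A \<phi>\<close> then solves \<open>v'' = (A (A - 1) / t\<^sup>2 - 4 \<pi>\<^sup>2) v\<close>, a harmonic oscillator with a perturbation that
  is integrable at infinity. Its energy stays bounded, so \<open>v\<close> is bounded and \<open>\<phi>\<close> decays like
  \<open>t\<close> to the power \<open>-A\<close>. Keeping the first-order system avoids differentiating \<open>\<phi>\<close> twice.
\<close>

lemma ray_system_bound: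
  fixes \<phi> \<psi> \<phi>' \<psi>' :: "real \<Rightarrow> complex" and \<beta> n B :: real
  defines "A \<equiv> \<beta> + (n + 1) / 2" and "c \<equiv> 2 * pi\<^sup>2 / (\<beta> + 1)"
  assumes \<beta>: "\<beta> > 0" and n: "n \<ge> 1"
    and \<phi>: "\<And>t. t > 0 \<Longrightarrow> (\<phi> has_vector_derivative \<phi>' t) (at t)"
    and \<psi>: "\<And>t. t > 0 \<Longrightarrow> (\<psi> has_vector_derivative \<psi>' t) (at t)"
    and \<phi>': "\<And>t. t > 0 \<Longrightarrow> \<phi>' t = - of_real (c * t) * \<psi> t"
    and \<psi>': "\<And>t. t > 0 \<Longrightarrow> of_real t * \<psi>' t = - of_real n * \<psi> t + 2 * of_real (\<beta> + 1) * (\<phi> t - \<psi> t)"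
    and B: "norm (\<phi> 1) \<le> B" "norm (\<psi> 1) \<le> B" and t: "t \<ge> 1"
  shows "norm (\<phi> t) \<le> B * sqrt ((4 * pi\<^sup>2 + (A + c)\<^sup>2) * exp (A * (A - 1))) * t powr (- A)"
proof -
  define \<kappa> where "\<kappa> = A * (A - 1)"
  have A: "A > 1" using \<beta> n unfolding A_def by argo
  have c: "c > 0" "c * (\<beta> + 1) = 2 * pi\<^sup>2" using \<beta> by (simp_all add: c_def)
  have \<kappa>: "\<kappa> \<ge> 0" using A by (simp add: \<kappa>_def)
  define v where "v = (\<lambda>t. (t powr A) *\<^sub>R \<phi> t)"
  \<comment> \<open>The derivative of \<open>v\<close>, with \<open>\<phi>'\<close> already expressed through \<open>\<psi>\<close>.\<close>
  define w where "w = (\<lambda>t. (A * t powr (A - 1)) *\<^sub>R \<phi> t - (c * t powr (A + 1)) *\<^sub>R \<psi> t)"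
  have v': "(v has_vector_derivative w t) (at t)" if t: "t > 0" for t
  proof -
    have "(v has_vector_derivative ((t powr A) *\<^sub>R \<phi>' t + (A * t powr (A - 1)) *\<^sub>R \<phi> t)) (at t)"
      unfolding v_def using t \<phi>[OF t] 
      by (intro has_vector_derivative_scaleR) (auto intro!: derivative_eq_intros)
    also have "(t powr A) *\<^sub>R \<phi>' t + (A * t powr (A - 1)) *\<^sub>R \<phi> t = w t"
      using t by (simp add: w_def \<phi>' scaleR_conv_of_real powr_add algebra_simps)
    finally show ?thesis .
  qed
  have w': "(w has_vector_derivative (\<kappa> / t\<^sup>2 - 4 * pi\<^sup>2) *\<^sub>R v t) (at t)" if t: "t > 0" for t
  proof -
    have "(w has_vector_derivative (((A * t powr (A - 1)) *\<^sub>R \<phi>' t + (A * ((A - 1) * t powr (A - 2))) *\<^sub>R \<phi> t)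
        - ((c * t powr (A + 1)) *\<^sub>R \<psi>' t + (c * ((A + 1) * t powr A)) *\<^sub>R \<psi> t))) (at t)"
      unfolding w_def using t \<phi>[OF t] \<psi>[OF t]
      by (intro has_vector_derivative_scaleR has_vector_derivative_diff) 
         (auto intro!: derivative_eq_intros)
    also have "\<psi>' t = of_real (1/t) * (- of_real n * \<psi> t + 2 * of_real (\<beta> + 1) * (\<phi> t - \<psi> t))"
      using \<psi>'[OF t] t by (simp add: field_simps)
    also have "(((A * t powr (A - 1)) *\<^sub>R \<phi>' t + (A * ((A - 1) * t powr (A - 2))) *\<^sub>R \<phi> t)
        - ((c * t powr (A + 1)) *\<^sub>R (of_real (1/t) * (- of_real n * \<psi> t + 2 * of_real (\<beta> + 1) * (\<phi> t - \<psi> t))) + (c * ((A + 1) * t powr A)) *\<^sub>R \<psi> t))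
      = (A * (A - 1) * t powr (A - 2) - 2 * (c * (\<beta> + 1)) * t powr (A + 1) / t) *\<^sub>R \<phi> t
       + (- c * A * t powr (A - 1) * t + c * (n + 2 * (\<beta> + 1)) * t powr (A + 1) / t - c * (A + 1) * t powr A) *\<^sub>R \<psi> t"
      using t by (simp add: \<phi>' scaleR_conv_of_real algebra_simps add_divide_distrib)
    also have "A * (A - 1) * t powr (A - 2) - 2 * (c * (\<beta> + 1)) * t powr (A + 1) / t = (\<kappa> / t\<^sup>2 - 4 * pi\<^sup>2) * t powr A"
      using t unfolding c(2) by (simp add: \<kappa>_def powr_add powr_diff field_simps power2_eq_square)
    also have "- c * A * t powr (A - 1) * t + c * (n + 2 * (\<beta> + 1)) * t powr (A + 1) / t - c * (A + 1) * t powr A = c * t powr A * (n + 2 * \<beta> + 1 - 2 * A)"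
      using t by (simp add: powr_add powr_diff field_simps)
    also have "n + 2 * \<beta> + 1 - 2 * A = 0" by (simp add: A_def field_simps)
    finally show ?thesis by (simp add: v_def)
  qed
  \<comment> \<open>The energy of the unperturbed oscillator: it changes only through the perturbation, and
    \<open>E' \<le> (\<kappa> / t\<^sup>2) E\<close>, so the factor \<open>exp (\<kappa> / t)\<close> makes it nonincreasing.\<close>
  define E where "E = (\<lambda>t. 4 * pi\<^sup>2 * (v t \<bullet> v t) + w t \<bullet> w t)"
  have E': "(E has_real_derivative (2 * \<kappa> / t\<^sup>2 * (v t \<bullet> w t))) (at t)" if t: "t > 0" for t
  proof -
    have 1: "((\<lambda>t. v t \<bullet> v t) has_real_derivative (v t \<bullet> w t + w t \<bullet> v t)) (at t)"
      unfolding has_real_derivative_iff_has_vector_derivative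
      by (rule bounded_bilinear.has_vector_derivative[OF bounded_bilinear_inner v'[OF t] v'[OF t]])
    have 2: "((\<lambda>t. w t \<bullet> w t) has_real_derivative (w t \<bullet> ((\<kappa> / t\<^sup>2 - 4 * pi\<^sup>2) *\<^sub>R v t) + ((\<kappa> / t\<^sup>2 - 4 * pi\<^sup>2) *\<^sub>R v t) \<bullet> w t)) (at t)"
      unfolding has_real_derivative_iff_has_vector_derivative
      by (rule bounded_bilinear.has_vector_derivative[OF bounded_bilinear_inner w'[OF t] w'[OF t]])
    show ?thesis unfolding E_def
      by (rule derivative_eq_intros 1 2 refl)+ (simp add: inner_commute algebra_simps)
  qed
  define G where "G = (\<lambda>t. E t * exp (\<kappa> / t))"
  have G': "\<exists>y. (G has_real_derivative y) (at s) \<and> y \<le> 0" if s: "1 \<le> s" for s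
  proof -
    have s0: "s > 0" using s by simp
    have "2 * \<bar>v s \<bullet> w s\<bar> \<le> 2 * (norm (v s) * norm (w s))" using Cauchy_Schwarz_ineq2[of "v s" "w s"] by simp
    also have "\<dots> \<le> (norm (v s))\<^sup>2 + (norm (w s))\<^sup>2"
      using sum_squares_bound[of "norm (v s)" "norm (w s)"] by simp
    also have "\<dots> \<le> 4 * pi\<^sup>2 * (norm (v s))\<^sup>2 + (norm (w s))\<^sup>2"
    proof -
      have "1 * 1 \<le> pi * pi" using pi_gt3 by (intro mult_mono) auto
      then have "1 \<le> 4 * pi\<^sup>2" by (simp add: power2_eq_square)
      then have "1 * (norm (v s))\<^sup>2 \<le> 4 * pi\<^sup>2 * (norm (v s))\<^sup>2" by (intro mult_right_mono) auto
      then show ?thesis by simp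
    qed
    also have "\<dots> = E s" by (simp add: E_def dot_square_norm)
    finally have "2 * (v s \<bullet> w s) \<le> E s" by linarith
    then have le: "\<kappa> / s\<^sup>2 * (2 * (v s \<bullet> w s)) \<le> \<kappa> / s\<^sup>2 * E s"
      using \<kappa> by (intro mult_left_mono) auto
    have "(G has_real_derivative ((2 * \<kappa> / s\<^sup>2 * (v s \<bullet> w s)) * exp (\<kappa> / s) + E s * (exp (\<kappa> / s) * (- \<kappa> / s\<^sup>2)))) (at s)"
      unfolding G_def using s0 by (auto intro!: derivative_eq_intros E' simp: power2_eq_square field_simps)
    moreover have "(2 * \<kappa> / s\<^sup>2 * (v s \<bullet> w s)) * exp (\<kappa> / s) + E s * (exp (\<kappa> / s) * (- \<kappa> / s\<^sup>2))
       = (\<kappa> / s\<^sup>2 * (2 * (v s \<bullet> w s)) - \<kappa> / s\<^sup>2 * E s) * exp (\<kappa> / s)" by (simp add: algebra_simps)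
    moreover have "\<dots> \<le> 0" using le by (intro mult_nonpos_nonneg) auto
    ultimately show ?thesis by metis
  qed
  have "G t \<le> G 1" using G' t by (intro DERIV_nonpos_imp_nonincreasing[OF t]) auto
  have "(norm (v t))\<^sup>2 \<le> 4 * pi\<^sup>2 * (norm (v t))\<^sup>2"
  proof -
    have "1 * 1 \<le> pi * pi" using pi_gt3 by (intro mult_mono) auto
    then have "1 \<le> 4 * pi\<^sup>2" by (simp add: power2_eq_square)
    then have "1 * (norm (v t))\<^sup>2 \<le> 4 * pi\<^sup>2 * (norm (v t))\<^sup>2" by (intro mult_right_mono) auto
    then show ?thesis by simp
  qed
  also have "\<dots> \<le> E t * 1" by (simp add: E_def dot_square_norm)
  also have "\<dots> \<le> G t" unfolding G_def using \<kappa> t by (intro mult_left_mono) (auto simp: E_def)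
  also have "\<dots> \<le> G 1" by fact
  also have "\<dots> \<le> (4 * pi\<^sup>2 * B\<^sup>2 + ((A + c) * B)\<^sup>2) * exp \<kappa>"
  proof -
    have B0: "B \<ge> 0" using B(1) norm_ge_zero order_trans by blast
    have "norm (w 1) \<le> norm (A *\<^sub>R \<phi> 1) + norm (c *\<^sub>R \<psi> 1)"
      unfolding w_def by (simp add: norm_triangle_ineq4 del: norm_scaleR)
    also have "\<dots> \<le> A * B + c * B" using A c B by (intro add_mono) (auto intro!: mult_left_mono)
    finally have "norm (w 1) \<le> (A + c) * B" by (simp add: algebra_simps)
    then have "(norm (w 1))\<^sup>2 \<le> ((A + c) * B)\<^sup>2" by (intro power_mono) auto
    moreover have "(norm (v 1))\<^sup>2 \<le> B\<^sup>2" using B by (intro power_mono) (auto simp: v_def)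
    ultimately show ?thesis unfolding G_def E_def by (simp add: dot_square_norm add_mono)
  qed
  also have "\<dots> = (B * sqrt ((4 * pi\<^sup>2 + (A + c)\<^sup>2) * exp \<kappa>))\<^sup>2"
    by (simp only: power_mult_distrib real_sqrt_pow2 mult_nonneg_nonneg add_nonneg_nonneg
        zero_le_power2 exp_ge_zero zero_le_numeral) (simp add: power_mult_distrib algebra_simps)
  finally have "norm (v t) \<le> B * sqrt ((4 * pi\<^sup>2 + (A + c)\<^sup>2) * exp \<kappa>)"
    by (rule power2_le_imp_le) (use order_trans[OF norm_ge_zero B(1)] in simp)
  moreover have "norm (v t) = t powr A * norm (\<phi> t)" by (simp add: v_def)
  ultimately have "norm (\<phi> t) \<le> (B * sqrt ((4 * pi\<^sup>2 + (A + c)\<^sup>2) * exp \<kappa>)) / t powr A"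
    using t by (simp add: field_simps)
  then show ?thesis unfolding \<kappa>_def by (simp add: powr_minus field_simps)
qed

lemma br_kernel_bounded:
  assumes \<beta>: "\<beta> \<ge> 0"
  shows "norm (br_kernel \<beta> (y::'a::euclidean_space)) \<le> unit_ball_vol DIM('a)"
proof -
  have 1: "integrable lborel (indicator (ball 0 1) :: 'a \<Rightarrow> real)"
    by (intro integrable_real_indicator) (auto simp: emeasure_ball)
  have "norm (br_kernel \<beta> y) \<le> (LINT x|lborel. indicator (ball (0::'a) 1) x)"
    unfolding br_kernel_def
  proof (rule Bochner_Integration.integral_norm_bound_integral)
    show "integrable lborel (\<lambda>x. of_real (br_bump \<beta> x) * unit_char (x \<bullet> y))"
      by (rule integrable_br_bump_mult[where C = 1]) (use \<beta> in auto)
    show "norm (of_real (br_bump \<beta> x) * unit_char (x \<bullet> y)) \<le> indicator (ball (0::'a) 1) x" for x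
      using br_bump_le_1[OF \<beta>, of x] br_bump_nonneg[of \<beta> x] br_bump_eq_0[of x \<beta>]
      by (auto simp: norm_mult indicator_def)
  qed (fact 1)
  also have "\<dots> = unit_ball_vol DIM('a)" by (simp add: measure_def emeasure_ball)
  finally show ?thesis .
qed

text \<open>
  Two integrations by parts. One moves the derivative along \<open>e\<close> from the wave to
  \<open>(1 - |x|^2)_+^(\<beta>+1)\<close> and so lowers the order by one. The other integrates the divergence of
  \<open>(1 - |x|^2)_+^(\<beta>+1) exp(2 \<pi> \<i> t x \<bullet> e) x\<close>, where
  \<open>|x|^2 (1 - |x|^2)_+^\<beta> = (1 - |x|^2)_+^\<beta> - (1 - |x|^2)_+^(\<beta>+1)\<close> brings the orders back to \<open>\<beta>\<close> and
  \<open>\<beta> + 1\<close>.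
\<close>

lemma br_kernel_ray:
  fixes e :: "'a::euclidean_space"
  assumes \<beta>: "\<beta> > 0" and e: "norm e = 1"
  defines "\<phi> \<equiv> \<lambda>t. br_kernel \<beta> (t *\<^sub>R e)" and "\<psi> \<equiv> \<lambda>t. br_kernel (\<beta> + 1) (t *\<^sub>R e)"
  obtains \<phi>' \<psi>' where
    "\<And>t. (\<phi> has_vector_derivative \<phi>' t) (at t)" "\<And>t. (\<psi> has_vector_derivative \<psi>' t) (at t)"
    "\<And>t. \<phi>' t = - of_real (2 * pi\<^sup>2 / (\<beta> + 1) * t) * \<psi> t"
    "\<And>t. of_real t * \<psi>' t = - of_real (real DIM('a)) * \<psi> t + 2 * of_real (\<beta> + 1) * (\<phi> t - \<psi> t)"
proof -
  let ?E = "\<lambda>t x. unit_char (t * (x \<bullet> e))" and ?I = "2 * of_real pi * \<i> :: complex"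
  define \<Phi> where "\<Phi> = (\<lambda>\<beta> t. LINT x|lborel. of_real (br_bump \<beta> x) * (?I * of_real (x \<bullet> e) * ?E t x))"
  have e_bd: "\<bar>x \<bullet> e\<bar> \<le> 1" if "norm x \<le> 1" for x
    using Cauchy_Schwarz_ineq2[of x e] e that by simp
  have int: "integrable lborel (\<lambda>x::'a. of_real (br_bump \<beta> x) * (p x * ?E t x))"
    if "\<beta> \<ge> 0" "p \<in> borel_measurable borel" "\<And>x. norm x \<le> 1 \<Longrightarrow> norm (p x) \<le> C" for \<beta> t p C
  proof -
    note [measurable] = that(2)
    show ?thesis by (rule integrable_br_bump_mult[where C = C]) (use that in \<open>auto simp: norm_mult\<close>)
  qed
  have char_der: "((\<lambda>t. ?E t x) has_vector_derivative ?I * of_real (x \<bullet> e) * ?E t x) (at t)" for t x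
    using has_vector_derivative_unit_char[of 0 "x \<bullet> e" t] by simp
  have der: "((\<lambda>t. br_kernel \<beta> (t *\<^sub>R e)) has_vector_derivative \<Phi> \<beta> t) (at t)" if "\<beta> > 0" for \<beta> t
    unfolding br_kernel_def inner_scaleR_right \<Phi>_def
  proof (rule has_vector_derivative_integral)
    show "((\<lambda>t. of_real (br_bump \<beta> x) * ?E t x) has_vector_derivative
        of_real (br_bump \<beta> x) * (?I * of_real (x \<bullet> e) * ?E t x)) (at t)" for t x
      by (rule has_vector_derivative_mult_right[OF char_der])
    show "integrable lborel (\<lambda>x. of_real (br_bump \<beta> x) * ?E t x)" for t
      using int[of \<beta> "\<lambda>_. 1" 1 t] that by simp
    show "norm (of_real (br_bump \<beta> x) * (?I * of_real (x \<bullet> e) * ?E t x))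
       \<le> norm (complex_of_real (br_bump \<beta> x) * of_real (2 * pi))" for t x
    proof (cases "norm x \<le> 1")
      case True
      have "norm (?I * of_real (x \<bullet> e) * ?E t x) \<le> 2 * pi * 1"
        using e_bd[OF True] by (simp add: norm_mult)
      then have "br_bump \<beta> x * norm (?I * of_real (x \<bullet> e) * ?E t x) \<le> br_bump \<beta> x * (2 * pi)"
        using br_bump_nonneg[of \<beta> x] by (intro mult_left_mono) auto
      then show ?thesis by (simp add: norm_mult br_bump_nonneg)
    qed (simp add: br_bump_eq_0)
    show "integrable lborel (\<lambda>x. norm (complex_of_real (br_bump \<beta> x) * of_real (2 * pi)))"
      by (intro integrable_norm integrable_br_bump_mult[where C = "2 * pi"]) (use that in auto)
  qed
  \<comment> \<open>The integrand \<open>?D\<close> is the derivative of \<open>(1 - |x|^2)_+^(\<beta>+1) exp(2 \<pi> \<i> t x \<bullet> e)\<close> along \<open>e\<close>.\<close>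
  have parts_along_ray: "?I * of_real t * br_kernel (\<beta> + 1) (t *\<^sub>R e)
      = 2 * of_real (\<beta> + 1) * (LINT x|lborel. of_real (br_bump \<beta> x) * (of_real (x \<bullet> e) * ?E t x))" for t
  proof -
    let ?D = "\<lambda>x. of_real (br_bump (\<beta> + 1) x) * (?I * of_real t * ?E t x)
        + of_real (- 2 * (\<beta> + 1) * (x \<bullet> e) * br_bump \<beta> x) * ?E t x"
    have D: "integral\<^sup>L lborel ?D = 0"
    proof (rule integral_directional_derivative(2)[where v = e and F = "\<lambda>x. of_real (br_bump (\<beta> + 1) x) * ?E t x"])
      fix x :: 'a
      have 1: "((\<lambda>s. ?E t (x + s *\<^sub>R e)) has_vector_derivative ?I * of_real t * ?E t x) (at 0)"
        using has_vector_derivative_unit_char[of "t * (x \<bullet> e)" t 0] e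
        by (simp add: inner_add_left distrib_left dot_square_norm mult.commute)
      show "((\<lambda>s. of_real (br_bump (\<beta> + 1) (x + s *\<^sub>R e)) * ?E t (x + s *\<^sub>R e)) has_vector_derivative ?D x) (at 0)"
        using has_vector_derivative_mult[OF has_vector_derivative_br_bump[OF \<beta>, of x e] 1] by simp
      have eq: "?D x = of_real (br_bump (\<beta> + 1) x) * (?I * of_real t * ?E t x)
         + of_real (br_bump \<beta> x) * (of_real (- 2 * (\<beta> + 1) * (x \<bullet> e)) * ?E t x)" by simp
      have b1: "norm (of_real (br_bump (\<beta> + 1) x) * (?I * of_real t * ?E t x)) * (1 + norm x) ^ Suc DIM('a) \<le> (2 * pi * \<bar>t\<bar>) * 2 ^ Suc DIM('a)"
        by (rule br_bump_mult_decay) (use \<beta> in \<open>auto simp: norm_mult\<close>)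
      have b2: "norm (of_real (br_bump \<beta> x) * (of_real (- 2 * (\<beta> + 1) * (x \<bullet> e)) * ?E t x)) * (1 + norm x) ^ Suc DIM('a) \<le> (2 * (\<beta> + 1)) * 2 ^ Suc DIM('a)"
      proof (rule br_bump_mult_decay)
        assume "norm x \<le> 1"
        then have "2 * (\<beta> + 1) * \<bar>x \<bullet> e\<bar> \<le> 2 * (\<beta> + 1) * 1"
          using e_bd \<beta> by (intro mult_left_mono) auto
        then show "norm (of_real (- 2 * (\<beta> + 1) * (x \<bullet> e)) * ?E t x) \<le> 2 * (\<beta> + 1)"
          unfolding norm_of_real_unit_char abs_mult using \<beta> by simp
      qed (use \<beta> in auto)
      have "norm (?D x) * (1 + norm x) ^ Suc DIM('a) \<le> (norm (of_real (br_bump (\<beta> + 1) x) * (?I * of_real t * ?E t x))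
         + norm (of_real (br_bump \<beta> x) * (of_real (- 2 * (\<beta> + 1) * (x \<bullet> e)) * ?E t x))) * (1 + norm x) ^ Suc DIM('a)"
        unfolding eq by (intro mult_right_mono norm_triangle_ineq) auto
      also have "\<dots> \<le> (2 * pi * \<bar>t\<bar>) * 2 ^ Suc DIM('a) + (2 * (\<beta> + 1)) * 2 ^ Suc DIM('a)"
        unfolding distrib_right using b1 b2 by (rule add_mono)
      finally show "norm (?D x) * (1 + norm x) ^ Suc DIM('a) \<le> (2 * pi * \<bar>t\<bar>) * 2 ^ Suc DIM('a) + (2 * (\<beta> + 1)) * 2 ^ Suc DIM('a)" .
    qed (use int[of "\<beta> + 1" "\<lambda>_. 1" 1 t] \<beta> in simp)
    have "integral\<^sup>L lborel ?D = (LINT x|lborel. (?I * of_real t) * (of_real (br_bump (\<beta> + 1) x) * (1 * ?E t x))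
        + (- 2 * of_real (\<beta> + 1)) * (of_real (br_bump \<beta> x) * (of_real (x \<bullet> e) * ?E t x)))"
      by (intro Bochner_Integration.integral_cong) (auto simp: algebra_simps)
    also have "\<dots> = (?I * of_real t) * (LINT x|lborel. (of_real (br_bump (\<beta> + 1) x) * (1 * ?E t x)))
        + (- 2 * of_real (\<beta> + 1)) * (LINT x|lborel. (of_real (br_bump \<beta> x) * (of_real (x \<bullet> e) * ?E t x)))"
    proof -
      have i1: "integrable lborel (\<lambda>x::'a. of_real (br_bump (\<beta> + 1) x) * (1 * ?E t x))"
        by (rule int[where C = 1]) (use \<beta> in auto)
      have i2: "integrable lborel (\<lambda>x::'a. of_real (br_bump \<beta> x) * (of_real (x \<bullet> e) * ?E t x))"
        by (rule int[where C = 1]) (use \<beta> e_bd in auto)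
      show ?thesis
        by (subst Bochner_Integration.integral_add[OF integrable_mult_right[OF i1] integrable_mult_right[OF i2]])
           (simp only: integral_mult_right_zero)
    qed
    finally have eq: "0 = (?I * of_real t) * (LINT x|lborel. (of_real (br_bump (\<beta> + 1) x) * (1 * ?E t x)))
        + (- 2 * of_real (\<beta> + 1)) * (LINT x|lborel. (of_real (br_bump \<beta> x) * (of_real (x \<bullet> e) * ?E t x)))"
      by (simp only: D)
    have alg: "0 = a + (- 2 * c) * b \<Longrightarrow> a = 2 * c * b" for a b c :: complex by simp
    show ?thesis using alg[OF eq] by (simp only: br_kernel_def inner_scaleR_right mult_1_left)
  qed
  \<comment> \<open>Here \<open>?D b\<close> is the contribution of the coordinate \<open>b\<close> to the divergence of
    \<open>(1 - |x|^2)_+^(\<beta>+1) exp(2 \<pi> \<i> t x \<bullet> e) x\<close>.\<close>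
  have parts_divergence: "of_real t * \<Phi> (\<beta> + 1) t + of_real (real DIM('a)) * \<psi> t - 2 * of_real (\<beta> + 1) * (\<phi> t - \<psi> t) = 0" for t
  proof -
    let ?D = "\<lambda>b x. of_real (br_bump (\<beta> + 1) x) * ?E t x
        + of_real (br_bump (\<beta> + 1) x) * (of_real (x \<bullet> b) * (?I * of_real (t * (b \<bullet> e))) * ?E t x)
        + of_real (br_bump \<beta> x) * (of_real (- 2 * (\<beta> + 1) * (x \<bullet> b)\<^sup>2) * ?E t x)"
    have D: "integrable lborel (?D b) \<and> integral\<^sup>L lborel (?D b) = 0" if b: "b \<in> Basis" for b
    proof -
      have b1: "norm b = 1" using b by simp
      have b_bd: "\<bar>x \<bullet> b\<bar> \<le> 1" if "norm x \<le> 1" for x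
        using Cauchy_Schwarz_ineq2[of x b] b1 that by simp
      have c1: "((\<lambda>s. ?E t (x + s *\<^sub>R b)) has_vector_derivative ?I * of_real (t * (b \<bullet> e)) * ?E t x) (at 0)" for x
        using has_vector_derivative_unit_char[of "t * (x \<bullet> e)" "t * (b \<bullet> e)" 0] 
        by (simp add: inner_add_left distrib_left algebra_simps)
      have c2: "((\<lambda>s. complex_of_real ((x + s *\<^sub>R b) \<bullet> b)) has_vector_derivative 1) (at 0)" for x
      proof -
        have "(\<lambda>s. (x + s *\<^sub>R b) \<bullet> b) = (\<lambda>s. x \<bullet> b + s)"
          using b by (simp add: inner_add_left)
        moreover have "((\<lambda>s. x \<bullet> b + s) has_real_derivative 1) (at 0)"
          by (auto intro!: derivative_eq_intros)
        ultimately have "((\<lambda>s. (x + s *\<^sub>R b) \<bullet> b) has_real_derivative 1) (at 0)" by simp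
        from has_vector_derivative_of_real[OF this] show ?thesis by simp
      qed
      have c3: "((\<lambda>s. of_real (br_bump (\<beta> + 1) (x + s *\<^sub>R b)) * (of_real ((x + s *\<^sub>R b) \<bullet> b) * ?E t (x + s *\<^sub>R b))) has_vector_derivative ?D b x) (at 0)" for x
        by (rule has_vector_derivative_eq_rhs[OF has_vector_derivative_mult[OF has_vector_derivative_br_bump[OF \<beta>, of x b] has_vector_derivative_mult[OF c2 c1]]])
           (simp only: scaleR_zero_left add_0_right coordinate_wave_product_rule)
      have c4: "norm (?D b x) * (1 + norm x) ^ Suc DIM('a) \<le> 1 * 2 ^ Suc DIM('a) + (2 * pi * \<bar>t\<bar>) * 2 ^ Suc DIM('a) + (2 * (\<beta> + 1)) * 2 ^ Suc DIM('a)" for x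
      proof -
        have d1: "norm (of_real (br_bump (\<beta> + 1) x) * ?E t x) * (1 + norm x) ^ Suc DIM('a) \<le> 1 * 2 ^ Suc DIM('a)"
          by (rule br_bump_mult_decay) (use \<beta> in auto)
        have d2: "norm (of_real (br_bump (\<beta> + 1) x) * (of_real (x \<bullet> b) * (?I * of_real (t * (b \<bullet> e))) * ?E t x)) * (1 + norm x) ^ Suc DIM('a) \<le> (2 * pi * \<bar>t\<bar>) * 2 ^ Suc DIM('a)"
        proof (rule br_bump_mult_decay)
          assume x: "norm x \<le> 1"
          have be: "\<bar>b \<bullet> e\<bar> \<le> 1" using Cauchy_Schwarz_ineq2[of b e] b1 e by simp
          have "\<bar>x \<bullet> b\<bar> * (2 * pi * (\<bar>t\<bar> * \<bar>b \<bullet> e\<bar>)) \<le> 1 * (2 * pi * (\<bar>t\<bar> * 1))"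
            using b_bd[OF x] be by (intro mult_mono) auto
          then show "norm (of_real (x \<bullet> b) * (?I * of_real (t * (b \<bullet> e))) * ?E t x) \<le> 2 * pi * \<bar>t\<bar>"
            by (simp add: norm_mult abs_mult)
        qed (use \<beta> in auto)
        have d3: "norm (of_real (br_bump \<beta> x) * (of_real (- 2 * (\<beta> + 1) * (x \<bullet> b)\<^sup>2) * ?E t x)) * (1 + norm x) ^ Suc DIM('a) \<le> (2 * (\<beta> + 1)) * 2 ^ Suc DIM('a)"
        proof (rule br_bump_mult_decay)
          assume x: "norm x \<le> 1"
          have "2 * (\<beta> + 1) * (x \<bullet> b)\<^sup>2 \<le> 2 * (\<beta> + 1) * 1"
            using b_bd[OF x] \<beta> by (intro mult_left_mono) (auto simp: abs_square_le_1)
          then show "norm (of_real (- 2 * (\<beta> + 1) * (x \<bullet> b)\<^sup>2) * ?E t x) \<le> 2 * (\<beta> + 1)"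
            unfolding norm_of_real_unit_char abs_mult using \<beta> by simp
        qed (use \<beta> in auto)
        have tri: "norm (x1 + x2 + x3) \<le> norm x1 + norm x2 + norm x3" for x1 x2 x3 :: complex
          by (metis add_mono norm_triangle_ineq order_refl order_trans)
        have "norm (?D b x) * (1 + norm x) ^ Suc DIM('a) \<le> 
          (norm (of_real (br_bump (\<beta> + 1) x) * ?E t x) + norm (of_real (br_bump (\<beta> + 1) x) * (of_real (x \<bullet> b) * (?I * of_real (t * (b \<bullet> e))) * ?E t x))
          + norm (of_real (br_bump \<beta> x) * (of_real (- 2 * (\<beta> + 1) * (x \<bullet> b)\<^sup>2) * ?E t x))) * (1 + norm x) ^ Suc DIM('a)"
          by (intro mult_right_mono tri) auto
        also have "\<dots> \<le> 1 * 2 ^ Suc DIM('a) + (2 * pi * \<bar>t\<bar>) * 2 ^ Suc DIM('a) + (2 * (\<beta> + 1)) * 2 ^ Suc DIM('a)"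
          unfolding distrib_right using add_mono[OF add_mono[OF d1 d2] d3] .
        finally show ?thesis .
      qed
      have "integrable lborel (\<lambda>x. of_real (br_bump (\<beta> + 1) x) * (of_real (x \<bullet> b) * ?E t x))"
        using \<beta> b_bd by (intro int[where C = 1]) auto
      from integral_directional_derivative[where v = b, OF c3 c4 this] show ?thesis by blast
    qed
    have sum_eq: "(\<Sum>b\<in>Basis. ?D b x) = of_real (real DIM('a)) * (of_real (br_bump (\<beta> + 1) x) * (1 * ?E t x))
        + of_real t * (of_real (br_bump (\<beta> + 1) x) * (?I * of_real (x \<bullet> e) * ?E t x))
        - 2 * of_real (\<beta> + 1) * (of_real (br_bump \<beta> x) * (1 * ?E t x) - of_real (br_bump (\<beta> + 1) x) * (1 * ?E t x))" for x
    proof -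
      have "(\<Sum>b\<in>Basis. ?D b x) = of_real (real DIM('a)) * (of_real (br_bump (\<beta> + 1) x) * ?E t x)
        + of_real (br_bump (\<beta> + 1) x) * (?I * of_real t * of_real (\<Sum>b\<in>Basis. (x \<bullet> b) * (b \<bullet> e)) * ?E t x)
        + of_real (br_bump \<beta> x) * (- 2 * of_real (\<beta> + 1) * of_real (\<Sum>b\<in>Basis. (x \<bullet> b)\<^sup>2) * ?E t x)"
        by (rule sum_coordinate_wave_terms) simp
      also have "(\<Sum>b\<in>Basis. (x \<bullet> b) * (b \<bullet> e)) = x \<bullet> e"
        by (subst euclidean_inner) (simp add: inner_commute)
      also have "(\<Sum>b\<in>Basis. (x \<bullet> b)\<^sup>2) = (norm x)\<^sup>2"
        unfolding power2_norm_eq_inner by (subst (2) euclidean_inner) (simp add: power2_eq_square)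
      also have "of_real (br_bump \<beta> x) * (- 2 * of_real (\<beta> + 1) * of_real ((norm x)\<^sup>2) * ?E t x)
        = - 2 * of_real (\<beta> + 1) * (of_real ((norm x)\<^sup>2 * br_bump \<beta> x) * ?E t x)"
        by (simp add: mult_ac)
      finally show ?thesis unfolding br_bump_Suc[OF \<beta>] by (simp add: algebra_simps)
    qed
    have ints: "integrable lborel (\<lambda>x::'a. of_real (br_bump (\<beta> + 1) x) * (1 * ?E t x))"
      "integrable lborel (\<lambda>x::'a. of_real (br_bump \<beta> x) * (1 * ?E t x))"
      by (rule int[where C = 1]; use \<beta> in simp)+
    have int3: "integrable lborel (\<lambda>x::'a. of_real (br_bump (\<beta> + 1) x) * (?I * of_real (x \<bullet> e) * ?E t x))"
      using \<beta> e_bd by (intro int[where C = "2 * pi"]) (auto simp: norm_mult)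
    have "0 = (\<Sum>b\<in>Basis. integral\<^sup>L lborel (?D b))" using D by simp
    also have "\<dots> = (LINT x|lborel. (\<Sum>b\<in>Basis. ?D b x))"
      by (rule Bochner_Integration.integral_sum[symmetric]) (use D in blast)
    also have "\<dots> = of_real (real DIM('a)) * \<psi> t + of_real t * \<Phi> (\<beta> + 1) t - 2 * of_real (\<beta> + 1) * (\<phi> t - \<psi> t)"
      unfolding sum_eq \<phi>_def \<psi>_def \<Phi>_def br_kernel_def inner_scaleR_right
      using ints int3 by simp
    finally show ?thesis by (simp add: algebra_simps)
  qed
  have \<Phi>1: "\<Phi> \<beta> t = - of_real (2 * pi\<^sup>2 / (\<beta> + 1) * t) * \<psi> t" for t
  proof -
    have "\<Phi> \<beta> t = ?I * (LINT x|lborel. of_real (br_bump \<beta> x) * (of_real (x \<bullet> e) * ?E t x))"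
      unfolding \<Phi>_def by (subst integral_mult_right_zero[symmetric]) (simp add: mult_ac)
    moreover have "of_real (\<beta> + 1) \<noteq> (0::complex)" using \<beta> by (metis add_pos_pos less_irrefl of_real_eq_0_iff zero_less_one)
    ultimately have "2 * of_real (\<beta> + 1) * \<Phi> \<beta> t = ?I * (?I * of_real t * \<psi> t)"
      using parts_along_ray[of t] by (simp add: \<psi>_def mult_ac)
    also have "\<dots> = - of_real (4 * pi\<^sup>2 * t) * \<psi> t" by (simp add: power2_eq_square)
    finally have "2 * of_real (\<beta> + 1) * \<Phi> \<beta> t = - of_real (4 * pi\<^sup>2 * t) * \<psi> t" .
    moreover have alg: "2 * c * X = - of_real (4 * p * t) * Y \<Longrightarrow> c * X = - of_real (2 * p * t) * Y"
      for c X Y :: complex and p t :: real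
    proof -
      assume "2 * c * X = - of_real (4 * p * t) * Y"
      then have "2 * (c * X) = 2 * (- of_real (2 * p * t) * Y)" by (simp only: mult.assoc of_real_mult) simp
      then show ?thesis by (simp only: mult_cancel_left) simp
    qed
    ultimately have "of_real (\<beta> + 1) * \<Phi> \<beta> t = - of_real (2 * pi\<^sup>2 * t) * \<psi> t" by blast
    then show ?thesis using \<open>of_real (\<beta> + 1) \<noteq> (0::complex)\<close> by (simp add: field_simps)
  qed
  show ?thesis
  proof (rule that)
    show "(\<phi> has_vector_derivative \<Phi> \<beta> t) (at t)" for t unfolding \<phi>_def by (rule der[OF \<beta>])
    show "(\<psi> has_vector_derivative \<Phi> (\<beta> + 1) t) (at t)" for t unfolding \<psi>_def by (rule der) (use \<beta> in simp)
    show "of_real t * \<Phi> (\<beta> + 1) t = - of_real (real DIM('a)) * \<psi> t + 2 * of_real (\<beta> + 1) * (\<phi> t - \<psi> t)" for t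
      using parts_divergence[of t] by (simp add: algebra_simps)
  qed (fact \<Phi>1)
qed

text \<open>
  Near the origin the kernel is bounded, and beyond the unit sphere \<open>ray_system_bound\<close> applies on each
  ray. Since a single constant serves all exponents up to the critical one, kernels of different orders
  can later be compared with the same power of \<open>|y|\<close>.
\<close>

theorem br_kernel_decay:
  assumes \<beta>: "\<beta> > 0"
  obtains C where "C \<ge> 0"
    "\<And>(y::'a::euclidean_space) a. 0 \<le> a \<Longrightarrow> a \<le> \<beta> + (real DIM('a) + 1) / 2 \<Longrightarrow> y \<noteq> 0 \<Longrightarrow> norm (br_kernel \<beta> y) \<le> C * norm y powr (- a)"
proof -
  define A where "A = \<beta> + (real DIM('a) + 1) / 2"
  define V where "V = unit_ball_vol DIM('a)"
  define C where "C = max 1 (sqrt ((4 * pi\<^sup>2 + (A + 2 * pi\<^sup>2 / (\<beta> + 1))\<^sup>2) * exp (A * (A - 1))))"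
  have V: "V \<ge> 0" by (simp add: V_def)
  have C: "1 \<le> C" "sqrt ((4 * pi\<^sup>2 + (A + 2 * pi\<^sup>2 / (\<beta> + 1))\<^sup>2) * exp (A * (A - 1))) \<le> C"
    unfolding C_def by (rule max.cobounded1, rule max.cobounded2)
  have C0: "V * C \<ge> 0" using V C(1) by simp
  show ?thesis
  proof (rule that[of "V * C"])
    show "V * C \<ge> 0" by (fact C0)
    fix y :: 'a and a :: real
    assume a: "0 \<le> a" "a \<le> \<beta> + (real DIM('a) + 1) / 2" and y: "y \<noteq> 0"
    show "norm (br_kernel \<beta> y) \<le> V * C * norm y powr (- a)"
    proof (cases "norm y \<le> 1")
      case True
      have "norm (br_kernel \<beta> y) \<le> V" unfolding V_def by (rule br_kernel_bounded) (use \<beta> in simp)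
      also have "V = V * 1 * 1" by simp
      also have "\<dots> \<le> V * C * norm y powr (- a)"
      proof (intro mult_mono)
        have "norm y powr a \<le> 1" using True a by (intro powr_le1) auto
        then show "1 \<le> norm y powr (- a)" using y by (simp add: powr_minus one_le_inverse_iff)
      qed (use V C in auto)
      finally show ?thesis .
    next
      case False
      define t where "t = norm y" define e where "e = y /\<^sub>R t"
      have t: "t \<ge> 1" and e: "norm e = 1" and ye: "y = t *\<^sub>R e" using False y by (auto simp: t_def e_def)
      from br_kernel_ray[OF \<beta> e] obtain \<phi>' \<psi>' where 
       *: "\<And>t. ((\<lambda>t. br_kernel \<beta> (t *\<^sub>R e)) has_vector_derivative \<phi>' t) (at t)" "\<And>t. ((\<lambda>t. br_kernel (\<beta> + 1) (t *\<^sub>R e)) has_vector_derivative \<psi>' t) (at t)"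
        "\<And>t. \<phi>' t = - of_real (2 * pi\<^sup>2 / (\<beta> + 1) * t) * br_kernel (\<beta> + 1) (t *\<^sub>R e)"
        "\<And>t. of_real t * \<psi>' t = - of_real (real DIM('a)) * br_kernel (\<beta> + 1) (t *\<^sub>R e) + 2 * of_real (\<beta> + 1) * (br_kernel \<beta> (t *\<^sub>R e) - br_kernel (\<beta> + 1) (t *\<^sub>R e))" by blast
      have "norm (br_kernel \<beta> (t *\<^sub>R e)) \<le> V * sqrt ((4 * pi\<^sup>2 + (A + 2 * pi\<^sup>2 / (\<beta> + 1))\<^sup>2) * exp (A * (A - 1))) * t powr (- A)"
        unfolding A_def
      proof (rule ray_system_bound[OF \<beta> _ *(1,2,3,4) _ _ t])
        show "1 \<le> real DIM('a)" using DIM_positive[where 'a='a] by linarith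
        show "norm (br_kernel \<beta> (1 *\<^sub>R e)) \<le> V" "norm (br_kernel (\<beta> + 1) (1 *\<^sub>R e)) \<le> V"
          unfolding V_def by (rule br_kernel_bounded, use \<beta> in simp)+
      qed
      also have "\<dots> \<le> V * C * t powr (- A)"
        by (rule mult_right_mono[OF mult_left_mono[OF C(2) V] powr_ge_zero])
      also have "\<dots> \<le> V * C * t powr (- a)"
        by (rule mult_left_mono[OF powr_mono[OF _ t] C0]) (use a in \<open>simp add: A_def\<close>)
      finally have "norm (br_kernel \<beta> y) \<le> V * C * t powr (- a)" unfolding ye[symmetric] .
      then show ?thesis unfolding t_def .
    qed
  qed
qed

section \<open>Schwartz functions and Fourier inversion\<close>

text \<open>
  Fubini's theorem with the finiteness of one iterated integral as hypothesis, the form in which it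
  can be checked from product bounds.
\<close>

lemma Fubini_finite:
  fixes f :: "'x \<Rightarrow> 'y \<Rightarrow> 'z::{banach,second_countable_topology}"
  assumes M1: "sigma_finite_measure M1" and M2: "sigma_finite_measure M2"
    and meas[measurable]: "case_prod f \<in> borel_measurable (M1 \<Otimes>\<^sub>M M2)"
    and fin: "(\<integral>\<^sup>+x. \<integral>\<^sup>+y. ennreal (norm (f x y)) \<partial>M2 \<partial>M1) < \<infinity>"
  shows "(LINT x|M1. LINT y|M2. f x y) = (LINT y|M2. LINT x|M1. f x y)"
    and "integrable M1 (\<lambda>x. LINT y|M2. f x y)" and "integrable M2 (\<lambda>y. LINT x|M1. f x y)"
    and "AE x in M1. integrable M2 (f x)" and "AE y in M2. integrable M1 (\<lambda>x. f x y)"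
proof -
  interpret M1: sigma_finite_measure M1 by fact
  interpret M2: sigma_finite_measure M2 by fact
  interpret pair_sigma_finite M1 M2 ..
  have int: "integrable (M1 \<Otimes>\<^sub>M M2) (case_prod f)"
  proof (rule integrableI_bounded)
    have "(\<integral>\<^sup>+p. ennreal (norm (case_prod f p)) \<partial>(M1 \<Otimes>\<^sub>M M2)) = (\<integral>\<^sup>+x. \<integral>\<^sup>+y. ennreal (norm (case_prod f (x,y))) \<partial>M2 \<partial>M1)"
      by (rule M2.nn_integral_fst[symmetric]) measurable
    then show "(\<integral>\<^sup>+p. ennreal (norm (case_prod f p)) \<partial>(M1 \<Otimes>\<^sub>M M2)) < \<infinity>" using fin by simp
  qed simp
  show "(LINT x|M1. LINT y|M2. f x y) = (LINT y|M2. LINT x|M1. f x y)"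
    using Fubini_integral[OF int] by simp
  show "integrable M1 (\<lambda>x. LINT y|M2. f x y)" using integrable_fst'[OF int] by simp
  show "integrable M2 (\<lambda>y. LINT x|M1. f x y)" using integrable_snd[OF int] by simp
  show "AE x in M1. integrable M2 (f x)" using AE_integrable_fst'[OF int] by simp
  show "AE y in M2. integrable M1 (\<lambda>x. f x y)" using AE_integrable_snd[OF int] by simp
qed

lemma schwartz_partials_bound:
  assumes "\<phi> \<in> schwartz" "set vs \<subseteq> Basis"
  obtains B where "\<And>x. norm (partials vs \<phi> x) * (1 + norm x) ^ N \<le> B"
proof -
  have "bounded (range (\<lambda>x. (1 + norm x) ^ N * norm (partials vs \<phi> x)))"
    using assms by (auto simp: schwartz_def)
  then obtain B where "\<And>x. norm ((1 + norm x) ^ N * norm (partials vs \<phi> x)) \<le> B"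
    by (auto simp: bounded_iff)
  then have "norm (partials vs \<phi> x) * (1 + norm x) ^ N \<le> B" for x
    by (metis abs_of_nonneg mult.commute mult_nonneg_nonneg norm_ge_zero real_norm_def zero_le_power add_nonneg_nonneg zero_le_one)
  then show ?thesis by (rule that)
qed

lemma schwartz_bound:
  assumes "\<phi> \<in> schwartz"
  obtains B where "\<And>x. norm (\<phi> x) * (1 + norm x) ^ N \<le> B"
  using schwartz_partials_bound[OF assms, of "[]" N] by auto

lemma schwartz_differentiable: "\<phi> \<in> schwartz \<Longrightarrow> \<phi> differentiable (at x)"
  unfolding schwartz_def using partials.simps(1)[of \<phi>] by (metis (mono_tags, lifting) empty_subsetI list.set(1) mem_Collect_eq)

lemma schwartz_continuous: "\<phi> \<in> schwartz \<Longrightarrow> continuous_on S \<phi>"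
  by (meson schwartz_differentiable differentiable_imp_continuous_within continuous_at_imp_continuous_on)

lemma schwartz_measurable: "\<phi> \<in> schwartz \<Longrightarrow> \<phi> \<in> borel_measurable borel"
  by (intro borel_measurable_continuous_onI schwartz_continuous)

lemma schwartz_integrable:
  fixes \<phi> :: "'a::euclidean_space \<Rightarrow> complex"
  assumes "\<phi> \<in> schwartz" shows "integrable lborel \<phi>"
proof -
  obtain B where "\<And>x. norm (\<phi> x) * (1 + norm x) ^ Suc DIM('a) \<le> B"
    using schwartz_bound[OF assms] by blast
  then show ?thesis by (rule integrable_decay[OF schwartz_measurable[OF assms]])
qed

lemma partials_append: "partials (vs @ ws) \<phi> = partials vs (partials ws \<phi>)"
  by (induction vs) auto

lemma schwartz_partials:
  assumes "\<phi> \<in> schwartz" "set ws \<subseteq> Basis" shows "partials ws \<phi> \<in> schwartz"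
  unfolding schwartz_def
proof (intro CollectI allI impI)
  fix vs :: "'a list" assume "set vs \<subseteq> Basis"
  then have "set (vs @ ws) \<subseteq> Basis" using assms by simp
  then show "(\<forall>x. partials vs (partials ws \<phi>) differentiable at x) \<and>
     (\<forall>N. bounded (range (\<lambda>x. (1 + norm x) ^ N * norm (partials vs (partials ws \<phi>) x))))"
    using assms(1) unfolding schwartz_def partials_append[symmetric] by blast
qed

lemma schwartz_line_derivative:
  assumes "\<phi> \<in> schwartz"
  shows "((\<lambda>t. \<phi> (x + t *\<^sub>R b)) has_vector_derivative partials [b] \<phi> x) (at 0)"
proof -
  have "(\<phi> has_derivative frechet_derivative \<phi> (at x)) (at x)"
    using schwartz_differentiable[OF assms] frechet_derivative_works by blast
  then have 1: "(\<phi> has_derivative frechet_derivative \<phi> (at x)) (at (x + 0 *\<^sub>R b))" by simp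
  have 2: "((\<lambda>t. x + t *\<^sub>R b) has_derivative (\<lambda>t. t *\<^sub>R b)) (at 0)"
    by (auto intro!: derivative_eq_intros)
  have "((\<lambda>t. \<phi> (x + t *\<^sub>R b)) has_derivative (\<lambda>t. frechet_derivative \<phi> (at x) (t *\<^sub>R b))) (at 0)"
    using diff_chain_at[OF 2 1] by (simp add: o_def)
  moreover have "linear (frechet_derivative \<phi> (at x))"
    using schwartz_differentiable[OF assms] by (rule linear_frechet_derivative)
  ultimately show ?thesis
    by (simp add: has_vector_derivative_def linear_cmul)
qed

lemma fourier_lborel:
  assumes "\<phi> \<in> borel_measurable borel"
  shows "fourier \<phi> \<xi> = (LINT x|lborel. \<phi> x * unit_char (- (x \<bullet> \<xi>)))"
proof -
  have "(\<lambda>x. \<phi> x * unit_char (- (x \<bullet> \<xi>))) \<in> borel_measurable borel"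
    using assms by measurable
  then show ?thesis unfolding fourier_eq by (subst integral_completion) auto
qed

lemma borel_measurable_fourier:
  fixes \<phi> :: "'a::euclidean_space \<Rightarrow> complex"
  assumes [measurable]: "\<phi> \<in> borel_measurable borel"
  shows "fourier \<phi> \<in> borel_measurable borel"
proof -
  have eq: "fourier \<phi> = (\<lambda>\<xi>. LINT x|lborel. \<phi> x * unit_char (- (x \<bullet> \<xi>)))"
    using fourier_lborel[OF assms] by blast
  show ?thesis unfolding eq by measurable
qed

lemma fourier_partial:
  fixes \<phi> :: "'a::euclidean_space \<Rightarrow> complex"
  assumes \<phi>: "\<phi> \<in> schwartz" and b: "b \<in> Basis"
  shows "fourier (partials [b] \<phi>) \<xi> = 2 * of_real pi * \<i> * of_real (b \<bullet> \<xi>) * fourier \<phi> \<xi>"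
proof -
  let ?E = "\<lambda>x. unit_char (- (x \<bullet> \<xi>))" and ?c = "2 * of_real pi * \<i> * of_real (b \<bullet> \<xi>) :: complex"
  let ?D = "\<lambda>x. \<phi> x * (- ?c * ?E x) + partials [b] \<phi> x * ?E x"
  have p: "partials [b] \<phi> \<in> schwartz" using \<phi> b by (intro schwartz_partials) auto
  note [measurable] = schwartz_measurable[OF \<phi>] schwartz_measurable[OF p]
  have int: "integrable lborel (\<lambda>x. \<psi> x * ?E x)" if "\<psi> \<in> schwartz" for \<psi>
    by (rule Bochner_Integration.integrable_bound[OF integrable_norm[OF schwartz_integrable[OF that]]])
       (use schwartz_measurable[OF that] in \<open>auto simp: norm_mult\<close>)
  obtain B1 where B1: "\<And>x. norm (\<phi> x) * (1 + norm x) ^ Suc DIM('a) \<le> B1" using schwartz_bound[OF \<phi>] by blast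
  obtain B2 where B2: "\<And>x. norm (partials [b] \<phi> x) * (1 + norm x) ^ Suc DIM('a) \<le> B2" using schwartz_bound[OF p] by blast
  have A: "integral\<^sup>L lborel ?D = 0"
  proof (rule integral_directional_derivative(2)[where v = b and F = "\<lambda>x. \<phi> x * ?E x"])
    fix x
    have 1: "((\<lambda>t. ?E (x + t *\<^sub>R b)) has_vector_derivative - ?c * ?E x) (at 0)"
      using has_vector_derivative_unit_char[of "- (x \<bullet> \<xi>)" "- (b \<bullet> \<xi>)" 0] by (simp add: inner_add_left)
    show "((\<lambda>t. \<phi> (x + t *\<^sub>R b) * ?E (x + t *\<^sub>R b)) has_vector_derivative ?D x) (at 0)"
      using has_vector_derivative_mult[OF schwartz_line_derivative[OF \<phi>, of x b] 1] by simp
    have "norm (?D x) \<le> norm ?c * norm (\<phi> x) + norm (partials [b] \<phi> x)"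
      by (rule order_trans[OF norm_triangle_ineq]) (simp add: norm_mult)
    then have "norm (?D x) * (1 + norm x) ^ Suc DIM('a) \<le> (norm ?c * norm (\<phi> x) + norm (partials [b] \<phi> x)) * (1 + norm x) ^ Suc DIM('a)"
      by (intro mult_right_mono) auto
    also have "\<dots> = norm ?c * (norm (\<phi> x) * (1 + norm x) ^ Suc DIM('a)) + norm (partials [b] \<phi> x) * (1 + norm x) ^ Suc DIM('a)"
      by (simp only: distrib_right mult.assoc)
    also have "\<dots> \<le> norm ?c * B1 + B2"
      by (intro add_mono mult_left_mono B1 B2) auto
    finally show "norm (?D x) * (1 + norm x) ^ Suc DIM('a) \<le> norm ?c * B1 + B2" .
  qed (rule int[OF \<phi>])
  have B: "integral\<^sup>L lborel ?D = (LINT x|lborel. (- ?c) * (\<phi> x * ?E x) + partials [b] \<phi> x * ?E x)"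
    by (intro Bochner_Integration.integral_cong) (simp_all add: algebra_simps)
  have C: "\<dots> = (- ?c) * (LINT x|lborel. \<phi> x * ?E x) + (LINT x|lborel. partials [b] \<phi> x * ?E x)"
    by (subst Bochner_Integration.integral_add[OF integrable_mult_right[OF int[OF \<phi>]] int[OF p]])
       (simp only: integral_mult_right_zero)
  have alg: "- c * F + G = 0 \<Longrightarrow> G = c * F" for c F G :: complex by (simp add: add_eq_0_iff)
  show ?thesis
    unfolding fourier_lborel[OF schwartz_measurable[OF \<phi>]] fourier_lborel[OF schwartz_measurable[OF p]]
    by (rule alg[OF trans[OF C[symmetric] trans[OF B[symmetric] A]]])
qed

lemma norm_fourier_le:
  assumes "\<phi> \<in> borel_measurable borel" "integrable lborel \<phi>"
  shows "norm (fourier \<phi> \<xi>) \<le> (LINT x|lborel. norm (\<phi> x))"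
proof -
  note [measurable] = assms(1)
  have "norm (fourier \<phi> \<xi>) \<le> (LINT x|lborel. norm (\<phi> x * unit_char (- (x \<bullet> \<xi>))))"
    unfolding fourier_lborel[OF assms(1)] by (rule integral_norm_bound)
  then show ?thesis by (simp add: norm_mult)
qed

text \<open>
  Differentiating \<open>N\<close> times in the direction of the largest coordinate of \<open>\<xi>\<close> bounds
  \<open>|\<xi>|^N |fourier \<phi> \<xi>|\<close> by the \<open>L\<^sup>1\<close> norms of finitely many derivatives.
\<close>

lemma fourier_decay:
  fixes \<phi> :: "'a::euclidean_space \<Rightarrow> complex"
  assumes \<phi>: "\<phi> \<in> schwartz"
  obtains B where "\<And>\<xi>. norm (fourier \<phi> \<xi>) * (1 + norm \<xi>) ^ N \<le> B"
proof -
  have pow: "fourier (partials (replicate k b) \<phi>) \<xi> = (2 * of_real pi * \<i> * of_real (b \<bullet> \<xi>)) ^ k * fourier \<phi> \<xi>"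
    if b: "b \<in> Basis" for b k \<xi>
  proof (induction k)
    case (Suc k)
    have "partials (replicate k b) \<phi> \<in> schwartz" using \<phi> b by (intro schwartz_partials) auto
    from fourier_partial[OF this b, of \<xi>] Suc show ?case by (simp add: mult_ac)
  qed simp
  define I where "I = (\<lambda>b k. LINT x|lborel. norm (partials (replicate k b) \<phi> x))"
  have le: "\<bar>b \<bullet> \<xi>\<bar> ^ k * norm (fourier \<phi> \<xi>) \<le> I b k" if b: "b \<in> Basis" for b k \<xi>
  proof -
    have p: "partials (replicate k b) \<phi> \<in> schwartz" using \<phi> b by (intro schwartz_partials) auto
    have "1 \<le> 2 * pi" using pi_gt3 by linarith
    from mult_right_mono[OF this abs_ge_zero[of "b \<bullet> \<xi>"]]
    have "\<bar>b \<bullet> \<xi>\<bar> ^ k \<le> (2 * pi * \<bar>b \<bullet> \<xi>\<bar>) ^ k" by (intro power_mono) simp_all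
    then have "\<bar>b \<bullet> \<xi>\<bar> ^ k * norm (fourier \<phi> \<xi>) \<le> (2 * pi * \<bar>b \<bullet> \<xi>\<bar>) ^ k * norm (fourier \<phi> \<xi>)"
      by (intro mult_right_mono) auto
    also have "\<dots> = norm (fourier (partials (replicate k b) \<phi>) \<xi>)"
      unfolding pow[OF b] by (simp add: norm_mult norm_power)
    also have "\<dots> \<le> I b k" unfolding I_def by (rule norm_fourier_le[OF schwartz_measurable[OF p] schwartz_integrable[OF p]])
    finally show ?thesis .
  qed
  define J where "J = (\<Sum>b\<in>Basis. I b N)"
  have "norm (fourier \<phi> \<xi>) * (1 + norm \<xi>) ^ N \<le> 2 ^ N * (I (SOME b. b \<in> Basis) 0 + real DIM('a) ^ N * J)" for \<xi>
  proof -
    have b0: "(SOME b. b \<in> (Basis::'a set)) \<in> Basis" by (simp add: some_in_eq)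
    have 0: "norm (fourier \<phi> \<xi>) \<le> I (SOME b. b \<in> Basis) 0" using le[OF b0, of \<xi> 0] by simp
    obtain b where b: "b \<in> Basis" "\<And>c. c \<in> Basis \<Longrightarrow> \<bar>\<xi> \<bullet> c\<bar> \<le> \<bar>\<xi> \<bullet> b\<bar>"
    proof -
      let ?S = "(\<lambda>c. \<bar>\<xi> \<bullet> c\<bar>) ` Basis"
      have S: "finite ?S" "?S \<noteq> {}" by auto
      from Max_in[OF S] obtain b where b: "Max ?S = \<bar>\<xi> \<bullet> b\<bar>" "b \<in> Basis" by (rule imageE)
      have "\<bar>\<xi> \<bullet> c\<bar> \<le> \<bar>\<xi> \<bullet> b\<bar>" if "c \<in> Basis" for c
        unfolding b(1)[symmetric] using that by (intro Max_ge[OF S(1)] imageI)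
      then show ?thesis using that b(2) by blast
    qed
    have "norm \<xi> \<le> (\<Sum>c\<in>Basis. \<bar>\<xi> \<bullet> c\<bar>)" by (rule norm_le_l1)
    also have "\<dots> \<le> real DIM('a) * \<bar>\<xi> \<bullet> b\<bar>" using sum_bounded_above[of Basis "\<lambda>c. \<bar>\<xi> \<bullet> c\<bar>"] b by simp
    finally have n: "norm \<xi> ^ N \<le> real DIM('a) ^ N * \<bar>\<xi> \<bullet> b\<bar> ^ N"
      unfolding power_mult_distrib[symmetric] by (intro power_mono) auto
    have Ipos: "I c N \<ge> 0" for c by (simp add: I_def)
    have "norm \<xi> ^ N * norm (fourier \<phi> \<xi>) \<le> real DIM('a) ^ N * \<bar>\<xi> \<bullet> b\<bar> ^ N * norm (fourier \<phi> \<xi>)"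
      by (intro mult_right_mono n) auto
    also have "\<dots> \<le> real DIM('a) ^ N * I b N"
      unfolding mult.assoc using le[OF b(1), of \<xi> N] by (intro mult_left_mono) (auto simp: inner_commute)
    also have "I b N \<le> J" unfolding J_def using b(1) Ipos by (intro member_le_sum) auto
    finally have 1: "norm \<xi> ^ N * norm (fourier \<phi> \<xi>) \<le> real DIM('a) ^ N * J" by (simp add: mult_left_mono)
    have "(1 + norm \<xi>) ^ N \<le> 2 ^ N * (1 + norm \<xi> ^ N)"
    proof (cases "norm \<xi> \<le> 1")
      case True
      then have "(1 + norm \<xi>) ^ N \<le> 2 ^ N" by (intro power_mono) auto
      also have "\<dots> \<le> 2 ^ N * (1 + norm \<xi> ^ N)" by simp
      finally show ?thesis .
    next
      case False
      then have "(1 + norm \<xi>) ^ N \<le> (2 * norm \<xi>) ^ N" by (intro power_mono) auto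
      also have "\<dots> \<le> 2 ^ N * (1 + norm \<xi> ^ N)" by (simp add: power_mult_distrib)
      finally show ?thesis .
    qed
    then have "norm (fourier \<phi> \<xi>) * (1 + norm \<xi>) ^ N \<le> norm (fourier \<phi> \<xi>) * (2 ^ N * (1 + norm \<xi> ^ N))"
      by (intro mult_left_mono) auto
    also have "\<dots> = 2 ^ N * (norm (fourier \<phi> \<xi>) + norm \<xi> ^ N * norm (fourier \<phi> \<xi>))" by (simp add: algebra_simps)
    also have "\<dots> \<le> 2 ^ N * (I (SOME b. b \<in> Basis) 0 + real DIM('a) ^ N * J)"
      by (intro mult_left_mono add_mono 0 1) auto
    finally show ?thesis .
  qed
  then show ?thesis by (rule that)
qed

lemma fourier_integrable:
  fixes \<phi> :: "'a::euclidean_space \<Rightarrow> complex"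
  assumes "\<phi> \<in> schwartz" shows "integrable lborel (fourier \<phi>)"
proof -
  obtain B where "\<And>x. norm (fourier \<phi> x) * (1 + norm x) ^ Suc DIM('a) \<le> B"
    using fourier_decay[OF assms] by blast
  then show ?thesis by (rule integrable_decay[OF borel_measurable_fourier[OF schwartz_measurable[OF assms]]])
qed

subsection \<open>Gaussians\<close>

text \<open>
  A modulated Gaussian in \<open>x\<close>. Its Fourier transform is a Gaussian centred at \<open>y\<close>; these are the test
  functions by which kernels are identified.
\<close>

definition gauss_wave :: "real \<Rightarrow> 'a::euclidean_space \<Rightarrow> 'a \<Rightarrow> complex" where
  "gauss_wave c y x = of_real (exp (- c * (norm x)\<^sup>2)) * unit_char (y \<bullet> x)"

text \<open>
  From \<open>1 + r \<le> exp r\<close> by completing the square in the exponent.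
\<close>

lemma power_gauss_bounded:
  assumes c: "c > 0" and r: "r \<ge> 0"
  shows "(1 + r) ^ K * exp (- c * r\<^sup>2) \<le> exp ((real K)\<^sup>2 / (4 * c))"
proof -
  have "(1 + r) ^ K \<le> exp r ^ K" using exp_ge_add_one_self[of r] r by (intro power_mono) auto
  also have "\<dots> = exp (real K * r)" by (simp add: exp_of_nat_mult)
  finally have "(1 + r) ^ K * exp (- c * r\<^sup>2) \<le> exp (real K * r) * exp (- c * r\<^sup>2)" by (intro mult_right_mono) auto
  also have "\<dots> = exp (real K * r - c * r\<^sup>2)" by (simp add: exp_add[symmetric])
  also have "real K * r - c * r\<^sup>2 = (real K)\<^sup>2 / (4 * c) - (2 * c * r - real K)\<^sup>2 / (4 * c)"
    using c by (simp add: power2_eq_square field_simps)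
  also have "exp ((real K)\<^sup>2 / (4 * c) - (2 * c * r - real K)\<^sup>2 / (4 * c)) \<le> exp ((real K)\<^sup>2 / (4 * c))"
    using c by simp
  finally show ?thesis .
qed

text \<open>
  Polynomial functions on a Euclidean space: the class of factors that absorbs what differentiating
  a Gaussian produces, which is all that membership of Gaussians in the Schwartz space requires.
\<close>

inductive_set poly_fun :: "('a::euclidean_space \<Rightarrow> complex) set" where
  const: "(\<lambda>x. a) \<in> poly_fun"
| coord: "(\<lambda>x. of_real (x \<bullet> v)) \<in> poly_fun"
| add: "p \<in> poly_fun \<Longrightarrow> q \<in> poly_fun \<Longrightarrow> (\<lambda>x. p x + q x) \<in> poly_fun"
| mult: "p \<in> poly_fun \<Longrightarrow> q \<in> poly_fun \<Longrightarrow> (\<lambda>x. p x * q x) \<in> poly_fun"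

lemma poly_fun_derivative:
  assumes "p \<in> poly_fun"
  shows "\<exists>p'. (\<forall>v. p' v \<in> poly_fun) \<and> (\<forall>x. (p has_derivative (\<lambda>v. p' v x)) (at x))"
  using assms
proof induction
  case (const a)
  show ?case by (rule exI[of _ "\<lambda>v x. 0"]) (auto intro: poly_fun.const)
next
  case (coord v)
  show ?case
    by (rule exI[of _ "\<lambda>w x. of_real (w \<bullet> v)"]) (auto intro!: poly_fun.const derivative_eq_intros)
next
  case (add p q)
  then obtain p' q' where 
    "(\<forall>v. p' v \<in> poly_fun) \<and> (\<forall>x. (p has_derivative (\<lambda>v. p' v x)) (at x))"
    "(\<forall>v. q' v \<in> poly_fun) \<and> (\<forall>x. (q has_derivative (\<lambda>v. q' v x)) (at x))" by blast
  then show ?case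
    by (intro exI[of _ "\<lambda>v x. p' v x + q' v x"]) (auto intro!: poly_fun.add derivative_eq_intros)
next
  case (mult p q)
  then obtain p' q' where 
    "(\<forall>v. p' v \<in> poly_fun) \<and> (\<forall>x. (p has_derivative (\<lambda>v. p' v x)) (at x))"
    "(\<forall>v. q' v \<in> poly_fun) \<and> (\<forall>x. (q has_derivative (\<lambda>v. q' v x)) (at x))" by blast
  with mult.hyps show ?case
    by (intro exI[of _ "\<lambda>v x. p x * q' v x + p' v x * q x"])
       (auto intro!: poly_fun.add poly_fun.mult derivative_eq_intros)
qed

lemma poly_fun_growth:
  assumes "p \<in> poly_fun"
  shows "\<exists>C M. C \<ge> 0 \<and> (\<forall>x. norm (p x) \<le> C * (1 + norm x) ^ M)"
  using assms
proof induction
  case (const a)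
  show ?case by (rule exI[of _ "norm a"], rule exI[of _ 0]) simp
next
  case (coord v)
  have "\<bar>x \<bullet> v\<bar> \<le> norm v * (1 + norm x) ^ 1" for x
    using Cauchy_Schwarz_ineq2[of x v] by (simp add: algebra_simps add_increasing)
  then show ?case by (intro exI[of _ "norm v"] exI[of _ 1]) (auto simp: norm_of_real)
next
  case (add p q)
  then obtain C M D N where *: "C \<ge> 0" "\<And>x. norm (p x) \<le> C * (1 + norm x) ^ M" "D \<ge> 0" "\<And>x. norm (q x) \<le> D * (1 + norm x) ^ N" by blast
  have "norm (p x + q x) \<le> (C + D) * (1 + norm x) ^ (M + N)" for x
  proof -
    have 1: "(1 + norm x) ^ M \<le> (1 + norm x) ^ (M + N)" "(1 + norm x) ^ N \<le> (1 + norm x) ^ (M + N)"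
      by (intro power_increasing; simp)+
    have "norm (p x + q x) \<le> C * (1 + norm x) ^ M + D * (1 + norm x) ^ N" using *(2,4) by (intro norm_triangle_le add_mono)
    also have "\<dots> \<le> C * (1 + norm x) ^ (M + N) + D * (1 + norm x) ^ (M + N)"
      by (intro add_mono mult_left_mono 1 *)
    finally show ?thesis by (simp add: algebra_simps)
  qed
  then show ?case using *(1,3) by (intro exI[of _ "C + D"] exI[of _ "M + N"]) auto
next
  case (mult p q)
  then obtain C M D N where *: "C \<ge> 0" "\<And>x. norm (p x) \<le> C * (1 + norm x) ^ M" "D \<ge> 0" "\<And>x. norm (q x) \<le> D * (1 + norm x) ^ N" by blast
  have "norm (p x * q x) \<le> (C * D) * (1 + norm x) ^ (M + N)" for x
  proof -
    have "norm (p x * q x) \<le> (C * (1 + norm x) ^ M) * (D * (1 + norm x) ^ N)"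
      unfolding norm_mult using * by (intro mult_mono) auto
    then show ?thesis by (simp add: power_add mult_ac)
  qed
  then show ?case using *(1,3) by (intro exI[of _ "C * D"] exI[of _ "M + N"]) auto
qed

lemma norm_gauss_wave: "norm (gauss_wave c y x) = exp (- c * (norm x)\<^sup>2)"
  by (simp add: gauss_wave_def norm_mult)

lemma borel_measurable_gauss_wave [measurable]: "gauss_wave c y \<in> borel_measurable borel"
  unfolding gauss_wave_def by measurable

lemma poly_gauss_decay:
  assumes "p \<in> poly_fun" "c > 0"
  obtains B where "\<And>x. norm (p x * gauss_wave c y x) * (1 + norm x) ^ N \<le> B"
proof -
  obtain C M where *: "C \<ge> 0" "\<And>x. norm (p x) \<le> C * (1 + norm x) ^ M"
    using poly_fun_growth[OF assms(1)] by blast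
  have "norm (p x * gauss_wave c y x) * (1 + norm x) ^ N \<le> C * exp ((real (M + N))\<^sup>2 / (4 * c))" for x
  proof -
    have "norm (p x * gauss_wave c y x) * (1 + norm x) ^ N \<le> (C * (1 + norm x) ^ M) * exp (- c * (norm x)\<^sup>2) * (1 + norm x) ^ N"
      unfolding norm_mult norm_gauss_wave by (intro mult_right_mono *) auto
    also have "\<dots> = C * ((1 + norm x) ^ (M + N) * exp (- c * (norm x)\<^sup>2))" by (simp add: power_add mult_ac)
    also have "\<dots> \<le> C * exp ((real (M + N))\<^sup>2 / (4 * c))"
      by (intro mult_left_mono power_gauss_bounded *) (use assms in auto)
    finally show ?thesis .
  qed
  then show ?thesis by (rule that)
qed

lemma gauss_wave_derivative:
  "(gauss_wave c y has_derivative (\<lambda>v. (of_real (-2 * c) * of_real (x \<bullet> v) + 2 * of_real pi * \<i> * of_real (v \<bullet> y)) * gauss_wave c y x)) (at x)"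
proof -
  have eq: "gauss_wave c y = (\<lambda>x. exp (of_real (- c * (x \<bullet> x)) + 2 * of_real pi * \<i> * of_real (x \<bullet> y)))"
    by (simp add: fun_eq_iff gauss_wave_def unit_char_def power2_norm_eq_inner exp_of_real[symmetric] inner_commute)
       (simp add: exp_add[symmetric])
  have "((\<lambda>x. of_real (- c * (x \<bullet> x)) + 2 * of_real pi * \<i> * complex_of_real (x \<bullet> y)) has_derivative
      (\<lambda>v. of_real (-2 * c) * of_real (x \<bullet> v) + 2 * of_real pi * \<i> * of_real (v \<bullet> y))) (at x)"
    by (auto intro!: derivative_eq_intros simp: inner_commute algebra_simps)
  from has_derivative_compose[OF this DERIV_exp[THEN has_field_derivative_imp_has_derivative]]
  show ?thesis unfolding eq by (simp add: mult_ac)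
qed

lemma partials_poly_gauss:
  assumes "p \<in> poly_fun"
  shows "\<exists>q\<in>poly_fun. partials vs (\<lambda>x. p x * gauss_wave c y x) = (\<lambda>x. q x * gauss_wave c y x)"
proof (induction vs)
  case (Cons v vs)
  then obtain q where q: "q \<in> poly_fun" "partials vs (\<lambda>x. p x * gauss_wave c y x) = (\<lambda>x. q x * gauss_wave c y x)" by blast
  obtain q' where q': "\<And>v. q' v \<in> poly_fun" "\<And>x. (q has_derivative (\<lambda>v. q' v x)) (at x)"
    using poly_fun_derivative[OF q(1)] by blast
  define r where "r = (\<lambda>x. q x * (of_real (-2 * c) * of_real (x \<bullet> v) + 2 * of_real pi * \<i> * of_real (v \<bullet> y)) + q' v x)"
  have "frechet_derivative (\<lambda>x. q x * gauss_wave c y x) (at x) v = r x * gauss_wave c y x" for x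
  proof -
    have "((\<lambda>x. q x * gauss_wave c y x) has_derivative 
       (\<lambda>v. q x * ((of_real (-2 * c) * of_real (x \<bullet> v) + 2 * of_real pi * \<i> * of_real (v \<bullet> y)) * gauss_wave c y x) + q' v x * gauss_wave c y x)) (at x)"
      by (rule has_derivative_mult[OF q'(2) gauss_wave_derivative])
    from frechet_derivative_at[OF this, symmetric] show ?thesis by (simp add: r_def algebra_simps)
  qed
  then have "partials (v # vs) (\<lambda>x. p x * gauss_wave c y x) = (\<lambda>x. r x * gauss_wave c y x)"
    using q(2) by simp
  moreover have "r \<in> poly_fun" unfolding r_def by (intro poly_fun.intros q q')
  ultimately show ?case by blast
qed (use assms in auto)

lemma gauss_wave_schwartz:
  assumes c: "c > 0" shows "gauss_wave c y \<in> schwartz"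
proof -
  have "partials vs (gauss_wave c y) differentiable (at x) \<and> bounded (range (\<lambda>x. (1 + norm x) ^ N * norm (partials vs (gauss_wave c y) x)))" for vs x N
  proof -
    obtain q where q: "q \<in> poly_fun" "partials vs (gauss_wave c y) = (\<lambda>x. q x * gauss_wave c y x)"
      using partials_poly_gauss[OF poly_fun.const[of 1], of vs c y] by auto
    obtain q' where q': "\<And>x. (q has_derivative (\<lambda>v. q' v x)) (at x)"
      using poly_fun_derivative[OF q(1)] by blast
    have d: "partials vs (gauss_wave c y) differentiable (at x)"
      unfolding q(2) using has_derivative_mult[OF q' gauss_wave_derivative] by (rule differentiableI)
    obtain B where "\<And>x. norm (q x * gauss_wave c y x) * (1 + norm x) ^ N \<le> B" using poly_gauss_decay[OF q(1) c] by blast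
    then show ?thesis using d unfolding q(2) by (auto simp: bounded_iff mult.commute norm_mult norm_power abs_mult intro!: exI[of _ B])
  qed
  then show ?thesis unfolding schwartz_def by blast
qed

lemma poly_gauss_integrable:
  fixes p :: "'a::euclidean_space \<Rightarrow> complex"
  assumes "p \<in> poly_fun" "c > 0"
  shows "integrable lborel (\<lambda>x. p x * gauss_wave c y x)"
proof -
  have "p differentiable (at x)" for x using poly_fun_derivative[OF assms(1)] by (meson differentiableI)
  then have "continuous_on UNIV p" by (meson differentiable_imp_continuous_within continuous_at_imp_continuous_on)
  then have [measurable]: "p \<in> borel_measurable borel" by (rule borel_measurable_continuous_onI)
  obtain B where "\<And>x. norm (p x * gauss_wave c y x) * (1 + norm x) ^ Suc DIM('a) \<le> B" using poly_gauss_decay[OF assms] by blast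
  then show ?thesis by (rule integrable_decay[rotated]) measurable
qed

lemma integral_gauss_real:
  assumes c: "c > (0::real)"
  shows "integrable lborel (\<lambda>x. exp (- c * x\<^sup>2))" "(LINT x|lborel. exp (- c * x\<^sup>2)) = sqrt (pi / c)"
proof -
  \<comment> \<open>The standard deviation for which the Gaussian is a multiple of a normal density.\<close>
  define s where "s = sqrt (1 / (2 * c))"
  have s: "s > 0" "s\<^sup>2 = 1 / (2 * c)" using c by (simp_all add: s_def)
  have eq: "exp (- c * x\<^sup>2) = sqrt (pi / c) * normal_density 0 s x" for x
    using c by (simp add: normal_density_def s real_sqrt_divide real_sqrt_mult field_simps)
  show "integrable lborel (\<lambda>x. exp (- c * x\<^sup>2))" unfolding eq using s by (intro integrable_mult_right integrable_normal_density)
  show "(LINT x|lborel. exp (- c * x\<^sup>2)) = sqrt (pi / c)" unfolding eq using s by (simp add: integral_normal_density)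
qed

lemma integral_gauss:
  assumes c: "c > 0"
  shows "(LINT x|lborel. exp (- c * (norm (x::'a::euclidean_space))\<^sup>2)) = sqrt (pi / c) ^ DIM('a)"
proof -
  have "exp (- c * (norm x)\<^sup>2) = (\<Prod>b\<in>Basis. exp (- c * (x \<bullet> b)\<^sup>2))" for x :: 'a
  proof -
    have "(norm x)\<^sup>2 = (\<Sum>b\<in>Basis. (x \<bullet> b)\<^sup>2)"
      unfolding power2_norm_eq_inner by (subst euclidean_inner) (simp add: power2_eq_square)
    then show ?thesis by (simp add: exp_sum[symmetric] sum_distrib_left)
  qed
  then have "(\<integral>\<^sup>+x. ennreal (exp (- c * (norm x)\<^sup>2)) \<partial>(lborel::'a measure)) = (\<integral>\<^sup>+x. (\<Prod>b\<in>Basis. ennreal (exp (- c * (x \<bullet> b)\<^sup>2))) \<partial>(lborel::'a measure))"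
    by (simp add: prod_ennreal)
  also have "\<dots> = (\<Prod>b\<in>(Basis::'a set). \<integral>\<^sup>+x. ennreal (exp (- c * x\<^sup>2)) \<partial>lborel)"
    by (rule nn_integral_lborel_prod) auto
  also have "(\<integral>\<^sup>+x. ennreal (exp (- c * x\<^sup>2)) \<partial>lborel) = ennreal (sqrt (pi / c))"
    using integral_gauss_real[OF c] by (subst nn_integral_eq_integral) auto
  also have "(\<Prod>b\<in>(Basis::'a set). ennreal (sqrt (pi / c))) = ennreal (sqrt (pi / c) ^ DIM('a))"
    using c by (simp add: ennreal_power)
  finally show ?thesis using c by (intro integral_eq_nn_integral[THEN trans]) auto
qed

text \<open>
  Along the segment \<open>t \<mapsto> t y\<close> the integral \<open>h(t)\<close> satisfies \<open>h' = - 2 \<kappa> t h\<close> with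
  \<open>\<kappa> = \<pi>\<^sup>2 |y|\<^sup>2 / c\<close>, by one integration by parts in the direction \<open>y\<close>. This reduces the claim to the
  unmodulated case \<open>t = 0\<close> without any complex contour.
\<close>

theorem integral_gauss_wave:
  fixes y :: "'a::euclidean_space"
  assumes c: "c > 0"
  shows "(LINT x|lborel. gauss_wave c y x) = of_real (sqrt (pi / c) ^ DIM('a) * exp (- pi\<^sup>2 * (norm y)\<^sup>2 / c))"
proof -
  define h where "h = (\<lambda>t. LINT x|lborel. gauss_wave c (t *\<^sub>R y) x)"
  define L where "L = (\<lambda>t. LINT x|lborel. of_real (x \<bullet> y) * gauss_wave c (t *\<^sub>R y) x)"
  let ?I = "2 * of_real pi * \<i> :: complex"
  have int: "integrable lborel (gauss_wave c (t *\<^sub>R y))" for t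
    using poly_gauss_integrable[OF poly_fun.const[of 1] c, of "t *\<^sub>R y"] by simp
  have intL: "integrable lborel (\<lambda>x. of_real (x \<bullet> y) * gauss_wave c (t *\<^sub>R y) x)" for t
    by (rule poly_gauss_integrable[OF poly_fun.coord c])
  have h': "(h has_vector_derivative ?I * L t) (at t)" for t
  proof -
    have "(h has_vector_derivative (LINT x|lborel. ?I * (of_real (x \<bullet> y) * gauss_wave c (t *\<^sub>R y) x))) (at t)"
      unfolding h_def
    proof (rule has_vector_derivative_integral)
      fix t x
      show "((\<lambda>t. gauss_wave c (t *\<^sub>R y) x) has_vector_derivative ?I * (of_real (x \<bullet> y) * gauss_wave c (t *\<^sub>R y) x)) (at t)"
        unfolding gauss_wave_def inner_scaleR_left
        using has_vector_derivative_mult_right[OF has_vector_derivative_unit_char[of 0 "y \<bullet> x" t], of "of_real (exp (- c * (norm x)\<^sup>2))"]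
        by (simp add: inner_commute mult_ac)
      show "norm (?I * (of_real (x \<bullet> y) * gauss_wave c (t *\<^sub>R y) x)) \<le> norm (?I * (of_real (x \<bullet> y) * gauss_wave c (0 *\<^sub>R y) x))"
        unfolding norm_mult norm_gauss_wave by simp
    next
      show "integrable lborel (\<lambda>x. norm (?I * (of_real (x \<bullet> y) * gauss_wave c (0 *\<^sub>R y) x)))"
        by (rule integrable_norm[OF integrable_mult_right[OF intL[of 0]]])
    qed (rule int)
    then show ?thesis by (simp only: integral_mult_right_zero L_def)
  qed
  have L: "of_real (2 * c) * L t = ?I * of_real (t * (norm y)\<^sup>2) * h t" for t
  proof -
    let ?D = "\<lambda>x. (of_real (-2 * c) * of_real (x \<bullet> y) + 2 * of_real pi * \<i> * of_real (y \<bullet> (t *\<^sub>R y))) * gauss_wave c (t *\<^sub>R y) x"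
    have p: "(\<lambda>x. of_real (-2 * c) * of_real (x \<bullet> y) + 2 * of_real pi * \<i> * of_real (y \<bullet> (t *\<^sub>R y))) \<in> poly_fun"
      by (intro poly_fun.intros)
    obtain B where B: "\<And>x. norm (?D x) * (1 + norm x) ^ Suc DIM('a) \<le> B" using poly_gauss_decay[OF p c] by blast
    have A1: "integral\<^sup>L lborel ?D = 0"
    proof (rule integral_directional_derivative(2)[OF _ B int[of t], where v = y])
      fix x
      have 1: "(gauss_wave c (t *\<^sub>R y) has_derivative (\<lambda>v. (of_real (-2 * c) * of_real (x \<bullet> v) + 2 * of_real pi * \<i> * of_real (v \<bullet> (t *\<^sub>R y))) * gauss_wave c (t *\<^sub>R y) x)) (at (x + 0 *\<^sub>R y))"
        using gauss_wave_derivative[of c "t *\<^sub>R y" x] by simp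
      have 2: "((\<lambda>s. x + s *\<^sub>R y) has_derivative (\<lambda>s. s *\<^sub>R y)) (at 0)"
        by (auto intro!: derivative_eq_intros)
      from diff_chain_at[OF 2 1]
      show "((\<lambda>s. gauss_wave c (t *\<^sub>R y) (x + s *\<^sub>R y)) has_vector_derivative ?D x) (at 0)"
        by (simp add: has_vector_derivative_def o_def scaleR_conv_of_real algebra_simps)
    qed
    have A2: "integral\<^sup>L lborel ?D = (LINT x|lborel. of_real (-2 * c) * (of_real (x \<bullet> y) * gauss_wave c (t *\<^sub>R y) x) + (?I * of_real (t * (norm y)\<^sup>2)) * gauss_wave c (t *\<^sub>R y) x)"
      by (intro Bochner_Integration.integral_cong) (simp_all add: power2_norm_eq_inner algebra_simps)
    have A3: "\<dots> = of_real (-2 * c) * L t + (?I * of_real (t * (norm y)\<^sup>2)) * h t"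
      by (subst Bochner_Integration.integral_add[OF integrable_mult_right[OF intL] integrable_mult_right[OF int]])
         (simp only: integral_mult_right_zero L_def h_def)
    have "of_real (-2 * c) * L t + (?I * of_real (t * (norm y)\<^sup>2)) * h t = 0"
      by (rule trans[OF A3[symmetric] trans[OF A2[symmetric] A1]])
    then show ?thesis by (simp add: algebra_simps add_eq_0_iff)
  qed
  define \<kappa> where "\<kappa> = pi\<^sup>2 * (norm y)\<^sup>2 / c"
  have h'2: "(h has_vector_derivative - (2 * \<kappa> * t) *\<^sub>R h t) (at t)" for t
  proof -
    have "of_real (2 * c) * (?I * L t) = ?I * (?I * of_real (t * (norm y)\<^sup>2) * h t)"
      unfolding L[symmetric] by (simp add: mult_ac)
    also have "\<dots> = of_real (2 * c) * (- (2 * \<kappa> * t) *\<^sub>R h t)"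
      using c by (simp add: \<kappa>_def scaleR_conv_of_real power2_eq_square)
    finally have "of_real (2 * c) * (?I * L t) = of_real (2 * c) * (- (2 * \<kappa> * t) *\<^sub>R h t)" .
    moreover have "of_real (2 * c) \<noteq> (0::complex)" using c by simp
    ultimately have "?I * L t = - (2 * \<kappa> * t) *\<^sub>R h t" using mult_left_cancel by blast
    then show ?thesis using h'[of t] by simp
  qed
  have "((\<lambda>t. exp (\<kappa> * t\<^sup>2) *\<^sub>R h t) has_vector_derivative 0) (at t within {0..1})" for t
  proof (rule has_vector_derivative_at_within)
    have "((\<lambda>t. exp (\<kappa> * t\<^sup>2)) has_real_derivative (2 * \<kappa> * t * exp (\<kappa> * t\<^sup>2))) (at t)"
      by (auto intro!: derivative_eq_intros)
    from has_vector_derivative_scaleR[OF this h'2[of t]]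
    show "((\<lambda>t. exp (\<kappa> * t\<^sup>2) *\<^sub>R h t) has_vector_derivative 0) (at t)"
      by (simp add: algebra_simps)
  qed
  from has_vector_derivative_zero_constant[OF _ this]
  obtain d where d: "\<And>t. t \<in> {0..1} \<Longrightarrow> exp (\<kappa> * t\<^sup>2) *\<^sub>R h t = d" by auto
  have "exp \<kappa> *\<^sub>R h 1 = h 0" using d[of 0] d[of 1] by simp
  then have "h 1 = exp (- \<kappa>) *\<^sub>R h 0" by (metis exp_minus_inverse mult.commute scaleR_one scaleR_scaleR)
  moreover have "h 0 = of_real (sqrt (pi / c) ^ DIM('a))"
  proof -
    have "h 0 = (LINT x|lborel. complex_of_real (exp (- c * (norm (x::'a))\<^sup>2)))"
      by (simp add: h_def gauss_wave_def)
    then show ?thesis unfolding integral_complex_of_real integral_gauss[OF c] .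
  qed
  ultimately show ?thesis by (simp add: h_def \<kappa>_def scaleR_conv_of_real mult.commute)
qed

lemma nn_integral_product_finite:
  fixes f :: "'x \<Rightarrow> 'y \<Rightarrow> complex" and u :: "'x \<Rightarrow> real" and v :: "'y \<Rightarrow> real"
  assumes le: "AE x in M1. AE y in M2. norm (f x y) \<le> u x * v y"
    and u: "integrable M1 u" "\<And>x. u x \<ge> 0" and v: "integrable M2 v" "\<And>y. v y \<ge> 0"
  shows "(\<integral>\<^sup>+x. \<integral>\<^sup>+y. ennreal (norm (f x y)) \<partial>M2 \<partial>M1) < \<infinity>"
proof -
  have um: "u \<in> borel_measurable M1" and vm: "v \<in> borel_measurable M2" using u v by auto
  have "(\<integral>\<^sup>+x. \<integral>\<^sup>+y. ennreal (norm (f x y)) \<partial>M2 \<partial>M1) \<le> (\<integral>\<^sup>+x. \<integral>\<^sup>+y. ennreal (u x) * ennreal (v y) \<partial>M2 \<partial>M1)"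
    using le by (intro nn_integral_mono_AE) (auto elim!: eventually_mono intro!: nn_integral_mono_AE simp: ennreal_mult[symmetric] u v ennreal_leI)
  also have "\<dots> = (\<integral>\<^sup>+x. ennreal (u x) * (\<integral>\<^sup>+y. ennreal (v y) \<partial>M2) \<partial>M1)"
    using vm by (intro nn_integral_cong nn_integral_cmult) auto
  also have "\<dots> = (\<integral>\<^sup>+x. ennreal (u x) \<partial>M1) * (\<integral>\<^sup>+y. ennreal (v y) \<partial>M2)"
    using um by (intro nn_integral_multc) auto
  also have "\<dots> = ennreal (integral\<^sup>L M1 u) * ennreal (integral\<^sup>L M2 v)"
    using u v by (simp add: nn_integral_eq_integral)
  also have "\<dots> < \<infinity>" by (simp add: ennreal_mult_less_top)
  finally show ?thesis .
qed

lemma integrable_gauss_wave: "c > 0 \<Longrightarrow> integrable lborel (gauss_wave c y)"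
  by (rule schwartz_integrable[OF gauss_wave_schwartz])

text \<open>
  Inserting the factor \<open>exp (- \<epsilon> |y|^2)\<close> makes Fubini's theorem applicable and turns the left-hand
  side into a Gaussian average of \<open>\<phi>\<close> around \<open>x\<close>, which concentrates at \<open>x\<close> as \<open>\<epsilon>\<close> tends to \<open>0\<close>.
\<close>

theorem fourier_inversion:
  fixes \<phi> :: "'a::euclidean_space \<Rightarrow> complex"
  assumes \<phi>: "\<phi> \<in> schwartz"
  shows "(LINT y|lborel. fourier \<phi> y * unit_char (x \<bullet> y)) = \<phi> x"
proof -
  note [measurable] = schwartz_measurable[OF \<phi>] borel_measurable_fourier[OF schwartz_measurable[OF \<phi>]]
  define \<epsilon> where "\<epsilon> = (\<lambda>k. 1 / real (Suc k))"
  have \<epsilon>: "\<epsilon> k > 0" for k by (simp add: \<epsilon>_def)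
  have \<epsilon>0: "\<epsilon> \<longlonglongrightarrow> 0" unfolding \<epsilon>_def by (rule LIMSEQ_Suc) (rule lim_const_over_n)
  \<comment> \<open>The factor \<open>unit_char (x \<bullet> y)\<close> is absorbed into the Gaussian wave.\<close>
  define J where "J = (\<lambda>k. LINT y|lborel. fourier \<phi> y * gauss_wave (\<epsilon> k) x y)"
  have "J \<longlonglongrightarrow> (LINT y|lborel. fourier \<phi> y * unit_char (x \<bullet> y))"
    unfolding J_def
  proof (rule integral_dominated_convergence[where w = "\<lambda>y. norm (fourier \<phi> y)"])
    show "integrable lborel (\<lambda>y. norm (fourier \<phi> y))" by (rule integrable_norm[OF fourier_integrable[OF \<phi>]])
    show "AE y in lborel. (\<lambda>k. fourier \<phi> y * gauss_wave (\<epsilon> k) x y) \<longlonglongrightarrow> fourier \<phi> y * unit_char (x \<bullet> y)"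
      unfolding gauss_wave_def by (intro AE_I2) (auto intro!: tendsto_eq_intros \<epsilon>0)
    show "AE y in lborel. norm (fourier \<phi> y * gauss_wave (\<epsilon> k) x y) \<le> norm (fourier \<phi> y)" for k
      using \<epsilon>[of k] by (intro AE_I2) (auto simp: norm_mult norm_gauss_wave intro!: mult_left_le)
  qed auto
  moreover have "J \<longlonglongrightarrow> \<phi> x"
  proof -
    have Jk: "J k = of_real (sqrt pi ^ DIM('a)) * (LINT w|lborel. \<phi> (x + sqrt (\<epsilon> k) *\<^sub>R w) * of_real (exp (- pi\<^sup>2 * (norm w)\<^sup>2)))" for k
    proof -
      have eq1: "fourier \<phi> y * gauss_wave (\<epsilon> k) x y = (LINT z|lborel. \<phi> z * gauss_wave (\<epsilon> k) (x - z) y)" for y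
      proof -
        have "fourier \<phi> y * gauss_wave (\<epsilon> k) x y = (LINT z|lborel. \<phi> z * unit_char (- (z \<bullet> y)) * gauss_wave (\<epsilon> k) x y)"
          unfolding fourier_lborel[OF schwartz_measurable[OF \<phi>]] by simp
        also have "\<dots> = (LINT z|lborel. \<phi> z * gauss_wave (\<epsilon> k) (x - z) y)"
          by (intro Bochner_Integration.integral_cong) (auto simp: gauss_wave_def inner_diff_left unit_char_add[of _ "- _", simplified] mult_ac)
        finally show ?thesis .
      qed
      have "J k = (LINT y|lborel. LINT z|lborel. \<phi> z * gauss_wave (\<epsilon> k) (x - z) y)"
        unfolding J_def eq1 ..
      also have "\<dots> = (LINT z|lborel. LINT y|lborel. \<phi> z * gauss_wave (\<epsilon> k) (x - z) y)"
      proof (rule Fubini_finite(1)[symmetric])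
        show "(\<lambda>(z, y). \<phi> z * gauss_wave (\<epsilon> k) (x - z) y) \<in> borel_measurable (lborel \<Otimes>\<^sub>M lborel)"
          unfolding gauss_wave_def by measurable
        show "(\<integral>\<^sup>+z. \<integral>\<^sup>+y. ennreal (norm (\<phi> z * gauss_wave (\<epsilon> k) (x - z) y)) \<partial>lborel \<partial>lborel) < \<infinity>"
        proof (rule nn_integral_product_finite[where u = "\<lambda>z. norm (\<phi> z)" and v = "\<lambda>y. norm (gauss_wave (\<epsilon> k) 0 y)"])
          show "AE z in lborel. AE y in lborel. norm (\<phi> z * gauss_wave (\<epsilon> k) (x - z) y) \<le> norm (\<phi> z) * norm (gauss_wave (\<epsilon> k) 0 y)"
            by (intro AE_I2) (simp add: norm_mult norm_gauss_wave)
        qed (simp_all only: norm_ge_zero integrable_norm schwartz_integrable[OF \<phi>] integrable_gauss_wave[OF \<epsilon>])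
      qed (rule sigma_finite_lborel)+
      also have "\<dots> = (LINT z|lborel. \<phi> z * of_real (sqrt (pi / \<epsilon> k) ^ DIM('a) * exp (- pi\<^sup>2 * (norm (x - z))\<^sup>2 / \<epsilon> k)))"
        by (simp only: integral_mult_right_zero integral_gauss_wave[OF \<epsilon>])
      also have "\<dots> = \<bar>sqrt (\<epsilon> k)\<bar> ^ DIM('a) *\<^sub>R (LINT w|lborel. \<phi> (x + sqrt (\<epsilon> k) *\<^sub>R w) * of_real (sqrt (pi / \<epsilon> k) ^ DIM('a) * exp (- pi\<^sup>2 * (norm (x - (x + sqrt (\<epsilon> k) *\<^sub>R w)))\<^sup>2 / \<epsilon> k)))"
        by (rule integral_lborel_affine(2)) (use \<epsilon>[of k] in auto)
      also have "\<dots> = (LINT w|lborel. of_real (sqrt pi ^ DIM('a)) * (\<phi> (x + sqrt (\<epsilon> k) *\<^sub>R w) * of_real (exp (- pi\<^sup>2 * (norm w)\<^sup>2))))"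
      proof -
        have "sqrt (\<epsilon> k) ^ DIM('a) * sqrt (pi / \<epsilon> k) ^ DIM('a) = sqrt pi ^ DIM('a)"
          using \<epsilon>[of k] by (simp add: power_mult_distrib[symmetric] real_sqrt_mult[symmetric])
        then have "\<bar>sqrt (\<epsilon> k)\<bar> ^ DIM('a) *\<^sub>R (\<phi> (x + sqrt (\<epsilon> k) *\<^sub>R w) * of_real (sqrt (pi / \<epsilon> k) ^ DIM('a) * exp (- pi\<^sup>2 * (norm (x - (x + sqrt (\<epsilon> k) *\<^sub>R w)))\<^sup>2 / \<epsilon> k)))
          = of_real (sqrt pi ^ DIM('a)) * (\<phi> (x + sqrt (\<epsilon> k) *\<^sub>R w) * of_real (exp (- pi\<^sup>2 * (norm w)\<^sup>2)))" for w :: 'a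
          using \<epsilon>[of k] by (simp add: scaleR_conv_of_real power_mult_distrib mult_ac of_real_mult[symmetric] del: of_real_mult of_real_power)
        then show ?thesis by (simp only: integral_scaleR_right[symmetric])
      qed
      finally show ?thesis by (simp only: integral_mult_right_zero)
    qed
    obtain B where B: "\<And>z. norm (\<phi> z) * (1 + norm z) ^ 0 \<le> B" using schwartz_bound[OF \<phi>] by blast
    have pi2: "pi\<^sup>2 > 0" by simp
    have g: "integrable lborel (\<lambda>w::'a. exp (- pi\<^sup>2 * (norm w)\<^sup>2))"
      using integrable_norm[OF integrable_gauss_wave[OF pi2, of 0]] by (simp add: norm_gauss_wave)
    have "(\<lambda>k. LINT w|lborel. \<phi> (x + sqrt (\<epsilon> k) *\<^sub>R w) * of_real (exp (- pi\<^sup>2 * (norm w)\<^sup>2)))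
       \<longlonglongrightarrow> (LINT w|lborel. \<phi> x * of_real (exp (- pi\<^sup>2 * (norm (w::'a))\<^sup>2)))"
    proof (rule integral_dominated_convergence[where w = "\<lambda>w::'a. B * exp (- pi\<^sup>2 * (norm w)\<^sup>2)"])
      have "isCont \<phi> x" using schwartz_continuous[OF \<phi>, of UNIV] by (simp add: continuous_on_eq_continuous_at)
      moreover have "(\<lambda>k. x + sqrt (\<epsilon> k) *\<^sub>R w) \<longlonglongrightarrow> x" for w by (auto intro!: tendsto_eq_intros \<epsilon>0)
      ultimately have "(\<lambda>k. \<phi> (x + sqrt (\<epsilon> k) *\<^sub>R w)) \<longlonglongrightarrow> \<phi> x" for w by (rule isCont_tendsto_compose)
      then show "AE w in lborel. (\<lambda>k. \<phi> (x + sqrt (\<epsilon> k) *\<^sub>R w) * of_real (exp (- pi\<^sup>2 * (norm w)\<^sup>2))) \<longlonglongrightarrow> \<phi> x * of_real (exp (- pi\<^sup>2 * (norm w)\<^sup>2))"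
        by (intro AE_I2 tendsto_mult tendsto_const)
      show "AE w in lborel. norm (\<phi> (x + sqrt (\<epsilon> k) *\<^sub>R w) * of_real (exp (- pi\<^sup>2 * (norm w)\<^sup>2))) \<le> B * exp (- pi\<^sup>2 * (norm w)\<^sup>2)" for k
        using B by (intro AE_I2) (auto simp: norm_mult intro!: mult_right_mono)
    qed (use g in auto)
    also have "(LINT w|lborel. \<phi> x * of_real (exp (- pi\<^sup>2 * (norm (w::'a))\<^sup>2))) = \<phi> x * of_real (sqrt (pi / pi\<^sup>2) ^ DIM('a))"
      by (simp only: integral_mult_right_zero integral_complex_of_real integral_gauss[OF pi2])
    finally have L1: "(\<lambda>k. of_real (sqrt pi ^ DIM('a)) * (LINT w|lborel. \<phi> (x + sqrt (\<epsilon> k) *\<^sub>R w) * of_real (exp (- pi\<^sup>2 * (norm w)\<^sup>2))))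
      \<longlonglongrightarrow> of_real (sqrt pi ^ DIM('a)) * (\<phi> x * of_real (sqrt (pi / pi\<^sup>2) ^ DIM('a)))"
      by (intro tendsto_mult tendsto_const)
    have "sqrt pi * sqrt (pi / pi\<^sup>2) = 1"
      by (simp add: real_sqrt_mult[symmetric] power2_eq_square)
    then have "sqrt pi ^ DIM('a) * sqrt (pi / pi\<^sup>2) ^ DIM('a) = 1" by (simp add: power_mult_distrib[symmetric])
    then have E: "of_real (sqrt pi ^ DIM('a)) * (\<phi> x * of_real (sqrt (pi / pi\<^sup>2) ^ DIM('a))) = \<phi> x"
    proof -
      assume 1: "sqrt pi ^ DIM('a) * sqrt (pi / pi\<^sup>2) ^ DIM('a) = 1"
      have "of_real (sqrt pi ^ DIM('a)) * (\<phi> x * of_real (sqrt (pi / pi\<^sup>2) ^ DIM('a)))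
        = \<phi> x * of_real (sqrt pi ^ DIM('a) * sqrt (pi / pi\<^sup>2) ^ DIM('a))"
        by (simp only: of_real_mult mult_ac)
      then show ?thesis unfolding 1 by simp
    qed
    show ?thesis unfolding Jk using L1 unfolding E .
  qed
  ultimately show ?thesis by (rule LIMSEQ_unique)
qed

text \<open>
  By Fubini's theorem and Fourier inversion: the statement that the inverse Fourier transform of an
  integrable \<open>m\<close>, taken pointwise, is also its inverse Fourier transform as a distribution.
\<close>

lemma multiplication_formula:
  fixes \<phi> :: "'a::euclidean_space \<Rightarrow> complex"
  assumes \<phi>: "\<phi> \<in> schwartz" and m: "integrable lborel m"
  shows "(LINT y|lborel. (LINT x|lborel. m x * unit_char (x \<bullet> y)) * fourier \<phi> y) = (LINT x|lborel. m x * \<phi> x)"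
proof -
  note [measurable] = schwartz_measurable[OF \<phi>] borel_measurable_fourier[OF schwartz_measurable[OF \<phi>]]
  have [measurable]: "m \<in> borel_measurable borel" using m by simp
  have "(LINT y|lborel. (LINT x|lborel. m x * unit_char (x \<bullet> y)) * fourier \<phi> y) = (LINT y|lborel. LINT x|lborel. m x * unit_char (x \<bullet> y) * fourier \<phi> y)"
    by simp
  also have "\<dots> = (LINT x|lborel. LINT y|lborel. m x * unit_char (x \<bullet> y) * fourier \<phi> y)"
  proof (rule Fubini_finite(1)[symmetric])
    show "(\<lambda>(x, y). m x * unit_char (x \<bullet> y) * fourier \<phi> y) \<in> borel_measurable (lborel \<Otimes>\<^sub>M lborel)"
      by measurable
    show "(\<integral>\<^sup>+x. \<integral>\<^sup>+y. ennreal (norm (m x * unit_char (x \<bullet> y) * fourier \<phi> y)) \<partial>lborel \<partial>lborel) < \<infinity>"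
    proof (rule nn_integral_product_finite[where u = "\<lambda>z. norm (m z)" and v = "\<lambda>y. norm (fourier \<phi> y)"])
      show "AE x in lborel. AE y in lborel. norm (m x * unit_char (x \<bullet> y) * fourier \<phi> y) \<le> norm (m x) * norm (fourier \<phi> y)"
        by (intro AE_I2) (simp add: norm_mult)
    qed (simp_all only: norm_ge_zero integrable_norm fourier_integrable[OF \<phi>] m)
  qed (rule sigma_finite_lborel)+
  also have "\<dots> = (LINT x|lborel. m x * (LINT y|lborel. fourier \<phi> y * unit_char (x \<bullet> y)))"
  proof -
    have "m x * unit_char (x \<bullet> y) * fourier \<phi> y = m x * (fourier \<phi> y * unit_char (x \<bullet> y))" for x y
      by (simp only: mult_ac)
    then show ?thesis by (simp only: integral_mult_right_zero)
  qed
  finally show ?thesis unfolding fourier_inversion[OF \<phi>] .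
qed

section \<open>Subordination to Bochner--Riesz multipliers\<close>

text \<open>
  Taylor's formula with integral remainder, expanded at \<open>T k\<close> and evaluated at \<open>s\<close>, as \<open>T k\<close> moves to the
  far end of the interval \<open>S\<close>. The conditions on \<open>S\<close> cover \<open>(s, \<infinity>)\<close> and \<open>(s, 1)\<close>, the two cases needed:
  decay at infinity and vanishing at \<open>1\<close> both remove the boundary terms.
\<close>

lemma Taylor_from_boundary:
  fixes F :: "nat \<Rightarrow> real \<Rightarrow> complex"
  assumes J: "J > 0"
    and der: "\<And>i u. i < J \<Longrightarrow> u \<in> insert s S \<Longrightarrow> (F i has_vector_derivative F (Suc i) u) (at u)"
    and S: "\<And>u. u \<in> S \<Longrightarrow> s < u" "\<And>u v. v \<in> S \<Longrightarrow> s < u \<Longrightarrow> u \<le> v \<Longrightarrow> u \<in> S"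
    and T: "\<And>k. T k \<in> S" "\<And>u. u \<in> S \<Longrightarrow> \<forall>\<^sub>F k in sequentially. u \<le> T k"
    and bdry: "\<And>i. i < J \<Longrightarrow> (\<lambda>k. (T k - s) ^ i *\<^sub>R F i (T k)) \<longlonglongrightarrow> 0"
    and int: "set_integrable lborel S (\<lambda>u. (u - s) ^ (J - 1) *\<^sub>R F J u)"
    and Sm: "S \<in> sets borel"
  shows "F 0 s = ((-1) ^ J / fact (J - 1)) *\<^sub>R (LINT u:S|lborel. (u - s) ^ (J - 1) *\<^sub>R F J u)"
proof -
  let ?g = "\<lambda>u. (u - s) ^ (J - 1) *\<^sub>R F J u" and ?K = "(-1) ^ J / fact (J - 1) :: real"
  have eq: "F 0 s - (\<Sum>i<J. ((-1) ^ i / fact i) *\<^sub>R ((T k - s) ^ i *\<^sub>R F i (T k))) = ?K *\<^sub>R (LINT u:{s<..T k}|lborel. ?g u)" for k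
  proof -
    have Tk: "s < T k" using S T by blast
    \<comment> \<open>Reflection puts the centre \<open>T k\<close> of the expansion on the left of \<open>s\<close>.\<close>
    define Df where "Df = (\<lambda>i x. ((-1) ^ i :: real) *\<^sub>R F i (- x))"
    have "((\<lambda>x. ((- s - x) ^ (J - 1) / fact (J - 1)) *\<^sub>R Df J x) has_integral
        Df 0 (- s) - (\<Sum>i<J. ((- s - (- T k)) ^ i / fact i) *\<^sub>R Df i (- T k))) {- T k.. - s}"
    proof (rule Taylor_has_integral[where f = "Df 0" and Df = Df and p = J])
      fix i t assume i: "i < J" and t: "- T k \<le> t" "t \<le> - s"
      have mem: "- t \<in> insert s S" using t S(2)[OF T(1)[of k], of "- t"] by (cases "t = - s") auto
      have "(uminus has_vector_derivative (-1)) (at t)" by (auto intro!: derivative_eq_intros)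
      from vector_diff_chain_at[OF this, of "F i"] der[OF i mem]
      have "(F i \<circ> uminus has_vector_derivative (-1) *\<^sub>R F (Suc i) (- t)) (at t)" by blast
      then have "((\<lambda>x. F i (- x)) has_vector_derivative - F (Suc i) (- t)) (at t)" by (simp add: o_def)
      then have "((\<lambda>x. ((-1) ^ i :: real) *\<^sub>R F i (- x)) has_vector_derivative ((-1) ^ i :: real) *\<^sub>R (- F (Suc i) (- t))) (at t)"
        by (rule bounded_linear.has_vector_derivative[OF bounded_linear_scaleR_right])
      then show "(Df i has_vector_derivative Df (Suc i) t) (at t within {- T k..- s})"
        unfolding Df_def by (rule has_vector_derivative_at_within[OF has_vector_derivative_eq_rhs]) simp
    qed (use J Tk in auto)
    moreover have "(\<lambda>x. ((- s - x) ^ (J - 1) / fact (J - 1)) *\<^sub>R Df J x) = (\<lambda>x. ?K *\<^sub>R ?g (- x))"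
    proof
      fix x
      have eq: "- s - x = - x - s" by simp
      show "((- s - x) ^ (J - 1) / fact (J - 1)) *\<^sub>R Df J x = ?K *\<^sub>R ?g (- x)"
        unfolding eq by (simp add: Df_def divide_inverse mult_ac)
    qed
    moreover have "((- s - (- T k)) ^ i / fact i) *\<^sub>R Df i (- T k) = ((-1) ^ i / fact i) *\<^sub>R ((T k - s) ^ i *\<^sub>R F i (T k))" for i
    proof -
      have eq: "- s - (- T k) = T k - s" by simp
      show ?thesis unfolding eq by (simp add: Df_def divide_inverse mult_ac)
    qed
    moreover have "Df 0 (- s) = F 0 s" by (simp add: Df_def)
    ultimately have "((\<lambda>x. ?K *\<^sub>R ?g (- x)) has_integral F 0 s - (\<Sum>i<J. ((-1) ^ i / fact i) *\<^sub>R ((T k - s) ^ i *\<^sub>R F i (T k)))) {- T k.. - s}"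
      by (simp only:)
    then have "((\<lambda>x. ?K *\<^sub>R ?g x) has_integral F 0 s - (\<Sum>i<J. ((-1) ^ i / fact i) *\<^sub>R ((T k - s) ^ i *\<^sub>R F i (T k)))) {s..T k}"
      by (subst (asm) has_integral_reflect_real[where f = "\<lambda>x. ?K *\<^sub>R ?g x"]) 
    then have "((\<lambda>x. ?K *\<^sub>R ?g x) has_integral F 0 s - (\<Sum>i<J. ((-1) ^ i / fact i) *\<^sub>R ((T k - s) ^ i *\<^sub>R F i (T k)))) {s<..T k}"
      by (rule has_integral_spike_set_eq[THEN iffD1, rotated -1]) (auto intro: negligible_subset[of "{s}"])
    then have 1: "integral {s<..T k} (\<lambda>x. ?K *\<^sub>R ?g x) = F 0 s - (\<Sum>i<J. ((-1) ^ i / fact i) *\<^sub>R ((T k - s) ^ i *\<^sub>R F i (T k)))"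
      by (rule integral_unique)
    have sub: "{s<..T k} \<subseteq> S" using S(2)[OF T(1)] by auto
    have "set_integrable lborel {s<..T k} ?g" using set_integrable_subset[OF int _ sub] by simp
    then have "set_integrable lborel {s<..T k} (\<lambda>x. ?K *\<^sub>R ?g x)" by (rule set_integrable_scaleR_right)
    from set_borel_integral_eq_integral(2)[OF this] show ?thesis
      unfolding 1 set_integral_scaleR_right by (rule sym)
  qed
  have "(\<lambda>k. ?K *\<^sub>R (LINT u:{s<..T k}|lborel. ?g u)) \<longlonglongrightarrow> ?K *\<^sub>R (LINT u:S|lborel. ?g u)"
  proof (intro tendsto_scaleR tendsto_const)
    show "(\<lambda>k. LINT u:{s<..T k}|lborel. ?g u) \<longlonglongrightarrow> (LINT u:S|lborel. ?g u)"
      unfolding set_lebesgue_integral_def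
    proof (rule integral_dominated_convergence[where w = "\<lambda>u. norm (indicator S u *\<^sub>R ?g u)"])
      have sub: "{s<..T k} \<subseteq> S" for k using S(2)[OF T(1)] by auto
      show "(\<lambda>u. indicator {s<..T k} u *\<^sub>R ?g u) \<in> borel_measurable lborel" for k
        using set_integrable_subset[OF int _ sub] by (auto simp: set_integrable_def)
      show "(\<lambda>u. indicator S u *\<^sub>R ?g u) \<in> borel_measurable lborel"
        by (rule borel_measurable_integrable[OF int[unfolded set_integrable_def]])
      show "integrable lborel (\<lambda>u. norm (indicator S u *\<^sub>R ?g u))"
        by (rule integrable_norm[OF int[unfolded set_integrable_def]])
      show "AE u in lborel. norm (indicator {s<..T k} u *\<^sub>R ?g u) \<le> norm (indicator S u *\<^sub>R ?g u)" for k
        using sub[of k] by (intro AE_I2) (auto simp: indicator_def)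
      show "AE u in lborel. (\<lambda>k. indicator {s<..T k} u *\<^sub>R ?g u) \<longlonglongrightarrow> indicator S u *\<^sub>R ?g u"
      proof (rule AE_I2)
        fix u
        show "(\<lambda>k. indicator {s<..T k} u *\<^sub>R ?g u) \<longlonglongrightarrow> indicator S u *\<^sub>R ?g u"
        proof (cases "u \<in> S")
          case True
          have "\<forall>\<^sub>F k in sequentially. indicator {s<..T k} u *\<^sub>R ?g u = indicator S u *\<^sub>R ?g u"
            using T(2)[OF True] by eventually_elim (use True S(1)[OF True] in auto)
          then show ?thesis by (rule tendsto_eventually)
        next
          case False
          then have "u \<notin> {s<..T k}" for k using sub by blast
          then show ?thesis using False by simp
        qed
      qed
    qed
  qed
  moreover have "(\<lambda>k. F 0 s - (\<Sum>i<J. ((-1) ^ i / fact i) *\<^sub>R ((T k - s) ^ i *\<^sub>R F i (T k)))) \<longlonglongrightarrow> F 0 s - (\<Sum>i<J. ((-1) ^ i / fact i) *\<^sub>R 0)"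
    by (intro tendsto_diff tendsto_const tendsto_sum tendsto_scaleR bdry) auto
  ultimately show ?thesis unfolding eq using LIMSEQ_unique by fastforce
qed

text \<open>
  Dividing out the removable zero at \<open>a\<close> again and again. Powers of \<open>a - z\<close> are used because they
  match \<open>1 - s\<close> in the multipliers of the ball.
\<close>

lemma holomorphic_Taylor_factor:
  assumes "f holomorphic_on ball a r" "r > 0"
  shows "\<exists>c h. h holomorphic_on ball a r \<and> (\<forall>z\<in>ball a r. f z = (\<Sum>j<J. c j * (a - z) ^ j) + (a - z) ^ J * h z)"
proof (induction J)
  case 0
  show ?case using assms by auto
next
  case (Suc J)
  then obtain c h where h: "h holomorphic_on ball a r" "\<And>z. z \<in> ball a r \<Longrightarrow> f z = (\<Sum>j<J. c j * (a - z) ^ j) + (a - z) ^ J * h z" by blast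
  define h' where "h' = (\<lambda>z. - (if z = a then deriv h a else (h z - h a) / (z - a)))"
  have "h' holomorphic_on ball a r"
    unfolding h'_def using h(1) assms(2) by (intro holomorphic_on_minus pole_lemma) auto
  moreover have "f z = (\<Sum>j<Suc J. (c(J := h a)) j * (a - z) ^ j) + (a - z) ^ Suc J * h' z" if "z \<in> ball a r" for z
  proof -
    have hz: "h z = h a + (a - z) * h' z" by (auto simp: h'_def field_simps)
    have "(\<Sum>j<Suc J. (c(J := h a)) j * (a - z) ^ j) = (\<Sum>j<J. c j * (a - z) ^ j) + h a * (a - z) ^ J"
      by simp
    then show ?thesis unfolding h(2)[OF that] by (subst hz) (simp add: algebra_simps)
  qed
  ultimately show ?case by blast
qed

lemma higher_deriv_ball_bound:
  assumes "f holomorphic_on S" "open S" "cball a r \<subseteq> S" "r > 0" "\<And>z. z \<in> cball a r \<Longrightarrow> norm (f z) \<le> B"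
  shows "norm ((deriv ^^ i) f a) \<le> fact i * B / r ^ i"
proof (rule Cauchy_inequality)
  show "f holomorphic_on ball a r" using assms(1,3) by (meson ball_subset_cball holomorphic_on_subset)
  show "continuous_on (cball a r) f" using assms(1,3) by (meson continuous_on_subset holomorphic_on_imp_continuous_on)
  show "norm (f x) \<le> B" if "norm (a - x) = r" for x
    using that by (intro assms(5)) (simp add: dist_norm)
qed fact

lemma higher_deriv_real_line:
  assumes "f holomorphic_on S" "open S" "of_real u \<in> S"
  shows "((\<lambda>u. (deriv ^^ i) f (of_real u)) has_vector_derivative (deriv ^^ Suc i) f (of_real u)) (at u)"
proof -
  have "(deriv ^^ i) f holomorphic_on S" by (rule holomorphic_higher_deriv[OF assms(1,2)])
  from holomorphic_derivI[OF this assms(2,3)]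
  show ?thesis by (intro has_vector_derivative_real_field) simp
qed

lemma norm_powr_of_real: "norm (z powr complex_of_real a) = norm z powr a"
  by (simp add: norm_powr_real_powr')

text \<open>
  In the right half-plane the arguments are below \<open>\<pi> / 2\<close>, so their sum stays on the principal
  branch of the logarithm.
\<close>

lemma powr_mult_right_half_plane:
  assumes "Re w > 0" "Re z > 0"
  shows "(w * z) powr a = w powr a * z powr a"
proof -
  have 0: "w \<noteq> 0" "z \<noteq> 0" using assms by auto
  have "\<bar>Im (Ln w)\<bar> < pi / 2" "\<bar>Im (Ln z)\<bar> < pi / 2"
    using assms 0 Re_Ln_pos_lt by blast+
  then have "Ln (w * z) = Ln w + Ln z" using 0 by (intro Ln_times_simple) auto
  then show ?thesis using 0 by (simp add: powr_def exp_add[symmetric] algebra_simps)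
qed

lemma one_minus_powr_bound:
  fixes \<delta> q :: real
  assumes q: "0 < q" "q < 1"
  obtains C where "C \<ge> 0" "\<And>w::complex. norm w \<le> q \<Longrightarrow> norm ((1 - w) powr of_real \<delta> - 1) \<le> C * norm w"
proof -
  let ?f = "\<lambda>w::complex. (1 - w) powr of_real \<delta>"
  let ?f' = "\<lambda>w::complex. - (of_real \<delta> * (1 - w) powr (of_real \<delta> - 1))"
  have posRe: "Re w < 1" if "norm w \<le> q" for w :: complex
    using complex_Re_le_cmod[of w] that q by linarith
  have pos: "1 - w \<notin> \<real>\<^sub>\<le>\<^sub>0" if "norm w \<le> q" for w :: complex
  proof -
    have "Re w \<le> norm w" by (rule complex_Re_le_cmod)
    then have "Re (1 - w) > 0" using that q by simp
    then show ?thesis by (auto simp: complex_nonpos_Reals_iff)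
  qed
  have "continuous_on (cball 0 q) ?f'"
    by (intro holomorphic_on_imp_continuous_on holomorphic_intros) (simp_all add: pos)
  then have "compact (?f' ` cball 0 q)" by (intro compact_continuous_image) auto
  then obtain C where C: "\<And>w. w \<in> cball 0 q \<Longrightarrow> norm (?f' w) \<le> C" 
    by (metis (no_types, lifting) bounded_iff compact_imp_bounded imageI)
  have "C \<ge> 0" using C[of 0] q norm_ge_zero order_trans by (metis centre_in_cball less_imp_le)
  moreover have "norm (?f w - 1) \<le> C * norm w" if "norm w \<le> q" for w
  proof -
    have "norm (?f w - ?f 0) \<le> C * norm (w - 0)"
    proof (rule field_differentiable_bound[of "cball 0 q"])
      show "(?f has_field_derivative ?f' z) (at z within cball 0 q)" if "z \<in> cball 0 q" for z
        using pos[of z] that by (auto intro!: derivative_eq_intros)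
    qed (use C that q in auto)
    then show ?thesis by simp
  qed
  ultimately show ?thesis by (rule that)
qed

text \<open>
  On this set every power that occurs in the symbol, as a function of \<open>z = |\<xi>|^2\<close>, is holomorphic in
  its principal branch. It contains the disc around \<open>u\<close> of each radius below \<open>min u (1 - u)\<close>, so Cauchy's
  inequality can be used at the scale of the distance to the two singular points \<open>0\<close> and \<open>1\<close>.
\<close>

definition half_disc :: "complex set" where "half_disc = {z. Re z > 0 \<and> norm z < 1}"

lemma open_half_disc: "open half_disc"
  unfolding half_disc_def by (intro open_Collect_conj open_Collect_less continuous_intros)

lemma half_disc_cball:
  assumes "0 < u" "u < 1" "0 < r" "r < u" "r < 1 - u"
  shows "cball (of_real u) r \<subseteq> half_disc"
proof
  fix z assume "z \<in> cball (complex_of_real u) r"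
  then have z: "norm (of_real u - z) \<le> r" by (simp add: dist_norm)
  have "u - Re z \<le> r" using complex_Re_le_cmod[of "of_real u - z"] z by simp
  moreover have "norm z \<le> norm (complex_of_real u) + norm (of_real u - z)"
    by (metis norm_triangle_sub norm_minus_commute)
  ultimately show "z \<in> half_disc" using assms z by (simp add: half_disc_def)
qed

lemma half_disc_one_minus:
  assumes "z \<in> half_disc" "a > 0"
  shows "Re (1 - z) > 0" "Re (1 - z powr of_real a) > 0"
proof -
  have z: "norm z < 1" using assms by (simp add: half_disc_def)
  then show "Re (1 - z) > 0" using complex_Re_le_cmod[of z] by simp
  have "norm (z powr of_real a) = norm z powr a" by (rule norm_powr_of_real)
  also have "\<dots> < 1" using z assms(2) powr_less_mono2[of a "norm z" 1] by simp
  finally show "Re (1 - z powr of_real a) > 0" using complex_Re_le_cmod[of "z powr of_real a"] by simp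
qed

lemma pos_Re_not_nonpos: "Re z > 0 \<Longrightarrow> z \<notin> \<real>\<^sub>\<le>\<^sub>0"
  by (auto simp: complex_nonpos_Reals_iff)

text \<open>
  Near \<open>1\<close> one has \<open>1 - z^(\<gamma>/2) = (1 - z) Q(z)\<close> with \<open>Q\<close> holomorphic and of positive real part, and
  principal powers multiply there. The coefficients are those of the Taylor expansion of the remaining
  holomorphic factor \<open>z^(-lam/2) Q(z)^\<delta>\<close>.
\<close>

lemma boundary_factorization:
  fixes \<delta> \<gamma> lam :: real and J :: nat
  assumes "\<delta> > 0" "\<gamma> > 0"
  obtains c r B where "0 < r" "r < 1" "B \<ge> 0"
    "\<And>z. z \<in> half_disc \<Longrightarrow> dist 1 z < r \<Longrightarrow>
       norm (z powr of_real (- lam / 2) * (1 - z powr of_real (\<gamma> / 2)) powr of_real \<delta>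
          - (\<Sum>j<J. c j * (1 - z) powr of_real (\<delta> + real j))) \<le> B * norm (1 - z) powr (\<delta> + real J)"
proof -
  define g where "g = (\<lambda>z::complex. z powr of_real (\<gamma> / 2))"
  have pos: "Re z > 0" if "z \<in> ball 1 1" for z :: complex
  proof -
    have "1 - Re z \<le> norm (1 - z)" using complex_Re_le_cmod[of "1 - z"] by simp
    then show ?thesis using that by (simp add: dist_norm)
  qed
  have g: "g holomorphic_on ball 1 1"
    unfolding g_def by (intro holomorphic_intros) (use pos pos_Re_not_nonpos in blast)
  define Q where "Q = (\<lambda>z. if z = 1 then deriv g 1 else (g z - g 1) / (z - 1))"
  have Q: "Q holomorphic_on ball 1 1" unfolding Q_def by (rule pole_lemma[OF g]) simp
  have "(g has_field_derivative of_real (\<gamma> / 2)) (at 1)"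
    unfolding g_def by (auto intro!: derivative_eq_intros)
  then have Q1: "Q 1 = of_real (\<gamma> / 2)" by (simp add: Q_def DERIV_imp_deriv)
  have "isCont Q 1" using holomorphic_on_imp_continuous_on[OF Q] by (simp add: continuous_on_eq_continuous_at)
  then have "isCont (\<lambda>z. Re (Q z)) 1" by (rule continuous_Re)
  moreover have "Re (Q 1) > 0" unfolding Q1 using assms by simp
  ultimately have "\<forall>\<^sub>F z in nhds 1. Re (Q z) > 0"
    using isCont_def tendsto_nhds_iff order_tendstoD(1) by metis
  then obtain r where r: "r > 0" "\<And>z. dist z 1 < r \<Longrightarrow> Re (Q z) > 0"
    unfolding eventually_nhds_metric by blast
  define r1 where "r1 = min r (1/2)"
  have r1: "r1 > 0" "r1 \<le> 1/2" "\<And>z. z \<in> ball 1 r1 \<Longrightarrow> Re (Q z) > 0"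
    using r by (auto simp: r1_def dist_commute)
  define G where "G = (\<lambda>z. z powr of_real (- lam / 2) * Q z powr of_real \<delta>)"
  have sub: "ball 1 r1 \<subseteq> ball (1::complex) 1" using r1 by (intro subset_ball) auto
  have "G holomorphic_on ball 1 r1"
    unfolding G_def
  proof (intro holomorphic_intros)
    show "Q holomorphic_on ball 1 r1" using Q sub by (rule holomorphic_on_subset)
    show "z \<notin> \<real>\<^sub>\<le>\<^sub>0" if "z \<in> ball 1 r1" for z :: complex using that sub pos pos_Re_not_nonpos by blast
    show "Q z \<notin> \<real>\<^sub>\<le>\<^sub>0" if "z \<in> ball 1 r1" for z :: complex using that r1(3) pos_Re_not_nonpos by blast
  qed
  from holomorphic_Taylor_factor[OF this r1(1), of J] obtain c h where
    h: "h holomorphic_on ball 1 r1" "\<And>z. z \<in> ball 1 r1 \<Longrightarrow> G z = (\<Sum>j<J. c j * (1 - z) ^ j) + (1 - z) ^ J * h z" by blast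
  have "continuous_on (cball 1 (r1 / 2)) h"
    using h(1) r1(1) by (intro holomorphic_on_imp_continuous_on holomorphic_on_subset[OF h(1)]) auto
  then have "bounded (h ` cball 1 (r1 / 2))" by (intro compact_imp_bounded compact_continuous_image) auto
  then obtain B where "\<forall>y\<in>h ` cball 1 (r1 / 2). norm y \<le> B" unfolding bounded_iff by blast
  then have B: "norm (h z) \<le> B" if "z \<in> cball 1 (r1 / 2)" for z using that by blast
  have B0: "B \<ge> 0" using order_trans[OF norm_ge_zero B[of 1]] r1(1) by simp
  show ?thesis
  proof (rule that[of "r1 / 2" B c])
    fix z :: complex assume z: "z \<in> half_disc" "dist 1 z < r1 / 2"
    then have zb: "z \<in> ball 1 r1" "z \<in> cball 1 (r1 / 2)" using r1(1) by auto
    have z1: "z \<noteq> 1" using z by (auto simp: half_disc_def)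
    have "g 1 = 1" by (simp add: g_def)
    then have "1 - g z = (1 - z) * Q z" using z1 by (simp add: Q_def field_simps)
    then have eq: "(1 - g z) powr of_real \<delta> = (1 - z) powr of_real \<delta> * Q z powr of_real \<delta>"
      using powr_mult_right_half_plane[OF half_disc_one_minus(1)[OF z(1), of 1] r1(3)[OF zb(1)]] by simp
    have pw: "(1 - z) powr of_real (\<delta> + real j) = (1 - z) powr of_real \<delta> * (1 - z) ^ j" for j
      using z1 by (simp add: powr_add powr_nat')
    have "z powr of_real (- lam / 2) * (1 - g z) powr of_real \<delta> - (\<Sum>j<J. c j * (1 - z) powr of_real (\<delta> + real j))
      = (1 - z) powr of_real \<delta> * (G z - (\<Sum>j<J. c j * (1 - z) ^ j))"
      unfolding eq pw G_def by (simp add: algebra_simps sum_distrib_left)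
    also have "\<dots> = (1 - z) powr of_real \<delta> * (1 - z) ^ J * h z" unfolding h(2)[OF zb(1)] by simp
    also have "\<dots> = (1 - z) powr of_real (\<delta> + real J) * h z" unfolding pw ..
    finally have "norm (z powr of_real (- lam / 2) * (1 - g z) powr of_real \<delta> - (\<Sum>j<J. c j * (1 - z) powr of_real (\<delta> + real j)))
      = norm (1 - z) powr (\<delta> + real J) * norm (h z)" by (simp only: norm_mult norm_powr_of_real)
    also have "\<dots> \<le> B * norm (1 - z) powr (\<delta> + real J)"
      using B[OF zb(2)] by (simp add: mult.commute mult_right_mono)
    finally show "norm (z powr of_real (- lam / 2) * (1 - z powr of_real (\<gamma> / 2)) powr of_real \<delta>
          - (\<Sum>j<J. c j * (1 - z) powr of_real (\<delta> + real j))) \<le> B * norm (1 - z) powr (\<delta> + real J)"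
      unfolding g_def .
  qed (use r1 B0 in auto)
qed

text \<open>
  Near the origin \<open>(1 - w)^\<delta> - 1 = O(w)\<close> with \<open>w = z^(\<gamma>/2)\<close>, and \<open>lam \<le> \<gamma>\<close> lets this absorb the
  factor \<open>z^(-lam/2)\<close>.
\<close>

lemma origin_bound:
  fixes \<delta> \<gamma> lam :: real
  assumes "\<gamma> > 0" "lam \<le> \<gamma>"
  obtains C where "C \<ge> 0" "\<And>z. z \<in> half_disc \<Longrightarrow> norm z \<le> 1/2 \<Longrightarrow>
    norm (z powr of_real (- lam / 2) * (1 - z powr of_real (\<gamma> / 2)) powr of_real \<delta> - z powr of_real (- lam / 2)) \<le> C"
proof -
  define q :: real where "q = (1/2) powr (\<gamma> / 2)"
  have q: "0 < q" "q < 1" using assms powr_less_mono2[of "\<gamma> / 2" "1/2" 1] by (auto simp: q_def)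
  obtain C where C: "C \<ge> 0" "\<And>w::complex. norm w \<le> q \<Longrightarrow> norm ((1 - w) powr of_real \<delta> - 1) \<le> C * norm w"
    using one_minus_powr_bound[OF q, of \<delta>] by blast
  show ?thesis
  proof (rule that[OF C(1)])
    fix z assume z: "z \<in> half_disc" "norm z \<le> 1/2"
    have z0: "norm z > 0" using z by (auto simp: half_disc_def)
    have "norm (z powr of_real (\<gamma> / 2)) \<le> q" unfolding norm_powr_of_real q_def
      using z assms by (intro powr_mono2) auto
    from C(2)[OF this] have le: "norm ((1 - z powr of_real (\<gamma> / 2)) powr of_real \<delta> - 1) \<le> C * norm z powr (\<gamma> / 2)"
      by (simp only: norm_powr_of_real)
    have "norm (z powr of_real (- lam / 2) * (1 - z powr of_real (\<gamma> / 2)) powr of_real \<delta> - z powr of_real (- lam / 2))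
      = norm (z powr of_real (- lam / 2) * ((1 - z powr of_real (\<gamma> / 2)) powr of_real \<delta> - 1))"
      by (simp add: algebra_simps)
    also have "\<dots> \<le> norm z powr (- lam / 2) * (C * norm z powr (\<gamma> / 2))"
      unfolding norm_mult norm_powr_of_real by (intro mult_left_mono le) auto
    also have "\<dots> = C * norm z powr ((\<gamma> - lam) / 2)"
      using z0 by (simp add: powr_add[symmetric] field_simps)
    also have "norm z powr ((\<gamma> - lam) / 2) \<le> 1" using z assms by (intro powr_le1) auto
    finally show "norm (z powr of_real (- lam / 2) * (1 - z powr of_real (\<gamma> / 2)) powr of_real \<delta> - z powr of_real (- lam / 2)) \<le> C"
      using C(1) by (simp add: mult_left_mono)
  qed
qed

text \<open>
  Let \<open>E\<close> be the symbol without its term \<open>- s^(-lam/2)\<close>, after subtracting its singular expansion at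
  the unit sphere, and \<open>p(s) = s^(-lam/2)\<close>. On \<open>(0, 1)\<close> the function \<open>E\<close> vanishes to the order \<open>\<delta> + J\<close>
  at \<open>1\<close>, and \<open>p\<close> together with its derivatives decays at infinity, so \<open>Taylor_from_boundary\<close> represents
  both by their \<open>J\<close>-th derivatives and \<open>\<Phi>\<close> is a multiple of the difference. The growth of \<open>\<Phi>\<close> is
  read off from Cauchy's inequality. At the origin only the difference \<open>E - p\<close> is bounded, which is
  why the two representations are combined into a single density.
\<close>

theorem symbol_subordination:
  fixes \<delta> \<gamma> lam :: real and J :: nat
  assumes \<delta>: "\<delta> > 0" and \<gamma>: "\<gamma> > 0" and lam: "0 < lam" "lam \<le> \<gamma>" and J: "J > 0"
  obtains c :: "nat \<Rightarrow> complex" and \<Phi> :: "real \<Rightarrow> complex" and C :: real where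
    "\<Phi> \<in> borel_measurable borel" "C \<ge> 0"
    "\<And>u. 0 < u \<Longrightarrow> u < 1 \<Longrightarrow> norm (\<Phi> u) \<le> C * u powr (- real J)"
    "\<And>u. 1 \<le> u \<Longrightarrow> norm (\<Phi> u) \<le> C * u powr (- lam / 2 - real J)"
    "\<And>s. s > 0 \<Longrightarrow> of_real (s powr (- lam / 2) * ((max 0 (1 - s powr (\<gamma> / 2))) powr \<delta> - 1))
       = (\<Sum>j<J. c j * of_real ((max 0 (1 - s)) powr (\<delta> + real j)))
         + (LINT u:{s<..}|lborel. (u - s) ^ (J - 1) *\<^sub>R \<Phi> u)"
proof -
  define H :: "complex set" where "H = {z. Re z > 0}"
  have H: "open H" unfolding H_def by (intro open_Collect_less continuous_intros)
  define p where "p = (\<lambda>z::complex. z powr of_real (- lam / 2))"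
  obtain c r B where r: "0 < r" "r < 1" "B \<ge> 0"
    "\<And>z. z \<in> half_disc \<Longrightarrow> dist 1 z < r \<Longrightarrow>
       norm (z powr of_real (- lam / 2) * (1 - z powr of_real (\<gamma> / 2)) powr of_real \<delta>
          - (\<Sum>j<J. c j * (1 - z) powr of_real (\<delta> + real j))) \<le> B * norm (1 - z) powr (\<delta> + real J)"
    by (rule boundary_factorization[OF \<delta> \<gamma>, of lam J]) (rule that)
  obtain C0 where C0: "C0 \<ge> 0" "\<And>z. z \<in> half_disc \<Longrightarrow> norm z \<le> 1/2 \<Longrightarrow>
    norm (z powr of_real (- lam / 2) * (1 - z powr of_real (\<gamma> / 2)) powr of_real \<delta> - z powr of_real (- lam / 2)) \<le> C0"
    by (rule origin_bound[OF \<gamma> lam(2), of \<delta>]) (rule that)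
  define E where "E = (\<lambda>z. z powr of_real (- lam / 2) * (1 - z powr of_real (\<gamma> / 2)) powr of_real \<delta>
          - (\<Sum>j<J. c j * (1 - z) powr of_real (\<delta> + real j)))"
  have hd_pos: "z \<notin> \<real>\<^sub>\<le>\<^sub>0" "1 - z \<notin> \<real>\<^sub>\<le>\<^sub>0" "1 - z powr of_real (\<gamma> / 2) \<notin> \<real>\<^sub>\<le>\<^sub>0" if "z \<in> half_disc" for z
    using half_disc_one_minus[OF that, of "\<gamma> / 2"] that \<gamma> pos_Re_not_nonpos by (auto simp: half_disc_def)
  have p_hol: "p holomorphic_on H"
    unfolding p_def by (intro holomorphic_intros) (use pos_Re_not_nonpos in \<open>auto simp: H_def\<close>)
  have E_hol: "E holomorphic_on half_disc"
    unfolding E_def by (intro holomorphic_intros hd_pos)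
  have sub: "half_disc \<subseteq> H" by (auto simp: half_disc_def H_def)
  define P where "P = (\<lambda>i u. (deriv ^^ i) p (complex_of_real u))"
  define EE where "EE = (\<lambda>i u. (deriv ^^ i) E (complex_of_real u))"
  have P_der: "(P i has_vector_derivative P (Suc i) u) (at u)" if "u > 0" for i u
    unfolding P_def by (rule higher_deriv_real_line[OF p_hol H]) (use that in \<open>simp add: H_def\<close>)
  have EE_der: "(EE i has_vector_derivative EE (Suc i) u) (at u)" if "0 < u" "u < 1" for i u
    unfolding EE_def by (rule higher_deriv_real_line[OF E_hol open_half_disc]) (use that in \<open>simp add: half_disc_def\<close>)
  have P_cont: "continuous_on {0<..} (P i)" for i
    using P_der by (meson continuous_at_imp_continuous_on greaterThan_iff has_vector_derivative_continuous)
  have EE_cont: "continuous_on {0<..<1} (EE i)" for i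
    using EE_der by (meson continuous_at_imp_continuous_on greaterThanLessThan_iff has_vector_derivative_continuous)

  \<comment> \<open>Cauchy's inequality on the disc of radius \<open>u / 2\<close>, where \<open>|z| \<ge> u / 2\<close>.\<close>
  define Cp where "Cp = (\<lambda>i. fact i * (1/2) powr (- lam / 2) * 2 ^ i)"
  have P_bound: "norm (P i u) \<le> Cp i * u powr (- lam / 2 - real i)" if u: "u > 0" for i u
  proof -
    have "norm ((deriv ^^ i) p (of_real u)) \<le> fact i * ((u / 2) powr (- lam / 2)) / (u / 2) ^ i"
    proof (rule higher_deriv_ball_bound[OF p_hol H])
      have *: "Re z \<ge> u / 2" if "z \<in> cball (complex_of_real u) (u / 2)" for z
        using that complex_Re_le_cmod[of "of_real u - z"] by (simp add: dist_norm)
      then show "cball (complex_of_real u) (u / 2) \<subseteq> H" using u by (force simp: H_def)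
      show "norm (p z) \<le> (u / 2) powr (- lam / 2)" if "z \<in> cball (complex_of_real u) (u / 2)" for z
        unfolding p_def norm_powr_of_real using *[OF that] complex_Re_le_cmod[of z] u lam
        by (intro powr_mono2') auto
    qed (use u in simp)
    also have "\<dots> = Cp i * u powr (- lam / 2 - real i)"
      using u unfolding Cp_def powr_diff powr_realpow[OF u]
      by (simp add: powr_mult[symmetric] power_divide field_simps)
    finally show ?thesis unfolding P_def .
  qed
  have Cp: "Cp i \<ge> 0" for i by (simp add: Cp_def)
  \<comment> \<open>Cauchy's inequality on the disc of radius \<open>(1 - u) / 2\<close>, where \<open>|1 - z| \<le> 3/2 (1 - u) < r\<close>.\<close>
  define Ce where "Ce = (\<lambda>i. fact i * B * (3/2) powr (\<delta> + real J) * 2 ^ i)"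
  have Ce: "Ce i \<ge> 0" for i using r by (simp add: Ce_def)
  have E_bound: "norm (EE i u) \<le> Ce i * (1 - u) powr (\<delta> + real J - real i)" if u: "1 - r / 2 \<le> u" "u < 1" for i u
  proof -
    have "norm ((deriv ^^ i) E (of_real u)) \<le> fact i * (B * (3/2 * (1 - u)) powr (\<delta> + real J)) / ((1 - u) / 2) ^ i"
    proof (rule higher_deriv_ball_bound[OF E_hol open_half_disc])
      show sb: "cball (complex_of_real u) ((1 - u) / 2) \<subseteq> half_disc"
        using u r by (intro half_disc_cball) auto
      fix z assume z: "z \<in> cball (complex_of_real u) ((1 - u) / 2)"
      have "norm (1 - z) \<le> norm (1 - complex_of_real u) + norm (of_real u - z)"
        using norm_triangle_ineq[of "1 - complex_of_real u" "of_real u - z"] by simp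
      also have "norm (1 - complex_of_real u) = 1 - u" using u by (metis abs_of_pos diff_gt_0_iff_gt norm_of_real of_real_1 of_real_diff)
      finally have n: "norm (1 - z) \<le> 3/2 * (1 - u)" using z by (simp add: dist_norm)
      also have "\<dots> < r" using u r by simp
      finally have "dist 1 z < r" by (simp add: dist_norm)
      with r(4) z sb have "norm (E z) \<le> B * norm (1 - z) powr (\<delta> + real J)" unfolding E_def by blast
      also have "\<dots> \<le> B * (3/2 * (1 - u)) powr (\<delta> + real J)"
        using n r \<delta> by (intro mult_left_mono powr_mono2) auto
      finally show "norm (E z) \<le> B * (3/2 * (1 - u)) powr (\<delta> + real J)" .
    qed (use u in simp)
    also have "\<dots> = Ce i * (1 - u) powr (\<delta> + real J - real i)"
    proof -
      have u1: "1 - u > 0" using u by simp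
      have "(1 - u) powr (\<delta> + real J - real i) = (1 - u) powr (\<delta> + real J) / (1 - u) ^ i"
        by (simp only: powr_diff powr_realpow[OF u1])
      moreover have "(3/2 * (1 - u)) powr (\<delta> + real J) = (3/2) powr (\<delta> + real J) * (1 - u) powr (\<delta> + real J)"
        using u1 by (simp only: powr_mult)
      ultimately show ?thesis unfolding Ce_def by (simp add: power_divide)
    qed
    finally show ?thesis unfolding EE_def .
  qed

  \<comment> \<open>Three ranges: near the origin Cauchy's inequality for the bounded function \<open>E - p\<close>, near \<open>1\<close> the two
    separate bounds, and in between compactness.\<close>
  obtain C1 where C1: "C1 \<ge> 0" "\<And>u. 0 < u \<Longrightarrow> u < 1 \<Longrightarrow> norm (EE J u - P J u) \<le> C1 * u powr (- real J)"
  proof -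
    define M0 where "M0 = C0 + (\<Sum>j<J. norm (c j) * 2 powr (\<delta> + real j))"
    have M0: "M0 \<ge> 0" unfolding M0_def using C0 by (intro add_nonneg_nonneg sum_nonneg) auto
    have small: "norm (EE J u - P J u) \<le> fact J * M0 * 2 ^ J * u powr (- real J)" if u: "0 < u" "u < 1/3" for u
    proof -
      have uh: "complex_of_real u \<in> half_disc" using u by (simp add: half_disc_def)
      have hol: "(\<lambda>z. E z - p z) holomorphic_on half_disc"
        by (intro holomorphic_intros E_hol holomorphic_on_subset[OF p_hol sub])
      have "EE J u - P J u = (deriv ^^ J) (\<lambda>z. E z - p z) (of_real u)"
        unfolding EE_def P_def
        by (rule higher_deriv_diff[OF E_hol holomorphic_on_subset[OF p_hol sub] open_half_disc uh, symmetric])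
      also have "norm \<dots> \<le> fact J * M0 / (u / 2) ^ J"
      proof (rule higher_deriv_ball_bound[OF hol open_half_disc])
        show sb: "cball (complex_of_real u) (u / 2) \<subseteq> half_disc" using u by (intro half_disc_cball) auto
        fix z assume z: "z \<in> cball (complex_of_real u) (u / 2)"
        then have zh: "z \<in> half_disc" using sb by blast
        have "norm z \<le> norm (complex_of_real u) + norm (of_real u - z)"
          by (metis norm_triangle_sub norm_minus_commute)
        then have n: "norm z \<le> 1/2" using z u by (simp add: dist_norm)
        have "norm (E z - p z) \<le> norm (z powr of_real (- lam / 2) * (1 - z powr of_real (\<gamma> / 2)) powr of_real \<delta> - z powr of_real (- lam / 2))
             + norm (\<Sum>j<J. c j * (1 - z) powr of_real (\<delta> + real j))"
          unfolding E_def p_def by (rule order_trans[OF _ norm_triangle_ineq4]) (simp add: algebra_simps)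
        also have "\<dots> \<le> C0 + (\<Sum>j<J. norm (c j) * 2 powr (\<delta> + real j))"
        proof (intro add_mono C0(2)[OF zh n] sum_norm_le)
          fix j
          have "norm (1 - z) \<le> 1 + norm z" by (metis norm_one norm_triangle_ineq4)
          then have "norm (1 - z) \<le> 2" using n by simp
          then show "norm (c j * (1 - z) powr of_real (\<delta> + real j)) \<le> norm (c j) * 2 powr (\<delta> + real j)"
            unfolding norm_mult norm_powr_of_real using \<delta> by (intro mult_left_mono powr_mono2) auto
        qed
        finally show "norm (E z - p z) \<le> M0" unfolding M0_def .
      qed (use u in simp)
      also have "\<dots> = fact J * M0 * 2 ^ J * u powr (- real J)"
        using u by (simp add: powr_minus powr_realpow power_divide field_simps)
      finally show ?thesis .
    qed
    \<comment> \<open>The disc of radius \<open>u / 2\<close> stays in \<open>|z| \<le> 1/2\<close> only for \<open>u \<le> 1/3\<close>.\<close>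
    have "continuous_on {1/3..1 - r / 2} (\<lambda>u. EE J u - P J u)"
      using r by (intro continuous_intros continuous_on_subset[OF EE_cont] continuous_on_subset[OF P_cont]) auto
    then have "bounded ((\<lambda>u. EE J u - P J u) ` {1/3..1 - r / 2})"
      by (intro compact_imp_bounded compact_continuous_image) auto
    then obtain M1 where "\<forall>y\<in>(\<lambda>u. EE J u - P J u) ` {1/3..1 - r / 2}. norm y \<le> M1" unfolding bounded_iff by blast
    then have M1: "norm (EE J u - P J u) \<le> M1" if "u \<in> {1/3..1 - r / 2}" for u using that by blast
    define M2 where "M2 = Ce J + Cp J * (1/3) powr (- lam / 2 - real J)"
    have near: "norm (EE J u - P J u) \<le> M2" if u: "1 - r / 2 < u" "u < 1" for u
    proof -
      have "norm (EE J u) \<le> Ce J * (1 - u) powr (\<delta> + real J - real J)" using E_bound[of u J] u by simp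
      also have "\<dots> \<le> Ce J * 1" using u r \<delta> Ce by (intro mult_left_mono powr_le1) auto
      finally have 1: "norm (EE J u) \<le> Ce J" by simp
      have "norm (P J u) \<le> Cp J * u powr (- lam / 2 - real J)" using P_bound[of u J] u r by simp
      also have "\<dots> \<le> Cp J * (1/3) powr (- lam / 2 - real J)"
        using u r lam Cp by (intro mult_left_mono powr_mono2') auto
      finally have 2: "norm (P J u) \<le> Cp J * (1/3) powr (- lam / 2 - real J)" .
      show ?thesis unfolding M2_def by (rule order_trans[OF norm_triangle_ineq4 add_mono[OF 1 2]])
    qed
    have M2: "M2 \<ge> 0" unfolding M2_def using Ce Cp by (intro add_nonneg_nonneg mult_nonneg_nonneg) auto
    define C1 where "C1 = fact J * M0 * 2 ^ J + \<bar>M1\<bar> + M2"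
    have C1: "fact J * M0 * 2 ^ J \<le> C1" "M1 \<le> C1" "M2 \<le> C1" "0 \<le> C1"
    proof -
      have "0 \<le> fact J * M0 * 2 ^ J" using M0 by simp
      then show "fact J * M0 * 2 ^ J \<le> C1" "M1 \<le> C1" "M2 \<le> C1" "0 \<le> C1"
        unfolding C1_def using M2 by linarith+
    qed
    show ?thesis
    proof (rule that[OF C1(4)])
      fix u :: real assume u: "0 < u" "u < 1"
      have ge1: "1 \<le> u powr (- real J)" using u by (simp add: powr_minus powr_realpow one_le_inverse_iff power_le_one)
      consider "u < 1/3" | "1/3 \<le> u" "u \<le> 1 - r / 2" | "1 - r / 2 < u" by linarith
      then show "norm (EE J u - P J u) \<le> C1 * u powr (- real J)"
      proof cases
        case 1
        show ?thesis by (rule order_trans[OF small[OF u(1) 1] mult_right_mono[OF C1(1)]]) simp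
      next
        case 2
        then have "norm (EE J u - P J u) \<le> C1 * 1" using M1[of u] C1(2) by simp
        also have "\<dots> \<le> C1 * u powr (- real J)" by (rule mult_left_mono[OF ge1 C1(4)])
        finally show ?thesis .
      next
        case 3
        then have "norm (EE J u - P J u) \<le> C1 * 1" using near[of u] u C1(3) by simp
        also have "\<dots> \<le> C1 * u powr (- real J)" by (rule mult_left_mono[OF ge1 C1(4)])
        finally show ?thesis .
      qed
    qed
  qed

  \<comment> \<open>The constant of Taylor's formula. For \<open>u \<ge> 1\<close> only \<open>p\<close> contributes to the density, because the
    multiplier vanishes outside the unit ball.\<close>
  define K :: real where "K = (-1) ^ J / fact (J - 1)"
  have absK: "\<bar>K\<bar> \<le> 1" unfolding K_def by (simp add: abs_mult power_abs divide_le_eq_1 fact_ge_1)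
  define \<Phi> where "\<Phi> = (\<lambda>u. K *\<^sub>R (indicator {0<..<1} u *\<^sub>R EE J u - indicator {0<..} u *\<^sub>R P J u))"

  have P_int: "set_integrable lborel {s<..} (\<lambda>u. (u - s) ^ (J - 1) *\<^sub>R P J u)" if s: "s > 0" for s
  proof -
    have "set_integrable lborel {s<..} (\<lambda>u. Cp J * u powr (- lam / 2 - 1))"
    proof (rule set_integrable_mult_right, rule set_integrable_subset)
      show "set_integrable lborel {s..} (\<lambda>u. u powr (- lam / 2 - 1))"
        by (rule set_integrable_powr_inf) (use lam s in auto)
    qed auto
    then show ?thesis
    proof (rule set_integrable_bound)
      have "continuous_on {s<..} (\<lambda>u. (u - s) ^ (J - 1) *\<^sub>R P J u)"
        using s by (intro continuous_intros continuous_on_subset[OF P_cont]) auto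
      then have "(\<lambda>u. indicator {s<..} u *\<^sub>R ((u - s) ^ (J - 1) *\<^sub>R P J u)) \<in> borel_measurable borel"
        by (rule borel_measurable_continuous_on_indicator[rotated]) simp
      then show "set_borel_measurable lborel {s<..} (\<lambda>u. (u - s) ^ (J - 1) *\<^sub>R P J u)"
        unfolding set_borel_measurable_def by (simp only: measurable_lborel2)
      show "AE u in lborel. u \<in> {s<..} \<longrightarrow> norm ((u - s) ^ (J - 1) *\<^sub>R P J u) \<le> norm (Cp J * u powr (- lam / 2 - 1))"
      proof (intro AE_I2 impI)
        fix u assume u: "u \<in> {s<..}"
        then have u0: "u > 0" using s by simp
        have "norm ((u - s) ^ (J - 1) *\<^sub>R P J u) \<le> u ^ (J - 1) * (Cp J * u powr (- lam / 2 - real J))"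
          using u s P_bound[OF u0, of J] by (auto intro!: mult_mono power_mono simp: norm_power)
        also have "\<dots> = Cp J * (u powr real (J - 1) * u powr (- lam / 2 - real J))"
          using u0 by (simp add: powr_realpow)
        also have "u powr real (J - 1) * u powr (- lam / 2 - real J) = u powr (- lam / 2 - 1)"
        proof -
          have "real (J - 1) + (- lam / 2 - real J) = - lam / 2 - 1" using J by (simp add: of_nat_diff)
          then show ?thesis by (simp only: powr_add[symmetric])
        qed
        finally show "norm ((u - s) ^ (J - 1) *\<^sub>R P J u) \<le> norm (Cp J * u powr (- lam / 2 - 1))"
          using Cp[of J] by simp
      qed
    qed
  qed

  have P_rep: "P 0 s = K *\<^sub>R (LINT u:{s<..}|lborel. (u - s) ^ (J - 1) *\<^sub>R P J u)" if s: "s > 0" for s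
    unfolding K_def
  proof (rule Taylor_from_boundary[where T = "\<lambda>k. s + 1 + real k", OF J])
    show "\<forall>\<^sub>F k in sequentially. u \<le> s + 1 + real k" if "u \<in> {s<..}" for u
      by real_asymp
    fix i assume i: "i < J"
    show "(\<lambda>k. (s + 1 + real k - s) ^ i *\<^sub>R P i (s + 1 + real k)) \<longlonglongrightarrow> 0"
    proof (rule Lim_null_comparison)
      show "(\<lambda>k. Cp i * (s + 1 + real k) powr (- lam / 2)) \<longlonglongrightarrow> 0"
        using lam by real_asymp
      show "\<forall>\<^sub>F k in sequentially. norm ((s + 1 + real k - s) ^ i *\<^sub>R P i (s + 1 + real k)) \<le> Cp i * (s + 1 + real k) powr (- lam / 2)"
      proof (intro always_eventually allI)
        fix k
        define t where "t = s + 1 + real k"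
        have t: "t > 0" "s < t" using s by (simp_all add: t_def)
        have "norm ((t - s) ^ i *\<^sub>R P i t) \<le> t ^ i * (Cp i * t powr (- lam / 2 - real i))"
          using t s P_bound[OF t(1), of i] by (auto intro!: mult_mono power_mono simp: norm_power)
        also have "\<dots> = Cp i * t powr (- lam / 2)" using t by (simp add: powr_diff powr_realpow)
        finally show "norm ((s + 1 + real k - s) ^ i *\<^sub>R P i (s + 1 + real k)) \<le> Cp i * (s + 1 + real k) powr (- lam / 2)"
          unfolding t_def .
      qed
    qed
  qed (use s P_der P_int in auto)

  have E_int: "set_integrable lborel {s<..<1} (\<lambda>u. (u - s) ^ (J - 1) *\<^sub>R EE J u)" if s: "0 < s" "s < 1" for s
  proof -
    define M where "M = C1 * s powr (- real J) + Cp J * s powr (- lam / 2 - real J)"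
    have "set_integrable lborel {s<..<1} (\<lambda>u. M)"
      unfolding set_integrable_def using s by (intro integrable_scaleR_left integrable_real_indicator) auto
    then show ?thesis
    proof (rule set_integrable_bound)
      have "continuous_on {s<..<1} (\<lambda>u. (u - s) ^ (J - 1) *\<^sub>R EE J u)"
        using s by (intro continuous_intros continuous_on_subset[OF EE_cont]) auto
      then have "(\<lambda>u. indicator {s<..<1} u *\<^sub>R ((u - s) ^ (J - 1) *\<^sub>R EE J u)) \<in> borel_measurable borel"
        by (rule borel_measurable_continuous_on_indicator[rotated]) simp
      then show "set_borel_measurable lborel {s<..<1} (\<lambda>u. (u - s) ^ (J - 1) *\<^sub>R EE J u)"
        unfolding set_borel_measurable_def by (simp only: measurable_lborel2)
      show "AE u in lborel. u \<in> {s<..<1} \<longrightarrow> norm ((u - s) ^ (J - 1) *\<^sub>R EE J u) \<le> norm M"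
      proof (intro AE_I2 impI)
        fix u assume u: "u \<in> {s<..<1}"
        then have u0: "u > 0" "u < 1" using s by simp_all
        have "norm (EE J u) \<le> norm (EE J u - P J u) + norm (P J u)" by (metis norm_triangle_sub add.commute)
        also have "\<dots> \<le> C1 * u powr (- real J) + Cp J * u powr (- lam / 2 - real J)"
          by (intro add_mono C1(2) P_bound u0)
        also have "\<dots> \<le> M" unfolding M_def using u s lam C1(1) Cp by (intro add_mono mult_left_mono powr_mono2') auto
        finally have "norm (EE J u) \<le> M" .
        moreover have "\<bar>(u - s) ^ (J - 1)\<bar> \<le> 1" using u s by (simp add: power_abs power_le_one)
        ultimately have "\<bar>(u - s) ^ (J - 1)\<bar> * norm (EE J u) \<le> 1 * M" by (intro mult_mono) auto
        then show "norm ((u - s) ^ (J - 1) *\<^sub>R EE J u) \<le> norm M" by simp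
      qed
    qed
  qed

  have E_rep: "EE 0 s = K *\<^sub>R (LINT u:{s<..<1}|lborel. (u - s) ^ (J - 1) *\<^sub>R EE J u)" if s: "0 < s" "s < 1" for s
    unfolding K_def
  proof (rule Taylor_from_boundary[where T = "\<lambda>k. 1 - (1 - s) / (real k + 2)", OF J])
    have T: "1 - (1 - s) / (real k + 2) \<in> {s<..<1}" for k
    proof -
      have "(1 - s) / (real k + 2) < (1 - s) / 1" using s by (intro divide_strict_left_mono) auto
      then show ?thesis using s by auto
    qed
    then show "1 - (1 - s) / (real k + 2) \<in> {s<..<1}" for k .
    have lim: "(\<lambda>k. 1 - (1 - s) / (real k + 2)) \<longlonglongrightarrow> 1" by real_asymp
    show "\<forall>\<^sub>F k in sequentially. u \<le> 1 - (1 - s) / (real k + 2)" if "u \<in> {s<..<1}" for u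
      using order_tendstoD(1)[OF lim, of u] that by (auto elim: eventually_mono)
    fix i assume i: "i < J"
    show "(\<lambda>k. (1 - (1 - s) / (real k + 2) - s) ^ i *\<^sub>R EE i (1 - (1 - s) / (real k + 2))) \<longlonglongrightarrow> 0"
    proof (rule Lim_null_comparison)
      have e: "\<delta> + real J - real i > 0" using i \<delta> by simp
      have "(\<lambda>k. (1 - s) / (real k + 2)) \<longlonglongrightarrow> 0" by real_asymp
      then have "(\<lambda>k. ((1 - s) / (real k + 2)) powr (\<delta> + real J - real i)) \<longlonglongrightarrow> 0"
        using tendsto_powr'[of "\<lambda>k. (1 - s) / (real k + 2)" 0 sequentially "\<lambda>_. \<delta> + real J - real i" "\<delta> + real J - real i"] e s
        by simp
      then show "(\<lambda>k. Ce i * ((1 - s) / (real k + 2)) powr (\<delta> + real J - real i)) \<longlonglongrightarrow> 0"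
        by (rule tendsto_mult_right_zero)
      have "1 - r / 2 < 1" using r by simp
      from order_tendstoD(1)[OF lim this]
      show "\<forall>\<^sub>F k in sequentially. norm ((1 - (1 - s) / (real k + 2) - s) ^ i *\<^sub>R EE i (1 - (1 - s) / (real k + 2)))
         \<le> Ce i * ((1 - s) / (real k + 2)) powr (\<delta> + real J - real i)"
      proof eventually_elim
        fix k
        define t where "t = 1 - (1 - s) / (real k + 2)"
        assume "1 - r / 2 < 1 - (1 - s) / (real k + 2)"
        then have t: "1 - r / 2 < t" by (simp add: t_def)
        have ts: "s < t" "t < 1" using T[of k] by (auto simp: t_def)
        have "\<bar>(t - s) ^ i\<bar> \<le> 1" using ts s by (simp add: power_abs power_le_one)
        then have "norm ((t - s) ^ i *\<^sub>R EE i t) \<le> 1 * (Ce i * (1 - t) powr (\<delta> + real J - real i))"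
          unfolding norm_scaleR using t ts by (intro mult_mono E_bound) auto
        moreover have "1 - t = (1 - s) / (real k + 2)" by (simp add: t_def)
        ultimately show "norm ((1 - (1 - s) / (real k + 2) - s) ^ i *\<^sub>R EE i (1 - (1 - s) / (real k + 2)))
         \<le> Ce i * ((1 - s) / (real k + 2)) powr (\<delta> + real J - real i)" unfolding t_def by simp
      qed
    qed
  qed (use s EE_der E_int in auto)

  show ?thesis
  proof (rule that[of \<Phi> "C1 + Cp J" c])
    show "\<Phi> \<in> borel_measurable borel"
    proof -
      have [measurable]: "(\<lambda>u. indicator {0<..<1} u *\<^sub>R EE J u) \<in> borel_measurable borel"
        by (rule borel_measurable_continuous_on_indicator[OF _ EE_cont]) auto
      have [measurable]: "(\<lambda>u. indicator {0<..} u *\<^sub>R P J u) \<in> borel_measurable borel"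
        by (rule borel_measurable_continuous_on_indicator[OF _ P_cont]) auto
      show ?thesis unfolding \<Phi>_def by measurable
    qed
    show "C1 + Cp J \<ge> 0" using C1(1) Cp[of J] by simp
    fix u :: real
    have K1: "norm (K *\<^sub>R x) \<le> norm x" for x :: complex using mult_right_mono[OF absK norm_ge_zero[of x]] by simp
    show "norm (\<Phi> u) \<le> (C1 + Cp J) * u powr (- real J)" if "0 < u" "u < 1"
    proof -
      have "norm (\<Phi> u) \<le> norm (EE J u - P J u)" unfolding \<Phi>_def using that by (intro order_trans[OF K1]) simp
      also have "\<dots> \<le> C1 * u powr (- real J)" by (rule C1(2)[OF that])
      also have "\<dots> \<le> (C1 + Cp J) * u powr (- real J)" using Cp[of J] by (intro mult_right_mono) auto
      finally show ?thesis .
    qed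
    show "norm (\<Phi> u) \<le> (C1 + Cp J) * u powr (- lam / 2 - real J)" if "1 \<le> u"
    proof -
      have "norm (\<Phi> u) \<le> norm (P J u)" unfolding \<Phi>_def using that by (intro order_trans[OF K1]) simp
      also have "\<dots> \<le> Cp J * u powr (- lam / 2 - real J)" using that by (intro P_bound) simp
      also have "\<dots> \<le> (C1 + Cp J) * u powr (- lam / 2 - real J)" using C1(1) by (intro mult_right_mono) auto
      finally show ?thesis .
    qed
  next
    fix s :: real assume s: "s > 0"
    let ?gE = "\<lambda>u. (u - s) ^ (J - 1) *\<^sub>R EE J u" and ?gP = "\<lambda>u. (u - s) ^ (J - 1) *\<^sub>R P J u"
    have p0: "P 0 s = of_real (s powr (- lam / 2))" 
      unfolding P_def p_def funpow_0 by (rule powr_of_real) (use s in simp)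
    show "of_real (s powr (- lam / 2) * ((max 0 (1 - s powr (\<gamma> / 2))) powr \<delta> - 1))
       = (\<Sum>j<J. c j * of_real ((max 0 (1 - s)) powr (\<delta> + real j)))
         + (LINT u:{s<..}|lborel. (u - s) ^ (J - 1) *\<^sub>R \<Phi> u)"
    proof (cases "s < 1")
      case True
      have intE: "integrable lborel (\<lambda>u. indicator {s<..<1} u *\<^sub>R ?gE u)" using E_int[OF s True] by (simp only: set_integrable_def)
      have intP: "integrable lborel (\<lambda>u. indicator {s<..} u *\<^sub>R ?gP u)" using P_int[OF s] by (simp only: set_integrable_def)
      have "(LINT u:{s<..}|lborel. (u - s) ^ (J - 1) *\<^sub>R \<Phi> u)
        = (LINT u|lborel. K *\<^sub>R (indicator {s<..<1} u *\<^sub>R ?gE u - indicator {s<..} u *\<^sub>R ?gP u))"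
        unfolding set_lebesgue_integral_def
        by (intro Bochner_Integration.integral_cong) (use s in \<open>auto simp: \<Phi>_def indicator_def algebra_simps\<close>)
      also have "\<dots> = K *\<^sub>R (LINT u:{s<..<1}|lborel. ?gE u) - K *\<^sub>R (LINT u:{s<..}|lborel. ?gP u)"
        unfolding integral_scaleR_right Bochner_Integration.integral_diff[OF intE intP] set_lebesgue_integral_def
        by (rule scaleR_diff_right)
      also have "\<dots> = EE 0 s - P 0 s" unfolding E_rep[OF s True] P_rep[OF s] ..
      finally have I: "(LINT u:{s<..}|lborel. (u - s) ^ (J - 1) *\<^sub>R \<Phi> u) = EE 0 s - P 0 s" .
      have s1: "s powr (\<gamma> / 2) < 1" using s True \<gamma> powr_less_mono2[of "\<gamma> / 2" s 1] by simp
      have a1: "(1 - complex_of_real s powr of_real (\<gamma> / 2)) powr of_real \<delta> = of_real ((1 - s powr (\<gamma> / 2)) powr \<delta>)"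
      proof -
        have "1 - complex_of_real s powr of_real (\<gamma> / 2) = of_real (1 - s powr (\<gamma> / 2))"
          using s by (simp only: powr_of_real less_imp_le of_real_diff of_real_1)
        then show ?thesis using s1 by (simp only: powr_of_real diff_ge_0_iff_ge less_imp_le)
      qed
      have a2: "(1 - complex_of_real s) powr of_real (\<delta> + real j) = of_real ((1 - s) powr (\<delta> + real j))" for j
      proof -
        have "1 - complex_of_real s = of_real (1 - s)" by simp
        then show ?thesis using True by (simp only: powr_of_real diff_ge_0_iff_ge less_imp_le)
      qed
      have a3: "complex_of_real s powr of_real (- lam / 2) = of_real (s powr (- lam / 2))"
        using s by (simp only: powr_of_real less_imp_le)
      have E0: "EE 0 s = of_real (s powr (- lam / 2)) * of_real ((1 - s powr (\<gamma> / 2)) powr \<delta>)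
        - (\<Sum>j<J. c j * of_real ((1 - s) powr (\<delta> + real j)))"
        unfolding EE_def E_def funpow_0 a1 a2 a3 ..
      show ?thesis unfolding I E0 p0 using s1 True by (simp add: algebra_simps max_def)
    next
      case False
      have "(LINT u:{s<..}|lborel. (u - s) ^ (J - 1) *\<^sub>R \<Phi> u) = (LINT u|lborel. (- K) *\<^sub>R (indicator {s<..} u *\<^sub>R ?gP u))"
        unfolding set_lebesgue_integral_def
        by (intro Bochner_Integration.integral_cong) (use False s in \<open>auto simp: \<Phi>_def indicator_def\<close>)
      also have "\<dots> = - P 0 s" unfolding P_rep[OF s] integral_scaleR_right set_lebesgue_integral_def by simp
      finally have I: "(LINT u:{s<..}|lborel. (u - s) ^ (J - 1) *\<^sub>R \<Phi> u) = - P 0 s" .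
      have "1 \<le> s powr (\<gamma> / 2)" using False \<gamma> by (intro ge_one_powr_ge_zero) auto
      then show ?thesis unfolding I p0 using False by (simp add: max_def)
    qed
  qed
qed

section \<open>Kernels bounded by a power\<close>

lemma integrable_power_decay:
  fixes \<psi> :: "'a::euclidean_space \<Rightarrow> complex"
  assumes a: "0 < a" "a < real DIM('a)" and [measurable]: "\<psi> \<in> borel_measurable borel"
    and B: "\<And>x. norm (\<psi> x) * (1 + norm x) ^ Suc DIM('a) \<le> B"
  shows "integrable lborel (\<lambda>x. norm x powr (- a) * norm (\<psi> x))"
proof -
  have int: "integrable lborel (\<lambda>x. norm x powr (- a) * indicator (ball 0 1) x * B + norm (\<psi> x))"
    by (intro Bochner_Integration.integrable_add integrable_mult_left integrable_norm_powr_near a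
        integrable_norm integrable_decay[OF _ B]) measurable
  show ?thesis
  proof (rule Bochner_Integration.integrable_bound[OF int])
    show "AE x in lborel. norm (norm x powr (- a) * norm (\<psi> x)) \<le> norm (norm x powr (- a) * indicator (ball 0 1) x * B + norm (\<psi> x))"
    proof (rule AE_I2)
      fix x :: 'a
      have B0: "B \<ge> 0" using order_trans[OF _ B[of 0]] by simp
      have nonneg: "0 \<le> norm x powr (- a) * indicator (ball 0 1) x * B" using B0 by simp
      have "norm x powr (- a) * norm (\<psi> x) \<le> norm x powr (- a) * indicator (ball 0 1) x * B + norm (\<psi> x)"
      proof (cases "norm x < 1")
        case True
        have "norm (\<psi> x) * 1 \<le> norm (\<psi> x) * (1 + norm x) ^ Suc DIM('a)"
          by (intro mult_left_mono one_le_power) auto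
        then have "norm (\<psi> x) \<le> B" using B[of x] by linarith
        then have "norm x powr (- a) * norm (\<psi> x) \<le> norm x powr (- a) * B" by (intro mult_left_mono) auto
        then show ?thesis using True by (simp add: add_increasing2)
      next
        case False
        then have "norm x powr (- a) \<le> 1" using a powr_mono2'[of "- a" 1 "norm x"] by simp
        then have "norm x powr (- a) * norm (\<psi> x) \<le> 1 * norm (\<psi> x)" by (intro mult_right_mono) auto
        then show ?thesis using False by simp
      qed
      then show "norm (norm x powr (- a) * norm (\<psi> x)) \<le> norm (norm x powr (- a) * indicator (ball 0 1) x * B + norm (\<psi> x))"
        using nonneg by simp
    qed
  qed measurable
qed

lemma borel_measurable_br_kernel [measurable]: "br_kernel \<beta> \<in> borel_measurable borel"
  unfolding br_kernel_def by measurable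

text \<open>
  The multiplier of the ball of radius \<open>sqrt u\<close>, left without the normalizing factor \<open>u\<close> to the power
  \<open>-N\<close> so that it is the integrand of \<open>symbol_subordination\<close> when \<open>N = J - 1\<close>.
\<close>

definition br_cap :: "real \<Rightarrow> real \<Rightarrow> 'a::euclidean_space \<Rightarrow> real" where
  "br_cap N u x = (max 0 (u - (norm x)\<^sup>2)) powr N"

lemma br_cap_scale:
  assumes "u > 0" shows "br_cap N u (sqrt u *\<^sub>R x) = u powr N * br_bump N x"
proof -
  have "u - (norm (sqrt u *\<^sub>R x))\<^sup>2 = u * (1 - (norm x)\<^sup>2)"
    using assms by (simp add: power_mult_distrib algebra_simps)
  moreover have "max 0 (u * (1 - (norm x)\<^sup>2)) = u * max 0 (1 - (norm x)\<^sup>2)"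
    using assms by (simp add: max_mult_distrib_left)
  ultimately show ?thesis using assms by (simp add: br_cap_def br_bump_def powr_mult)
qed

lemma br_cap_fourier:
  fixes y :: "'a::euclidean_space"
  assumes u: "u > 0" and N: "N \<ge> 0"
  shows "integrable lborel (\<lambda>x::'a. complex_of_real (br_cap N u x))"
    and "(LINT x|lborel. of_real (br_cap N u x) * unit_char (x \<bullet> y)) = of_real (u powr (N + real DIM('a) / 2)) * br_kernel N (sqrt u *\<^sub>R y)"
proof -
  have su: "sqrt u \<noteq> 0" "sqrt u > 0" using u by auto
  have [measurable]: "(\<lambda>x::'a. br_cap N u x) \<in> borel_measurable borel" unfolding br_cap_def by measurable
  have "integrable lborel (\<lambda>x::'a. of_real (br_cap N u (0 + sqrt u *\<^sub>R x)) :: complex)"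
    using integrable_br_bump_mult[OF N, of "\<lambda>_. of_real (u powr N)" "u powr N"] u
    by (simp add: br_cap_scale mult.commute)
  then show "integrable lborel (\<lambda>x::'a. complex_of_real (br_cap N u x))"
    by (subst integral_lborel_affine(1)[OF _ su(1), where t = 0]) auto
  have "(LINT x|lborel. of_real (br_cap N u x) * unit_char (x \<bullet> y))
     = \<bar>sqrt u\<bar> ^ DIM('a) *\<^sub>R (LINT x|lborel. of_real (br_cap N u (0 + sqrt u *\<^sub>R x)) * unit_char ((0 + sqrt u *\<^sub>R x) \<bullet> y))"
    by (rule integral_lborel_affine(2)[OF _ su(1)]) measurable
  also have "\<dots> = \<bar>sqrt u\<bar> ^ DIM('a) *\<^sub>R (LINT x|lborel. of_real (u powr N) * (of_real (br_bump N x) * unit_char (x \<bullet> (sqrt u *\<^sub>R y))))"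
    using u by (simp add: br_cap_scale mult.assoc)
  also have "\<dots> = of_real (sqrt u ^ DIM('a) * u powr N) * br_kernel N (sqrt u *\<^sub>R y)"
    unfolding integral_mult_right_zero br_kernel_def[symmetric] using u by (simp add: scaleR_conv_of_real)
  also have "sqrt u ^ DIM('a) = u powr (real DIM('a) / 2)"
    using u by (simp add: powr_half_sqrt[symmetric] powr_powr powr_realpow[symmetric] powr_gt_zero)
  finally show "(LINT x|lborel. of_real (br_cap N u x) * unit_char (x \<bullet> y)) = of_real (u powr (N + real DIM('a) / 2)) * br_kernel N (sqrt u *\<^sub>R y)"
    by (simp add: powr_add mult.commute)
qed

text \<open>
  Pairs of a kernel and its multiplier, as seen by Schwartz functions. The bound by a power is part of
  the notion because it makes \<open>k\<close> integrable against Schwartz functions; with it the pairs for a fixed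
  exponent form a vector space that is also closed under superpositions.
\<close>

definition kernel_pair :: "real \<Rightarrow> ('a::euclidean_space \<Rightarrow> complex) \<Rightarrow> ('a \<Rightarrow> complex) \<Rightarrow> bool" where
  "kernel_pair a k m \<longleftrightarrow>
     k \<in> borel_measurable borel \<and> m \<in> borel_measurable borel \<and>
     (\<exists>C. \<forall>y. y \<noteq> 0 \<longrightarrow> norm (k y) \<le> C * norm y powr (- a)) \<and>
     (\<forall>\<phi>\<in>schwartz. integrable lborel (\<lambda>x. m x * \<phi> x) \<and>
        (LINT y|lborel. k y * fourier \<phi> y) = (LINT x|lborel. m x * \<phi> x))"

lemma AE_lborel_nonzero: "AE x in (lborel :: 'a::euclidean_space measure). x \<noteq> 0"
  using AE_lborel_singleton[of 0] by simp

lemma kernel_bound_integrable: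
  fixes k \<psi> :: "'a::euclidean_space \<Rightarrow> complex"
  assumes a: "0 < a" "a < real DIM('a)"
    and [measurable]: "k \<in> borel_measurable borel" and k: "\<And>y. y \<noteq> 0 \<Longrightarrow> norm (k y) \<le> C * norm y powr (- a)"
    and m\<psi>[measurable]: "\<psi> \<in> borel_measurable borel"
    and B: "\<And>x. norm (\<psi> x) * (1 + norm x) ^ Suc DIM('a) \<le> B"
  shows "integrable lborel (\<lambda>x. k x * \<psi> x)"
proof (rule Bochner_Integration.integrable_bound[OF integrable_mult_right[OF integrable_power_decay[OF a m\<psi> B], of C]])
  show "AE x in lborel. norm (k x * \<psi> x) \<le> norm (C * (norm x powr (- a) * norm (\<psi> x)))"
    using AE_lborel_nonzero
  proof eventually_elim
    case (elim x)
    have "norm (k x * \<psi> x) \<le> C * norm x powr (- a) * norm (\<psi> x)"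
      unfolding norm_mult by (intro mult_right_mono k elim) auto
    then show ?case by (simp add: mult.assoc)
  qed
qed measurable

lemma kernel_pair_integrable_fourier:
  fixes k m :: "'a::euclidean_space \<Rightarrow> complex"
  assumes a: "0 < a" "a < real DIM('a)" and "kernel_pair a k m" "\<phi> \<in> schwartz"
  shows "integrable lborel (\<lambda>x. k x * fourier \<phi> x)" "integrable lborel (\<lambda>x. k x * \<phi> x)"
proof -
  obtain C where C: "\<And>y. y \<noteq> 0 \<Longrightarrow> norm (k y) \<le> C * norm y powr (- a)" and km: "k \<in> borel_measurable borel"
    using assms(3) unfolding kernel_pair_def by blast
  obtain B where B: "\<And>\<xi>. norm (fourier \<phi> \<xi>) * (1 + norm \<xi>) ^ Suc DIM('a) \<le> B" using fourier_decay[OF assms(4)] by blast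
  show "integrable lborel (\<lambda>x. k x * fourier \<phi> x)"
    by (rule kernel_bound_integrable[OF a km C borel_measurable_fourier[OF schwartz_measurable[OF assms(4)]] B])
  obtain B' where B': "\<And>\<xi>. norm (\<phi> \<xi>) * (1 + norm \<xi>) ^ Suc DIM('a) \<le> B'" using schwartz_bound[OF assms(4)] by blast
  show "integrable lborel (\<lambda>x. k x * \<phi> x)"
    by (rule kernel_bound_integrable[OF a km C schwartz_measurable[OF assms(4)] B'])
qed

lemma kernel_pair_add:
  fixes k m :: "'a::euclidean_space \<Rightarrow> complex"
  assumes a: "0 < a" "a < real DIM('a)" and 1: "kernel_pair a k m" and 2: "kernel_pair a k' m'"
  shows "kernel_pair a (\<lambda>y. k y + k' y) (\<lambda>x. m x + m' x)"
proof -
  note int = kernel_pair_integrable_fourier[OF a 1] kernel_pair_integrable_fourier[OF a 2]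
  obtain C where C: "\<And>y. y \<noteq> 0 \<Longrightarrow> norm (k y) \<le> C * norm y powr (- a)" using 1 unfolding kernel_pair_def by blast
  obtain D where D: "\<And>y. y \<noteq> 0 \<Longrightarrow> norm (k' y) \<le> D * norm y powr (- a)" using 2 unfolding kernel_pair_def by blast
  have "norm (k y + k' y) \<le> (C + D) * norm y powr (- a)" if "y \<noteq> 0" for y
    using norm_triangle_ineq[of "k y" "k' y"] C[OF that] D[OF that] by (simp add: distrib_right)
  moreover have "integrable lborel (\<lambda>x. (m x + m' x) * \<phi> x) \<and>
        (LINT y|lborel. (k y + k' y) * fourier \<phi> y) = (LINT x|lborel. (m x + m' x) * \<phi> x)" if \<phi>: "\<phi> \<in> schwartz" for \<phi>
    using 1 2 \<phi> int(1,3)[OF \<phi>] unfolding kernel_pair_def by (simp add: distrib_right)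
  ultimately show ?thesis using 1 2 unfolding kernel_pair_def by (auto intro!: exI[of _ "C + D"])
qed

lemma kernel_pair_cmult:
  fixes k m :: "'a::euclidean_space \<Rightarrow> complex"
  assumes 1: "kernel_pair a k m"
  shows "kernel_pair a (\<lambda>y. c * k y) (\<lambda>x. c * m x)"
proof -
  obtain C where C: "\<And>y. y \<noteq> 0 \<Longrightarrow> norm (k y) \<le> C * norm y powr (- a)" using 1 unfolding kernel_pair_def by blast
  have "norm (c * k y) \<le> (norm c * C) * norm y powr (- a)" if "y \<noteq> 0" for y
    using C[OF that] by (simp add: norm_mult mult.assoc mult_left_mono)
  then show ?thesis using 1 unfolding kernel_pair_def by (auto simp: mult.assoc intro!: exI[of _ "norm c * C"])
qed

lemma kernel_pair_sum:
  fixes k m :: "nat \<Rightarrow> 'a::euclidean_space \<Rightarrow> complex"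
  assumes a: "0 < a" "a < real DIM('a)" and "\<And>j. j < J \<Longrightarrow> kernel_pair a (k j) (m j)"
  shows "kernel_pair a (\<lambda>y. \<Sum>j<J. c j * k j y) (\<lambda>x. \<Sum>j<J. c j * m j x)"
  using assms(3)
proof (induction J)
  case 0
  show ?case by (auto simp: kernel_pair_def intro!: exI[of _ 0])
next
  case (Suc J)
  show ?case unfolding sum.lessThan_Suc
    by (intro kernel_pair_add a kernel_pair_cmult Suc) auto
qed

lemma kernel_pair_br_kernel:
  assumes "\<beta> > 0" "0 \<le> a" "a \<le> \<beta> + (real DIM('a::euclidean_space) + 1) / 2"
  shows "kernel_pair a (br_kernel \<beta> :: 'a \<Rightarrow> complex) (\<lambda>x. of_real (br_bump \<beta> x))"
proof -
  obtain C where "\<And>(y::'a) a. 0 \<le> a \<Longrightarrow> a \<le> \<beta> + (real DIM('a) + 1) / 2 \<Longrightarrow> y \<noteq> 0 \<Longrightarrow> norm (br_kernel \<beta> y) \<le> C * norm y powr (- a)"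
    by (rule br_kernel_decay[OF assms(1)]) (rule that)
  then have "\<And>y::'a. y \<noteq> 0 \<Longrightarrow> norm (br_kernel \<beta> y) \<le> C * norm y powr (- a)" using assms by blast
  moreover have "integrable lborel (\<lambda>x::'a. of_real (br_bump \<beta> x) * \<phi> x) \<and>
     (LINT y|lborel. br_kernel \<beta> y * fourier \<phi> y) = (LINT x|lborel. of_real (br_bump \<beta> x) * \<phi> x)" if \<phi>: "\<phi> \<in> schwartz" for \<phi> :: "'a \<Rightarrow> complex"
  proof
    have b: "integrable lborel (\<lambda>x::'a. complex_of_real (br_bump \<beta> x))"
      using integrable_br_bump_mult[of \<beta> "\<lambda>_. 1" 1] assms by simp
    show "(LINT y|lborel. br_kernel \<beta> y * fourier \<phi> y) = (LINT x|lborel. of_real (br_bump \<beta> x) * \<phi> x)"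
      unfolding br_kernel_def by (rule multiplication_formula[OF \<phi> b])
    have [measurable]: "\<phi> \<in> borel_measurable borel" by (rule schwartz_measurable[OF \<phi>])
    have "norm (of_real (br_bump \<beta> x) * \<phi> x) \<le> norm (\<phi> x)" for x
      using br_bump_le_1[of \<beta> x] br_bump_nonneg[of \<beta> x] assms by (auto simp: norm_mult intro!: mult_left_le_one_le)
    then show "integrable lborel (\<lambda>x::'a. of_real (br_bump \<beta> x) * \<phi> x)"
      by (intro Bochner_Integration.integrable_bound[OF schwartz_integrable[OF \<phi>]] AE_I2) auto
  qed
  ultimately show ?thesis unfolding kernel_pair_def by auto
qed

text \<open>
  Fubini's theorem is needed on both sides of the multiplication formula. The choice of \<open>\<theta>\<close> lets one
  weight serve both: the kernel of the ball of radius \<open>sqrt u\<close> is at most a constant times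
  \<open>u^(N + \<theta>) |y|^(-a)\<close>, its multiplier at most \<open>u^(N + \<theta>) |x|^(-2 \<theta>)\<close>, and the powers \<open>a\<close> and
  \<open>2 \<theta> = n - a\<close> are both locally integrable.
\<close>

lemma kernel_pair_superposition:
  fixes N a \<theta> :: real and \<Phi> :: "real \<Rightarrow> complex"
  assumes a: "0 < a" "a < real DIM('a::euclidean_space)" and N: "N > 0" and aN: "a \<le> N + (real DIM('a) + 1) / 2"
    and \<theta>: "\<theta> = (real DIM('a) - a) / 2"
    and [measurable]: "\<Phi> \<in> borel_measurable borel"
    and W: "integrable lborel (\<lambda>u. indicator {0<..} u * (norm (\<Phi> u) * u powr (N + \<theta>)))"
  shows "kernel_pair a (\<lambda>y::'a. LINT u|lborel. indicator {0<..} u *\<^sub>R (\<Phi> u * (of_real (u powr (N + real DIM('a) / 2)) * br_kernel N (sqrt u *\<^sub>R y))))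
     (\<lambda>x. LINT u|lborel. indicator {0<..} u *\<^sub>R (\<Phi> u * of_real (br_cap N u x)))"
proof -
  define \<kappa> where "\<kappa> = (\<lambda>u (y::'a). of_real (u powr (N + real DIM('a) / 2)) * br_kernel N (sqrt u *\<^sub>R y))"
  define k where "k = (\<lambda>y. LINT u|lborel. indicator {0<..} u *\<^sub>R (\<Phi> u * \<kappa> u y))"
  define m where "m = (\<lambda>x::'a. LINT u|lborel. indicator {0<..} u *\<^sub>R (\<Phi> u * of_real (br_cap N u x)))"
  let ?W = "\<lambda>u. indicator {0<..} u * (norm (\<Phi> u) * u powr (N + \<theta>))"
  obtain C where C: "C \<ge> 0" "\<And>(y::'a) a. 0 \<le> a \<Longrightarrow> a \<le> N + (real DIM('a) + 1) / 2 \<Longrightarrow> y \<noteq> 0 \<Longrightarrow> norm (br_kernel N y) \<le> C * norm y powr (- a)"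
    by (rule br_kernel_decay[OF N]) (rule that)
  have \<theta>0: "\<theta> > 0" "2 * \<theta> < real DIM('a)" using \<theta> a by auto
  have [measurable]: "case_prod \<kappa> \<in> borel_measurable (borel \<Otimes>\<^sub>M borel)" unfolding \<kappa>_def by measurable
  \<comment> \<open>The decay of \<open>br_kernel N\<close> is used with the exponent \<open>a\<close>, not with its best one; then scaling gives
    the same power of \<open>|y|\<close> for every \<open>u\<close>.\<close>
  have \<kappa>_bd: "norm (\<kappa> u y) \<le> C * u powr (N + \<theta>) * norm y powr (- a)" if u: "u > 0" and y: "y \<noteq> 0" for u y
  proof -
    have "norm (br_kernel N (sqrt u *\<^sub>R y)) \<le> C * norm (sqrt u *\<^sub>R y) powr (- a)"
      using u y a aN by (intro C(2)) auto
    also have "norm (sqrt u *\<^sub>R y) powr (- a) = u powr (- a / 2) * norm y powr (- a)"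
      using u by (simp add: powr_mult powr_half_sqrt[symmetric] powr_powr)
    finally have "norm (\<kappa> u y) \<le> u powr (N + real DIM('a) / 2) * (C * (u powr (- a / 2) * norm y powr (- a)))"
      unfolding \<kappa>_def norm_mult by (intro mult_mono) auto
    also have "\<dots> = C * (u powr (N + real DIM('a) / 2) * u powr (- a / 2)) * norm y powr (- a)" by (simp add: mult_ac)
    also have "u powr (N + real DIM('a) / 2) * u powr (- a / 2) = u powr (N + \<theta>)"
      unfolding \<theta> by (simp add: powr_add[symmetric] diff_divide_distrib add_diff_eq)
    finally show ?thesis .
  qed
  \<comment> \<open>On the support of the multiplier \<open>u / |x|^2\<close> is at least \<open>1\<close>, so its power \<open>\<theta>\<close> may be inserted.\<close>
  have cap_bd: "br_cap N u x \<le> u powr (N + \<theta>) * norm x powr (- (2 * \<theta>))" if u: "u > 0" and x: "x \<noteq> 0" for u and x :: 'a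
  proof (cases "(norm x)\<^sup>2 < u")
    case True
    have "br_cap N u x \<le> u powr N * 1" unfolding br_cap_def using u N True by (simp add: powr_mono2)
    also have "1 \<le> (u / (norm x)\<^sup>2) powr \<theta>" using True x \<theta>0 by (intro ge_one_powr_ge_zero) auto
    also have "u powr N * (u / (norm x)\<^sup>2) powr \<theta> = u powr (N + \<theta>) * norm x powr (- (2 * \<theta>))"
    proof -
      have "(norm x)\<^sup>2 = norm x powr 2" using x by (simp add: powr_numeral)
      then have "((norm x)\<^sup>2) powr \<theta> = norm x powr (2 * \<theta>)" by (simp only: powr_powr)
      moreover have "(u / (norm x)\<^sup>2) powr \<theta> = u powr \<theta> / ((norm x)\<^sup>2) powr \<theta>"
        by (rule powr_divide)
      ultimately show ?thesis by (simp add: powr_add powr_minus divide_inverse)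
    qed
    finally show ?thesis by (simp add: mult_left_mono)
  qed (use N in \<open>auto simp: br_cap_def\<close>)
  have cap0: "br_cap N u x \<ge> 0" for u and x :: 'a by (simp add: br_cap_def)
  have ptw: "norm (indicator {0<..} u *\<^sub>R (\<Phi> u * \<kappa> u y)) \<le> ?W u * (C * norm y powr (- a))" if "y \<noteq> 0" for u y
  proof (cases "u > 0")
    case True
    have "norm (\<Phi> u) * norm (\<kappa> u y) \<le> norm (\<Phi> u) * (C * u powr (N + \<theta>) * norm y powr (- a))"
      by (intro mult_left_mono \<kappa>_bd True that) auto
    then show ?thesis using True by (simp add: norm_mult mult_ac)
  qed simp
  have k_bd: "norm (k y) \<le> (C * integral\<^sup>L lborel ?W) * norm y powr (- a)" if y: "y \<noteq> 0" for y
  proof -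
    have i: "integrable lborel (\<lambda>u. ?W u * (C * norm y powr (- a)))" by (rule integrable_mult_left[OF W])
    have "integrable lborel (\<lambda>u. indicator {0<..} u *\<^sub>R (\<Phi> u * \<kappa> u y))"
      by (rule Bochner_Integration.integrable_bound[OF i]) (use ptw[OF y] in \<open>auto intro!: AE_I2 order_trans[OF _ abs_ge_self]\<close>)
    then have "norm (k y) \<le> (LINT u|lborel. ?W u * (C * norm y powr (- a)))"
      unfolding k_def by (rule Bochner_Integration.integral_norm_bound_integral[OF _ i ptw[OF y]])
    then show ?thesis by (simp only: integral_mult_left_zero) (simp only: mult_ac)
  qed
  have main: "integrable lborel (\<lambda>x. m x * \<phi> x) \<and> (LINT y|lborel. k y * fourier \<phi> y) = (LINT x|lborel. m x * \<phi> x)"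
    if \<phi>: "\<phi> \<in> schwartz" for \<phi>
  proof -
    note [measurable] = schwartz_measurable[OF \<phi>] borel_measurable_fourier[OF schwartz_measurable[OF \<phi>]]
    obtain B where B: "\<And>\<xi>. norm (fourier \<phi> \<xi>) * (1 + norm \<xi>) ^ Suc DIM('a) \<le> B" using fourier_decay[OF \<phi>] by blast
    obtain B' where B': "\<And>\<xi>. norm (\<phi> \<xi>) * (1 + norm \<xi>) ^ Suc DIM('a) \<le> B'" using schwartz_bound[OF \<phi>] by blast
    define f where "f = (\<lambda>u y. indicator {0<..} u *\<^sub>R (\<Phi> u * \<kappa> u y) * fourier \<phi> y)"
    define g where "g = (\<lambda>u x. indicator {0<..} u *\<^sub>R (\<Phi> u * of_real (br_cap N u x)) * \<phi> x)"
    have fin_f: "(\<integral>\<^sup>+u. \<integral>\<^sup>+y. ennreal (norm (f u y)) \<partial>lborel \<partial>lborel) < \<infinity>"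
    proof (rule nn_integral_product_finite[where u = "\<lambda>u. ?W u * C" and v = "\<lambda>y. norm y powr (- a) * norm (fourier \<phi> y)"])
      show "AE u in lborel. AE y in lborel. norm (f u y) \<le> ?W u * C * (norm y powr (- a) * norm (fourier \<phi> y))"
      proof (rule AE_I2)
        fix u show "AE y in lborel. norm (f u y) \<le> ?W u * C * (norm y powr (- a) * norm (fourier \<phi> y))"
          using AE_lborel_nonzero
        proof eventually_elim
          case (elim y)
          have "norm (f u y) \<le> ?W u * (C * norm y powr (- a)) * norm (fourier \<phi> y)"
            unfolding f_def norm_mult[of _ "fourier \<phi> y"] by (intro mult_right_mono ptw elim) auto
          then show ?case by (simp only: mult.assoc)
        qed
      qed
      show "integrable lborel (\<lambda>u. ?W u * C)" by (rule integrable_mult_left[OF W])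
      show "integrable lborel (\<lambda>y. norm y powr (- a) * norm (fourier \<phi> y))"
        by (rule integrable_power_decay[OF a _ B]) measurable
    qed (use C in auto)
    have fin_g: "(\<integral>\<^sup>+u. \<integral>\<^sup>+x. ennreal (norm (g u x)) \<partial>lborel \<partial>lborel) < \<infinity>"
    proof (rule nn_integral_product_finite[where u = ?W and v = "\<lambda>x. norm x powr (- (2 * \<theta>)) * norm (\<phi> x)"])
      show "AE u in lborel. AE x in lborel. norm (g u x) \<le> ?W u * (norm x powr (- (2 * \<theta>)) * norm (\<phi> x))"
      proof (rule AE_I2)
        fix u show "AE x in lborel. norm (g u x) \<le> ?W u * (norm x powr (- (2 * \<theta>)) * norm (\<phi> x))"
          using AE_lborel_nonzero
        proof eventually_elim
          case (elim x)
          show ?case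
          proof (cases "u > 0")
            case True
            have "norm (\<Phi> u) * br_cap N u x * norm (\<phi> x) \<le> norm (\<Phi> u) * (u powr (N + \<theta>) * norm x powr (- (2 * \<theta>))) * norm (\<phi> x)"
              by (intro mult_right_mono mult_left_mono cap_bd True elim) auto
            then show ?thesis using True by (simp add: g_def norm_mult cap0 mult_ac)
          qed (simp add: g_def)
        qed
      qed
      show "integrable lborel (\<lambda>x. norm x powr (- (2 * \<theta>)) * norm (\<phi> x))"
        by (rule integrable_power_decay[OF _ \<theta>0(2) _ B']) (use \<theta>0 in auto)
    qed (use W in auto)
    have f_m: "case_prod f \<in> borel_measurable (lborel \<Otimes>\<^sub>M lborel)" unfolding f_def by measurable
    have g_m: "case_prod g \<in> borel_measurable (lborel \<Otimes>\<^sub>M lborel)" unfolding g_def br_cap_def by measurable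
    note Ff = Fubini_finite[OF sigma_finite_lborel sigma_finite_lborel f_m fin_f]
    note Fg = Fubini_finite[OF sigma_finite_lborel sigma_finite_lborel g_m fin_g]
    have mg: "(LINT u|lborel. g u x) = m x * \<phi> x" for x unfolding g_def m_def by (rule integral_mult_left_zero)
    have kf: "(LINT u|lborel. f u y) = k y * fourier \<phi> y" for y unfolding f_def k_def by (rule integral_mult_left_zero)
    have inner: "(LINT y|lborel. f u y) = (LINT x|lborel. g u x)" for u
    proof (cases "u > 0")
      case True
      have N0: "N \<ge> 0" using N by simp
      have "(LINT y|lborel. \<kappa> u y * fourier \<phi> y) = (LINT x|lborel. of_real (br_cap N u x) * \<phi> x)"
        using multiplication_formula[OF \<phi> br_cap_fourier(1)[OF True N0]]
        unfolding br_cap_fourier(2)[OF True N0] \<kappa>_def .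
      moreover have "(LINT y|lborel. f u y) = \<Phi> u * (LINT y|lborel. \<kappa> u y * fourier \<phi> y)"
        using True by (simp add: f_def mult.assoc)
      moreover have "(LINT x|lborel. g u x) = \<Phi> u * (LINT x|lborel. of_real (br_cap N u x) * \<phi> x)"
        using True by (simp add: g_def mult.assoc)
      ultimately show ?thesis by simp
    qed (simp add: f_def g_def)
    have "(LINT y|lborel. k y * fourier \<phi> y) = (LINT u|lborel. LINT y|lborel. f u y)"
      unfolding Ff(1) kf ..
    also have "\<dots> = (LINT x|lborel. m x * \<phi> x)" unfolding inner Fg(1) mg ..
    finally show ?thesis using Fg(3) unfolding mg by blast
  qed
  have "k \<in> borel_measurable borel" unfolding k_def by measurable
  moreover have "m \<in> borel_measurable borel" unfolding m_def br_cap_def by measurable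
  ultimately have "kernel_pair a k m" unfolding kernel_pair_def using k_bd main by blast
  then show ?thesis unfolding k_def m_def \<kappa>_def .
qed

lemma kernel_pair_imp_inverse_fourier:
  fixes k m :: "'a::euclidean_space \<Rightarrow> complex"
  assumes a: "0 < a" "a < real DIM('a)" and km: "kernel_pair a k m"
  shows "is_inverse_fourier k m"
proof -
  have [measurable]: "k \<in> borel_measurable borel" "m \<in> borel_measurable borel" using km by (auto simp: kernel_pair_def)
  obtain C where C: "\<And>y. y \<noteq> 0 \<Longrightarrow> norm (k y) \<le> C * norm y powr (- a)" using km unfolding kernel_pair_def by blast
  have "set_integrable lebesgue K k" if K: "compact K" for K
  proof -
    obtain r where r: "r > 0" "\<And>x. x \<in> K \<Longrightarrow> norm x \<le> r" using compact_imp_bounded[OF K] by (auto simp: bounded_pos)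
    have [measurable]: "K \<in> sets borel" using K by (simp add: compact_imp_closed borel_closed)
    have "integrable lborel (\<lambda>x. k x * indicator K x)"
    proof (rule kernel_bound_integrable[OF a _ C])
      fix x show "norm (indicator K x :: complex) * (1 + norm x) ^ Suc DIM('a) \<le> (1 + r) ^ Suc DIM('a)"
      proof (cases "x \<in> K")
        case True
        then have "(1 + norm x) ^ Suc DIM('a) \<le> (1 + r) ^ Suc DIM('a)" using r by (intro power_mono) auto
        then show ?thesis using True by simp
      qed (use r in simp)
    qed measurable
    then have "integrable lborel (\<lambda>x. indicator K x *\<^sub>R k x)"
      by (rule Bochner_Integration.integrable_cong[THEN iffD1, rotated -1]) (auto simp: indicator_def)
    then show ?thesis unfolding set_integrable_def by (subst integrable_completion) auto
  qed
  moreover have "integrable lebesgue (\<lambda>x. k x * \<phi> x)" "integrable lebesgue (\<lambda>\<xi>. m \<xi> * \<phi> \<xi>)"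
    "fourier_dist (dist_of k) \<phi> = dist_of m \<phi>" if \<phi>: "\<phi> \<in> schwartz" for \<phi>
  proof -
    note [measurable] = schwartz_measurable[OF \<phi>] borel_measurable_fourier[OF schwartz_measurable[OF \<phi>]]
    have *: "(LINT y|lborel. k y * fourier \<phi> y) = (LINT x|lborel. m x * \<phi> x)" "integrable lborel (\<lambda>x. m x * \<phi> x)"
      using km \<phi> unfolding kernel_pair_def by auto
    show "integrable lebesgue (\<lambda>x. k x * \<phi> x)"
      using kernel_pair_integrable_fourier(2)[OF a km \<phi>] by (subst integrable_completion) auto
    show "integrable lebesgue (\<lambda>x. m x * \<phi> x)" using *(2) by (subst integrable_completion) auto
    show "fourier_dist (dist_of k) \<phi> = dist_of m \<phi>"
      unfolding fourier_dist_def dist_of_def using *(1) by (simp add: integral_completion)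
  qed
  ultimately show ?thesis unfolding is_inverse_fourier_def by blast
qed

section \<open>Gaussians determine integrals\<close>

lemma norm_sum_squared_le: "(norm (x + y))\<^sup>2 \<le> 2 * (norm x)\<^sup>2 + 2 * (norm (y::'a::real_normed_vector))\<^sup>2"
proof -
  have "(norm (x + y))\<^sup>2 \<le> (norm x + norm y)\<^sup>2" by (intro power_mono norm_triangle_ineq) auto
  also have "\<dots> \<le> 2 * (norm x)\<^sup>2 + 2 * (norm y)\<^sup>2"
    using sum_squares_bound[of "norm x" "norm y"] by (simp add: power2_sum)
  finally show ?thesis .
qed

lemma gauss_integrable_real: "c > 0 \<Longrightarrow> integrable lborel (\<lambda>x::'a::euclidean_space. exp (- c * (norm x)\<^sup>2))"
  using integrable_norm[OF integrable_gauss_wave[of c "0::'a"]] by (simp add: norm_gauss_wave)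

lemma integrable_dominated:
  fixes f :: "'b::euclidean_space \<Rightarrow> complex"
  assumes "integrable M w" "f \<in> borel_measurable M" "\<And>x. norm (f x) \<le> w x"
  shows "integrable M f" "norm (integral\<^sup>L M f) \<le> integral\<^sup>L M w"
proof -
  have "AE x in M. norm (f x) \<le> norm (w x)"
    using assms(3) by (intro AE_I2) (metis abs_ge_self order_trans real_norm_def)
  then show "integrable M f" by (rule Bochner_Integration.integrable_bound[OF assms(1,2)])
  from Bochner_Integration.integral_norm_bound_integral[OF this assms(1)] assms(3)
  show "norm (integral\<^sup>L M f) \<le> integral\<^sup>L M w" by blast
qed

text \<open>
  A uniformly bounded sequence whose integrals against all translated and dilated Gaussians tend to
  zero. The measure is general because two cases are needed: a power weight, for dilated kernels, and
  the absolute value of a function that is to be shown to vanish.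
\<close>

locale gauss_null_family =
  fixes \<nu> :: "'a::euclidean_space measure" and Q :: "nat \<Rightarrow> 'a \<Rightarrow> complex" and B :: real
  assumes sets_\<nu> [measurable_cong]: "sets \<nu> = sets borel"
    and sigma_finite_\<nu>: "sigma_finite_measure \<nu>"
    and gauss_\<nu>: "\<And>c. c > 0 \<Longrightarrow> integrable \<nu> (\<lambda>y. exp (- c * (norm y)\<^sup>2))"
    and Q_measurable [measurable]: "\<And>i. Q i \<in> borel_measurable borel"
    and Q_bound: "\<And>i y. norm (Q i y) \<le> B"
    and Q_gauss: "\<And>c x. c > 0 \<Longrightarrow> (\<lambda>i. LINT y|\<nu>. Q i y * of_real (exp (- c * (norm (x - y))\<^sup>2))) \<longlonglongrightarrow> 0"
begin

definition null_against :: "('a \<Rightarrow> complex) \<Rightarrow> bool" where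
  "null_against h \<longleftrightarrow> integrable \<nu> h \<and> (\<lambda>i. LINT y|\<nu>. Q i y * h y) \<longlonglongrightarrow> 0"

lemma B_nonneg: "B \<ge> 0"
  using Q_bound[of 0 0] norm_ge_zero order_trans by blast

lemma Q_mult_integrable: "integrable \<nu> h \<Longrightarrow> integrable \<nu> (\<lambda>y. Q i y * h y)"
proof (rule Bochner_Integration.integrable_bound)
  assume h: "integrable \<nu> h"
  show "integrable \<nu> (\<lambda>y. B * norm (h y))" using h by auto
  show "(\<lambda>y. Q i y * h y) \<in> borel_measurable \<nu>" using borel_measurable_integrable[OF h] by measurable
  show "AE y in \<nu>. norm (Q i y * h y) \<le> norm (B * norm (h y))"
    using Q_bound[of i] B_nonneg by (intro AE_I2) (auto simp: norm_mult intro!: mult_right_mono)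
qed

text \<open>
  The uniform bound on \<open>Q\<close> turns \<open>L\<^sup>1\<close> approximation into approximation of the integrals that is
  uniform in \<open>i\<close>.
\<close>

lemma null_against_limit:
  assumes P: "\<And>m. null_against (h m)" and [measurable]: "h' \<in> borel_measurable borel"
    and lim: "\<And>y. (\<lambda>m. h m y) \<longlonglongrightarrow> h' y" and bnd: "\<And>m y. norm (h m y) \<le> w y" and w: "integrable \<nu> w"
  shows "null_against h'"
proof -
  have hi: "integrable \<nu> (h m)" for m using P by (simp add: null_against_def)
  have [measurable]: "h m \<in> borel_measurable \<nu>" for m using hi by simp
  have h'w: "norm (h' y) \<le> w y" for y
    by (rule Lim_norm_ubound[OF _ lim]) (auto simp: bnd)
  have h'i: "integrable \<nu> h'"
    by (rule integrable_dominated(1)[OF w _ h'w]) measurable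
  have "(\<lambda>m. LINT y|\<nu>. norm (h m y - h' y)) \<longlonglongrightarrow> (LINT y|\<nu>. 0)"
  proof (rule integral_dominated_convergence[where w = "\<lambda>y. 2 * w y"])
    show "AE y in \<nu>. (\<lambda>m. norm (h m y - h' y)) \<longlonglongrightarrow> 0"
      using lim by (intro AE_I2 tendsto_norm_zero) (simp add: LIM_zero)
    show "AE y in \<nu>. norm (norm (h m y - h' y)) \<le> 2 * w y" for m
    proof (rule AE_I2)
      fix y show "norm (norm (h m y - h' y)) \<le> 2 * w y"
        using norm_triangle_ineq4[of "h m y" "h' y"] bnd[of m y] h'w[of y] by simp
    qed
  qed (use w in auto)
  then have L1: "(\<lambda>m. LINT y|\<nu>. norm (h m y - h' y)) \<longlonglongrightarrow> 0" by simp
  have "(\<lambda>i. LINT y|\<nu>. Q i y * h' y) \<longlonglongrightarrow> 0"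
  proof (rule LIMSEQ_I)
    fix e :: real assume e: "e > 0"
    then have "e / (2 * (B + 1)) > 0" using B_nonneg by simp
    from order_tendstoD(2)[OF L1 this] obtain m where m: "(LINT y|\<nu>. norm (h m y - h' y)) < e / (2 * (B + 1))"
      by (auto simp: eventually_sequentially)
    have "(\<lambda>i. LINT y|\<nu>. Q i y * h m y) \<longlonglongrightarrow> 0" using P by (simp add: null_against_def)
    then have "\<exists>n0. \<forall>i\<ge>n0. norm ((LINT y|\<nu>. Q i y * h m y) - 0) < e / 2"
      using e by (intro LIMSEQ_D) auto
    then obtain n0 where n0: "\<And>i. i \<ge> n0 \<Longrightarrow> norm (LINT y|\<nu>. Q i y * h m y) < e / 2" by auto
    show "\<exists>no. \<forall>i\<ge>no. norm ((LINT y|\<nu>. Q i y * h' y) - 0) < e"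
    proof (intro exI allI impI)
      fix i assume i: "i \<ge> n0"
      have d: "integrable \<nu> (\<lambda>y. norm (h m y - h' y))" using hi h'i by auto
      have "norm ((LINT y|\<nu>. Q i y * h m y) - (LINT y|\<nu>. Q i y * h' y)) = norm (LINT y|\<nu>. Q i y * (h m y - h' y))"
        using Q_mult_integrable[OF hi] Q_mult_integrable[OF h'i] by (simp add: right_diff_distrib)
      also have "\<dots> \<le> (LINT y|\<nu>. B * norm (h m y - h' y))"
      proof (rule Bochner_Integration.integral_norm_bound_integral)
        show "integrable \<nu> (\<lambda>y. Q i y * (h m y - h' y))" using hi h'i by (intro Q_mult_integrable) auto
        show "integrable \<nu> (\<lambda>y. B * norm (h m y - h' y))" using d by auto
        show "norm (Q i y * (h m y - h' y)) \<le> B * norm (h m y - h' y)" for y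
          unfolding norm_mult by (intro mult_right_mono Q_bound) auto
      qed
      also have "\<dots> = B * (LINT y|\<nu>. norm (h m y - h' y))" by simp
      also have "\<dots> \<le> (B + 1) * (LINT y|\<nu>. norm (h m y - h' y))" by (intro mult_right_mono) auto
      also have "\<dots> < (B + 1) * (e / (2 * (B + 1)))" using B_nonneg by (intro mult_strict_left_mono m) auto
      also have "\<dots> = e / 2" using B_nonneg by (simp add: field_simps)
      finally have "norm ((LINT y|\<nu>. Q i y * h m y) - (LINT y|\<nu>. Q i y * h' y)) < e / 2" .
      with n0[OF i] have "norm (LINT y|\<nu>. Q i y * h' y) < e / 2 + e / 2"
        using norm_triangle_ineq4[of "LINT y|\<nu>. Q i y * h m y" "(LINT y|\<nu>. Q i y * h m y) - (LINT y|\<nu>. Q i y * h' y)"] by simp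
      then show "norm ((LINT y|\<nu>. Q i y * h' y) - 0) < e" by simp
    qed
  qed
  with h'i show ?thesis by (simp add: null_against_def)
qed

lemma null_against_add: "null_against g \<Longrightarrow> null_against h \<Longrightarrow> null_against (\<lambda>y. g y + h y)"
  unfolding null_against_def
  using tendsto_add[of "\<lambda>i. LINT y|\<nu>. Q i y * g y" 0 sequentially "\<lambda>i. LINT y|\<nu>. Q i y * h y" 0]
  by (auto simp: distrib_left Q_mult_integrable)

lemma null_against_cmult: "null_against h \<Longrightarrow> null_against (\<lambda>y. c * h y)"
  unfolding null_against_def
  using tendsto_mult_right_zero[of "\<lambda>i. LINT y|\<nu>. Q i y * h y" sequentially c]
  by (auto simp: mult.left_commute[of _ c])

text \<open>
  The function \<open>\<eta>\<close> is the limit of its own Gaussian averages, which by Fubini's theorem are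
  superpositions of Gaussians and hence null. The decay of \<open>\<eta>\<close> leaves enough room for a Gaussian
  majorant that does not depend on the stage of the approximation.
\<close>

lemma null_against_continuous:
  assumes \<eta>: "continuous_on UNIV \<eta>" and M: "\<And>x. norm (\<eta> x) \<le> M * exp (- (norm x)\<^sup>2)"
  shows "null_against \<eta>"
proof -
  have [measurable]: "\<eta> \<in> borel_measurable borel" by (rule borel_measurable_continuous_onI[OF \<eta>])
  have M0: "M \<ge> 0" using order_trans[OF norm_ge_zero M[of 0]] by simp
  have g1: "integrable lborel (\<lambda>x::'a. exp (- (norm x)\<^sup>2))" using gauss_integrable_real[of 1] by simp
  have g2: "integrable lborel (\<lambda>x::'a. exp (- (1/2) * (norm x)\<^sup>2))" by (rule gauss_integrable_real) simp
  define Z where "Z = sqrt pi ^ DIM('a)"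
  have Z: "Z > 0" by (simp add: Z_def)
  \<comment> \<open>The sharpness of the averaging Gaussian. Starting at \<open>2\<close> keeps half of the decay of \<open>\<eta>\<close> in the
    majorant \<open>exp (- |y|\<^sup>2 / 2)\<close> at every stage.\<close>
  define c where "c = (\<lambda>m. real m + 2)"
  have c: "c m \<ge> 2" "c m > 0" for m by (simp_all add: c_def)
  define \<eta>c where "\<eta>c = (\<lambda>m y. of_real (sqrt (c m) ^ DIM('a) / Z) * (LINT x|lborel. \<eta> x * of_real (exp (- c m * (norm (x - y))\<^sup>2))))"
  have \<eta>c_eq: "\<eta>c m y = of_real (1 / Z) * (LINT w|lborel. \<eta> (y + (1 / sqrt (c m)) *\<^sub>R w) * of_real (exp (- (norm w)\<^sup>2)))" for m y
  proof -
    have s: "1 / sqrt (c m) \<noteq> 0" "1 / sqrt (c m) > 0" using c[of m] by auto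
    have "(LINT x|lborel. \<eta> x * of_real (exp (- c m * (norm (x - y))\<^sup>2)))
       = \<bar>1 / sqrt (c m)\<bar> ^ DIM('a) *\<^sub>R (LINT w|lborel. \<eta> (y + (1 / sqrt (c m)) *\<^sub>R w) * of_real (exp (- c m * (norm ((y + (1 / sqrt (c m)) *\<^sub>R w) - y))\<^sup>2)))"
      by (rule integral_lborel_affine(2)[OF _ s(1)]) measurable
    also have "(\<lambda>w::'a. exp (- c m * (norm ((y + (1 / sqrt (c m)) *\<^sub>R w) - y))\<^sup>2)) = (\<lambda>w. exp (- (norm w)\<^sup>2))"
      using c[of m] by (intro ext) (simp add: power_divide power_mult_distrib)
    finally show ?thesis unfolding \<eta>c_def using s c[of m]
      by (simp add: scaleR_conv_of_real power_divide)
  qed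
  have small: "norm (\<eta> (y + (1 / sqrt (c m)) *\<^sub>R w) * of_real (exp (- (norm w)\<^sup>2))) \<le> M * exp (- (1/2) * (norm y)\<^sup>2) * exp (- (1/2) * (norm w)\<^sup>2)" for m y w
  proof -
    let ?x = "y + (1 / sqrt (c m)) *\<^sub>R w"
    have "(norm y)\<^sup>2 = (norm (?x + (- (1 / sqrt (c m))) *\<^sub>R w))\<^sup>2" by (simp add: scaleR_left.minus)
    also have "\<dots> \<le> 2 * (norm ?x)\<^sup>2 + 2 * (norm ((- (1 / sqrt (c m))) *\<^sub>R w))\<^sup>2" by (rule norm_sum_squared_le)
    also have "2 * (norm ((- (1 / sqrt (c m))) *\<^sub>R w))\<^sup>2 = (2 / c m) * (norm w)\<^sup>2"
      using c[of m] by (simp add: power_mult_distrib power_divide)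
    also have "\<dots> \<le> 1 * (norm w)\<^sup>2" using c[of m] by (intro mult_right_mono) auto
    finally have le: "- (norm ?x)\<^sup>2 + (- (norm w)\<^sup>2) \<le> - (1/2) * (norm y)\<^sup>2 + (- (1/2) * (norm w)\<^sup>2)" by simp
    have "norm (\<eta> ?x * of_real (exp (- (norm w)\<^sup>2))) \<le> M * exp (- (norm ?x)\<^sup>2) * exp (- (norm w)\<^sup>2)"
      unfolding norm_mult using M[of ?x] by (simp add: mult_right_mono)
    also have "\<dots> = M * exp (- (norm ?x)\<^sup>2 + (- (norm w)\<^sup>2))" by (simp only: exp_add mult.assoc)
    also have "\<dots> \<le> M * exp (- (1/2) * (norm y)\<^sup>2 + (- (1/2) * (norm w)\<^sup>2))"
      using le M0 by (intro mult_left_mono) (simp_all only: exp_le_cancel_iff)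
    finally show ?thesis by (simp only: exp_add mult.assoc)
  qed
  define D where "D = (LINT w|lborel. exp (- (1/2) * (norm (w::'a))\<^sup>2))"
  show ?thesis
  proof (rule null_against_limit[where h = \<eta>c and w = "\<lambda>y. (M * D / Z) * exp (- (1/2) * (norm y)\<^sup>2)"])
    show "integrable \<nu> (\<lambda>y. (M * D / Z) * exp (- (1/2) * (norm y)\<^sup>2))"
      by (rule integrable_mult_right[OF gauss_\<nu>]) simp
    show bnd: "norm (\<eta>c m y) \<le> (M * D / Z) * exp (- (1/2) * (norm y)\<^sup>2)" for m y
    proof -
      have i: "integrable lborel (\<lambda>w::'a. M * exp (- (1/2) * (norm y)\<^sup>2) * exp (- (1/2) * (norm w)\<^sup>2))"
        by (rule integrable_mult_right[OF g2])
      have "norm (LINT w|lborel. \<eta> (y + (1 / sqrt (c m)) *\<^sub>R w) * of_real (exp (- (norm w)\<^sup>2)))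
        \<le> (LINT w|lborel. M * exp (- (1/2) * (norm y)\<^sup>2) * exp (- (1/2) * (norm (w::'a))\<^sup>2))"
        by (rule integrable_dominated(2)[OF i _ small]) measurable
      also have "\<dots> = M * exp (- (1/2) * (norm y)\<^sup>2) * D" unfolding D_def by (rule integral_mult_right_zero)
      finally have "norm (of_real (1 / Z) * (LINT w|lborel. \<eta> (y + (1 / sqrt (c m)) *\<^sub>R w) * of_real (exp (- (norm w)\<^sup>2))))
        \<le> (1 / Z) * (M * exp (- (1/2) * (norm y)\<^sup>2) * D)"
        unfolding norm_mult using Z by (intro mult_mono) (auto simp: norm_divide)
      then show ?thesis unfolding \<eta>c_eq by (simp only: divide_inverse mult_1_left mult_ac)
    qed
    show "(\<lambda>m. \<eta>c m y) \<longlonglongrightarrow> \<eta> y" for y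
    proof -
      have L: "(\<lambda>m. LINT w|lborel. \<eta> (y + (1 / sqrt (c m)) *\<^sub>R w) * of_real (exp (- (norm w)\<^sup>2)))
         \<longlonglongrightarrow> (LINT w|lborel. \<eta> y * of_real (exp (- (norm (w::'a))\<^sup>2)))"
      proof (rule integral_dominated_convergence[where w = "\<lambda>w. M * exp (- (norm (w::'a))\<^sup>2)"])
        have s0: "(\<lambda>m. 1 / sqrt (c m)) \<longlonglongrightarrow> 0" unfolding c_def by real_asymp
        have "isCont \<eta> y" using \<eta> by (simp add: continuous_on_eq_continuous_at)
        moreover have "(\<lambda>m. y + (1 / sqrt (c m)) *\<^sub>R w) \<longlonglongrightarrow> y" for w
          using tendsto_add[OF tendsto_const tendsto_scaleR[OF s0 tendsto_const[of w]], of y] by simp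
        ultimately have "(\<lambda>m. \<eta> (y + (1 / sqrt (c m)) *\<^sub>R w)) \<longlonglongrightarrow> \<eta> y" for w
          by (rule isCont_tendsto_compose)
        then show "AE w in lborel. (\<lambda>m. \<eta> (y + (1 / sqrt (c m)) *\<^sub>R w) * of_real (exp (- (norm w)\<^sup>2))) \<longlonglongrightarrow> \<eta> y * of_real (exp (- (norm w)\<^sup>2))"
          by (intro AE_I2 tendsto_mult tendsto_const)
        have "norm (\<eta> x) \<le> M" for x
          using order_trans[OF M[of x] mult_left_le[OF _ M0, of "exp (- (norm x)\<^sup>2)"]] by simp
        then show "AE w in lborel. norm (\<eta> (y + (1 / sqrt (c m)) *\<^sub>R w) * of_real (exp (- (norm w)\<^sup>2))) \<le> M * exp (- (norm w)\<^sup>2)" for m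
          by (intro AE_I2) (simp add: norm_mult mult_right_mono)
        show "integrable lborel (\<lambda>w::'a. M * exp (- (norm w)\<^sup>2))" by (rule integrable_mult_right[OF g1])
      qed measurable
      have E: "(LINT w|lborel. \<eta> y * of_real (exp (- (norm (w::'a))\<^sup>2))) = \<eta> y * of_real Z"
      proof -
        have "(LINT w|lborel. exp (- (norm (w::'a))\<^sup>2)) = Z" using integral_gauss[of 1, where 'a='a] by (simp add: Z_def)
        then show ?thesis by (simp only: integral_mult_right_zero integral_complex_of_real)
      qed
      have "of_real (1 / Z) * (\<eta> y * of_real Z) = \<eta> y" using Z by simp
      with tendsto_mult[OF tendsto_const L[unfolded E], of "of_real (1 / Z)"] show ?thesis
        unfolding \<eta>c_eq by (simp only:)
    qed
    show "null_against (\<eta>c m)" for m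
    proof -
      let ?G = "\<lambda>x y. of_real (exp (- c m * (norm (x - y))\<^sup>2)) :: complex"
      \<comment> \<open>Half of the exponent of \<open>\<eta>\<close> is kept for the integral over \<open>x\<close>; the other half, together with the
        averaging Gaussian, dominates a Gaussian in \<open>y\<close>.\<close>
      have prod: "norm (\<eta> x) * exp (- c m * (norm (x - y))\<^sup>2) \<le> (M * exp (- (1/2) * (norm x)\<^sup>2)) * exp (- (1/4) * (norm y)\<^sup>2)" for x y
      proof -
        have "(norm y)\<^sup>2 \<le> 2 * (norm x)\<^sup>2 + 2 * (norm (y - x))\<^sup>2" using norm_sum_squared_le[of x "y - x"] by simp
        also have "norm (y - x) = norm (x - y)" by (rule norm_minus_commute)
        finally have 1: "(1/4) * (norm y)\<^sup>2 \<le> (1/2) * (norm x)\<^sup>2 + (1/2) * (norm (x - y))\<^sup>2" by simp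
        have "(1/2) * (norm (x - y))\<^sup>2 \<le> c m * (norm (x - y))\<^sup>2" using c[of m] by (intro mult_right_mono) auto
        with 1 have le: "- (norm x)\<^sup>2 + (- c m * (norm (x - y))\<^sup>2) \<le> - (1/2) * (norm x)\<^sup>2 + (- (1/4) * (norm y)\<^sup>2)" by simp
        have "norm (\<eta> x) * exp (- c m * (norm (x - y))\<^sup>2) \<le> M * exp (- (norm x)\<^sup>2) * exp (- c m * (norm (x - y))\<^sup>2)"
          by (intro mult_right_mono M) auto
        also have "\<dots> = M * exp (- (norm x)\<^sup>2 + (- c m * (norm (x - y))\<^sup>2))" by (simp only: exp_add mult.assoc)
        also have "\<dots> \<le> M * exp (- (1/2) * (norm x)\<^sup>2 + (- (1/4) * (norm y)\<^sup>2))"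
          using le M0 by (intro mult_left_mono) (simp_all only: exp_le_cancel_iff)
        finally show ?thesis by (simp only: exp_add mult.assoc)
      qed
      have e4: "integrable \<nu> (\<lambda>y. exp (- (1/4) * (norm y)\<^sup>2))" by (rule gauss_\<nu>) simp
      have L0: "(\<lambda>i. LINT x|lborel. \<eta> x * (LINT y|\<nu>. Q i y * ?G x y)) \<longlonglongrightarrow> (LINT x|(lborel :: 'a measure). 0)"
      proof (rule integral_dominated_convergence[where w = "\<lambda>x::'a. B * (LINT y|\<nu>. exp (- (1/4) * (norm y)\<^sup>2)) * (M * exp (- (1/2) * (norm x)\<^sup>2))"])
        show "integrable lborel (\<lambda>x::'a. B * (LINT y|\<nu>. exp (- (1/4) * (norm y)\<^sup>2)) * (M * exp (- (1/2) * (norm x)\<^sup>2)))"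
          by (intro integrable_mult_right g2)
        show "AE x in lborel. (\<lambda>i. \<eta> x * (LINT y|\<nu>. Q i y * ?G x y)) \<longlonglongrightarrow> 0"
          using Q_gauss[OF c(2)[of m]] by (intro AE_I2 tendsto_mult_right_zero)
        show "AE x in lborel. norm (\<eta> x * (LINT y|\<nu>. Q i y * ?G x y)) \<le> B * (LINT y|\<nu>. exp (- (1/4) * (norm y)\<^sup>2)) * (M * exp (- (1/2) * (norm x)\<^sup>2))" for i
        proof (rule AE_I2)
          fix x :: 'a
          let ?b = "\<lambda>y. B * (M * exp (- (1/2) * (norm x)\<^sup>2)) * exp (- (1/4) * (norm y)\<^sup>2)"
          have ib: "integrable \<nu> ?b" by (rule integrable_mult_right[OF e4])
          have nb: "norm (\<eta> x * (Q i y * ?G x y)) \<le> ?b y" for y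
          proof -
            have "norm (\<eta> x * (Q i y * ?G x y)) = norm (Q i y) * (norm (\<eta> x) * exp (- c m * (norm (x - y))\<^sup>2))"
              by (simp add: norm_mult)
            also have "\<dots> \<le> B * ((M * exp (- (1/2) * (norm x)\<^sup>2)) * exp (- (1/4) * (norm y)\<^sup>2))"
              using B_nonneg by (intro mult_mono Q_bound prod) auto
            finally show ?thesis by (simp only: mult.assoc)
          qed
          have "norm (LINT y|\<nu>. \<eta> x * (Q i y * ?G x y)) \<le> (LINT y|\<nu>. ?b y)"
            by (rule integrable_dominated(2)[OF ib _ nb]) measurable
          then show "norm (\<eta> x * (LINT y|\<nu>. Q i y * ?G x y)) \<le> B * (LINT y|\<nu>. exp (- (1/4) * (norm y)\<^sup>2)) * (M * exp (- (1/2) * (norm x)\<^sup>2))"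
            by (simp add: mult_ac)
        qed
        interpret \<nu>: sigma_finite_measure \<nu> by (rule sigma_finite_\<nu>)
        show "(\<lambda>x. \<eta> x * (LINT y|\<nu>. Q i y * ?G x y)) \<in> borel_measurable lborel" for i by measurable
      qed simp
      have F1: "(LINT y|\<nu>. Q i y * \<eta>c m y) = of_real (sqrt (c m) ^ DIM('a) / Z) * (LINT x|lborel. \<eta> x * (LINT y|\<nu>. Q i y * ?G x y))" for i
      proof -
        have fin: "(\<integral>\<^sup>+x. \<integral>\<^sup>+y. ennreal (norm (\<eta> x * (Q i y * ?G x y))) \<partial>\<nu> \<partial>lborel) < \<infinity>"
        proof (rule nn_integral_product_finite[where u = "\<lambda>x. B * (M * exp (- (1/2) * (norm x)\<^sup>2))" and v = "\<lambda>y. exp (- (1/4) * (norm y)\<^sup>2)"])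
          show "AE x in lborel. AE y in \<nu>. norm (\<eta> x * (Q i y * ?G x y)) \<le> B * (M * exp (- (1/2) * (norm x)\<^sup>2)) * exp (- (1/4) * (norm y)\<^sup>2)"
          proof (intro AE_I2)
            fix x y :: 'a
            have "norm (\<eta> x * (Q i y * ?G x y)) = norm (Q i y) * (norm (\<eta> x) * exp (- c m * (norm (x - y))\<^sup>2))"
              by (simp add: norm_mult)
            also have "\<dots> \<le> B * ((M * exp (- (1/2) * (norm x)\<^sup>2)) * exp (- (1/4) * (norm y)\<^sup>2))"
              using B_nonneg by (intro mult_mono Q_bound prod) auto
            finally show "norm (\<eta> x * (Q i y * ?G x y)) \<le> B * (M * exp (- (1/2) * (norm x)\<^sup>2)) * exp (- (1/4) * (norm y)\<^sup>2)"
              by (simp only: mult.assoc)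
          qed
          show "integrable lborel (\<lambda>x::'a. B * (M * exp (- (1/2) * (norm x)\<^sup>2)))" by (intro integrable_mult_right g2)
        qed (use e4 B_nonneg M0 in auto)
        have meas: "(\<lambda>(x, y). \<eta> x * (Q i y * ?G x y)) \<in> borel_measurable (lborel \<Otimes>\<^sub>M \<nu>)" by measurable
        have "(LINT x|lborel. \<eta> x * (LINT y|\<nu>. Q i y * ?G x y)) = (LINT x|lborel. LINT y|\<nu>. \<eta> x * (Q i y * ?G x y))" by simp
        also have "\<dots> = (LINT y|\<nu>. LINT x|lborel. \<eta> x * (Q i y * ?G x y))"
          by (rule Fubini_finite(1)[OF sigma_finite_lborel sigma_finite_\<nu> meas fin])
        also have "\<dots> = (LINT y|\<nu>. Q i y * (LINT x|lborel. \<eta> x * ?G x y))"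
          by (simp only: mult.left_commute[of "\<eta> _" "Q i _"] integral_mult_right_zero)
        finally have F: "(LINT x|lborel. \<eta> x * (LINT y|\<nu>. Q i y * ?G x y)) = (LINT y|\<nu>. Q i y * (LINT x|lborel. \<eta> x * ?G x y))" .
        show ?thesis unfolding F \<eta>c_def
          by (simp only: mult.left_commute[of "Q i _"] integral_mult_right_zero)
      qed
      have lim0: "(\<lambda>i. LINT y|\<nu>. Q i y * \<eta>c m y) \<longlonglongrightarrow> 0"
        unfolding F1 by (rule tendsto_mult_right_zero[OF L0[unfolded Bochner_Integration.integral_zero]])
      have "\<eta>c m \<in> borel_measurable \<nu>" unfolding \<eta>c_def by measurable
      then have "integrable \<nu> (\<eta>c m)"
        by (rule integrable_dominated(1)[OF integrable_mult_right[OF gauss_\<nu>[of "1/2"]] _ bnd, rotated]) simp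
      with lim0 show ?thesis by (simp add: null_against_def)
    qed
  qed measurable
qed

lemma null_against_zero: "null_against (\<lambda>y. 0)"
  by (simp add: null_against_def)

lemma null_against_diff: "null_against g \<Longrightarrow> null_against h \<Longrightarrow> null_against (\<lambda>y. g y - h y)"
  using null_against_add[of g "\<lambda>y. (-1) * h y"] null_against_cmult[of h "-1"] by simp

text \<open>
  Indicators of bounded open sets are increasing limits of truncated multiples of the distance to the
  complement.
\<close>

lemma null_against_open:
  assumes U: "open U" "U \<subseteq> ball 0 r"
  shows "null_against (indicator U)"
proof -
  define \<eta> where "\<eta> = (\<lambda>m y. complex_of_real (min 1 (real m * infdist y (- U))))"
  have r: "indicator U y \<le> exp (\<bar>r\<bar>\<^sup>2) * exp (- (norm y)\<^sup>2)" for y :: 'a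
  proof (cases "y \<in> U")
    case True
    then have "norm y \<le> \<bar>r\<bar>" using U by (force simp: dist_norm)
    then have "(norm y)\<^sup>2 \<le> \<bar>r\<bar>\<^sup>2" by (intro power_mono) auto
    then have "1 \<le> exp (\<bar>r\<bar>\<^sup>2 + - (norm y)\<^sup>2)" by simp
    then show ?thesis using True by (simp only: exp_add indicator_simps)
  qed simp
  have "\<not> U = UNIV"
  proof
    assume "U = UNIV"
    then have "bounded (UNIV :: 'a set)" using U(2) bounded_subset[OF bounded_ball] by metis
    then show False by simp
  qed
  then have ne: "- U \<noteq> {}" by auto
  have cl: "closed (- U)" using U by (simp add: closed_Compl)
  have nonneg: "infdist y (- U) \<ge> 0" for y by (rule infdist_nonneg)
  have norm_\<eta>: "norm (\<eta> m y) \<le> indicator U y" for m y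
  proof (cases "y \<in> U")
    case False
    then have "infdist y (- U) = 0" by simp
    then show ?thesis using False by (simp add: \<eta>_def)
  qed (use nonneg[of y] in \<open>auto simp: \<eta>_def\<close>)
  show ?thesis
  proof (rule null_against_limit[where h = \<eta> and w = "\<lambda>y. exp (\<bar>r\<bar>\<^sup>2) * exp (- (norm y)\<^sup>2)"])
    show "null_against (\<eta> m)" for m
    proof (rule null_against_continuous)
      show "continuous_on UNIV (\<eta> m)" unfolding \<eta>_def by (intro continuous_intros)
      show "norm (\<eta> m x) \<le> exp (\<bar>r\<bar>\<^sup>2) * exp (- (norm x)\<^sup>2)" for x
        using order_trans[OF norm_\<eta> r] .
    qed
    show "(\<lambda>m. \<eta> m y) \<longlonglongrightarrow> indicator U y" for y
    proof (cases "y \<in> U")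
      case True
      then have pos: "infdist y (- U) > 0"
        using in_closed_iff_infdist_zero[OF cl ne, of y] nonneg[of y] by auto
      obtain N where N: "1 / infdist y (- U) < real N" using reals_Archimedean2 by blast
      have "\<forall>\<^sub>F m in sequentially. \<eta> m y = indicator U y"
      proof (rule eventually_sequentiallyI[of N])
        fix m assume "m \<ge> N"
        then have "1 / infdist y (- U) < real m" using N by linarith
        then have "1 \<le> real m * infdist y (- U)" using pos by (simp add: divide_less_eq)
        then show "\<eta> m y = indicator U y" using True by (simp add: \<eta>_def)
      qed
      then show ?thesis by (rule tendsto_eventually)
    next
      case False
      then have "infdist y (- U) = 0" by simp
      then show ?thesis using False by (simp add: \<eta>_def)
    qed
    show "norm (\<eta> m y) \<le> exp (\<bar>r\<bar>\<^sup>2) * exp (- (norm y)\<^sup>2)" for m y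
      using order_trans[OF norm_\<eta> r] .
    show "integrable \<nu> (\<lambda>y. exp (\<bar>r\<bar>\<^sup>2) * exp (- (norm y)\<^sup>2))"
      using gauss_\<nu>[of 1] by (intro integrable_mult_right) simp
    show "indicator U \<in> borel_measurable borel" using U by simp
  qed
qed

text \<open>
  By Dynkin's lemma, as open sets are stable under intersections. The ball keeps the sets within the
  range of \<open>null_against_open\<close>.
\<close>

lemma null_against_borel:
  assumes A: "A \<in> sets borel"
  shows "null_against (indicator (A \<inter> ball 0 r))"
proof -
  have ball: "null_against (indicator (ball 0 r))" by (rule null_against_open) auto
  then have wi: "integrable \<nu> (indicator (ball (0::'a) r) :: 'a \<Rightarrow> complex)" by (simp add: null_against_def)
  have gen: "sets borel = sigma_sets UNIV {S::'a set. open S}" by (rule sets_borel)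
  have stable: "Int_stable {S::'a set. open S}" "{S::'a set. open S} \<subseteq> Pow UNIV" by (auto simp: Int_stable_def)
  have "A \<in> sigma_sets UNIV {S. open S}" using A gen by simp
  with stable show ?thesis
  proof (induction rule: sigma_sets_induct_disjoint)
    case (basic S)
    then show ?case by (intro null_against_open) auto
  next
    case empty
    show ?case using null_against_zero by simp
  next
    case (compl S)
    have "indicator ((UNIV - S) \<inter> ball 0 r) = (\<lambda>y. indicator (ball 0 r) y - indicator (S \<inter> ball 0 r) y :: complex)"
      by (auto simp: indicator_def fun_eq_iff)
    then show ?case using null_against_diff[OF ball compl(2)] by simp
  next
    case (union S)
    have [measurable]: "S i \<in> sets borel" for i using union(2) gen by auto
    have [measurable]: "ball (0::'a) r \<in> sets borel" by simp
    have part: "null_against (\<lambda>y. \<Sum>i<m. indicator (S i \<inter> ball 0 r) y)" for m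
      by (induction m) (auto intro: null_against_zero null_against_add union(3))
    have eq: "(\<Sum>i<m. indicator (S i \<inter> ball 0 r) y :: complex) = indicator ((\<Union>i<m. S i) \<inter> ball 0 r) y" for m y
    proof -
      have "disjoint_family_on (\<lambda>i. S i \<inter> ball 0 r) {..<m}" using union(1) by (auto simp: disjoint_family_on_def)
      then have "indicator (\<Union>i<m. S i \<inter> ball 0 r) y = (\<Sum>i<m. indicator (S i \<inter> ball 0 r) y :: complex)"
        by (intro indicator_UN_disjoint) auto
      then show ?thesis by (simp add: Int_UN_distrib2 flip: UN_simps)
    qed
    show ?case
    proof (rule null_against_limit[OF part, where w = "\<lambda>y. norm (indicator (ball 0 r) y :: complex)"])
      show "integrable \<nu> (\<lambda>y. norm (indicator (ball 0 r) y :: complex))" by (rule integrable_norm[OF wi])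
      show "norm (\<Sum>i<m. indicator (S i \<inter> ball 0 r) y :: complex) \<le> norm (indicator (ball 0 r) y :: complex)" for m y
        unfolding eq by (simp add: indicator_def)
      show "(\<lambda>m. \<Sum>i<m. indicator (S i \<inter> ball 0 r) y :: complex) \<longlonglongrightarrow> indicator (\<Union> (range S) \<inter> ball 0 r) y" for y
        unfolding eq
      proof (cases "y \<in> \<Union> (range S)")
        case True
        then obtain i where "y \<in> S i" by auto
        then have "\<forall>\<^sub>F m in sequentially. indicator ((\<Union>i<m. S i) \<inter> ball 0 r) y = (indicator (\<Union> (range S) \<inter> ball 0 r) y :: complex)"
          by (intro eventually_sequentiallyI[of "Suc i"]) (auto simp: indicator_def)
        then show "(\<lambda>m. indicator ((\<Union>i<m. S i) \<inter> ball 0 r) y :: complex) \<longlonglongrightarrow> indicator (\<Union> (range S) \<inter> ball 0 r) y"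
          by (rule tendsto_eventually)
      next
        case False
        then have "indicator ((\<Union>i<m. S i) \<inter> ball 0 r) y = (indicator (\<Union> (range S) \<inter> ball 0 r) y :: complex)" for m
          by (auto simp: indicator_def)
        then show "(\<lambda>m. indicator ((\<Union>i<m. S i) \<inter> ball 0 r) y :: complex) \<longlonglongrightarrow> indicator (\<Union> (range S) \<inter> ball 0 r) y"
          by simp
      qed
    qed measurable
  qed
qed

theorem null_against_integrable:
  assumes "integrable \<nu> h" shows "null_against h"
  using assms
proof (induction rule: integrable_induct)
  case (base A c)
  have A[measurable]: "A \<in> sets borel" using base(1) sets_\<nu> by simp
  have i: "integrable \<nu> (\<lambda>y. indicator A y *\<^sub>R c)" using base by simp
  have P: "null_against (\<lambda>y. c * indicator (A \<inter> ball 0 (real m)) y)" for m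
    by (rule null_against_cmult[OF null_against_borel[OF A]])
  show ?case
  proof (rule null_against_limit[OF P, where w = "\<lambda>y. norm (indicator A y *\<^sub>R c)"])
    show "(\<lambda>m. c * indicator (A \<inter> ball 0 (real m)) y) \<longlonglongrightarrow> indicator A y *\<^sub>R c" for y
    proof -
      obtain N where N: "norm y < real N" using reals_Archimedean2 by blast
      have "\<forall>\<^sub>F m in sequentially. c * indicator (A \<inter> ball 0 (real m)) y = indicator A y *\<^sub>R c"
        using N by (intro eventually_sequentiallyI[of N]) (auto simp: indicator_def)
      then show ?thesis by (rule tendsto_eventually)
    qed
    show "norm (c * indicator (A \<inter> ball 0 (real m)) y) \<le> norm (indicator A y *\<^sub>R c)" for m y
      by (auto simp: indicator_def)
    show "integrable \<nu> (\<lambda>y. norm (indicator A y *\<^sub>R c))" by (rule integrable_norm[OF i])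
  qed measurable
next
  case (add f g)
  then show ?case by (intro null_against_add)
next
  case (lim f s)
  have sp: "space \<nu> = UNIV" using sets_eq_imp_space_eq[OF sets_\<nu>] by simp
  show ?case
  proof (rule null_against_limit[where h = s and w = "\<lambda>y. 2 * norm (f y)"])
    show "f \<in> borel_measurable borel"
      using borel_measurable_integrable[OF lim(4)] sets_\<nu> by (simp cong: measurable_cong_sets)
    show "integrable \<nu> (\<lambda>y. 2 * norm (f y))" using lim(4) by simp
  qed (use lim sp in auto)
qed

end

lemma fourier_gauss_wave:
  fixes x y :: "'a::euclidean_space"
  assumes c: "c > 0"
  shows "fourier (gauss_wave c x) y = of_real (sqrt (pi / c) ^ DIM('a) * exp (- pi\<^sup>2 * (norm (x - y))\<^sup>2 / c))"
proof -
  have eq: "gauss_wave c x z * unit_char (- (z \<bullet> y)) = gauss_wave c (x - y) z" for z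
  proof -
    have "unit_char (x \<bullet> z) * unit_char (- (z \<bullet> y)) = unit_char ((x - y) \<bullet> z)"
      unfolding unit_char_add[symmetric] by (simp add: inner_diff_left inner_commute[of z y])
    then show ?thesis by (simp only: gauss_wave_def mult.assoc)
  qed
  have "fourier (gauss_wave c x) y = (LINT z|lborel. gauss_wave c (x - y) z)"
    unfolding fourier_lborel[OF borel_measurable_gauss_wave] eq ..
  then show ?thesis unfolding integral_gauss_wave[OF c] .
qed

text \<open>
  Every Gaussian is the Fourier transform of a Schwartz function, so a distributional inverse Fourier
  transform can be tested against it.
\<close>

lemma exp_eq_fourier_gauss_wave:
  fixes x y :: "'a::euclidean_space"
  assumes c: "c > 0"
  shows "complex_of_real (exp (- c * (norm (x - y))\<^sup>2)) = of_real ((sqrt (pi / c)) ^ DIM('a)) * fourier (gauss_wave (pi\<^sup>2 / c) x) y"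
proof -
  have c': "pi\<^sup>2 / c > 0" using c by simp
  have "sqrt (pi / c) * sqrt (pi / (pi\<^sup>2 / c)) = 1"
    using c by (simp add: real_sqrt_mult[symmetric] power2_eq_square)
  then have s: "sqrt (pi / c) ^ DIM('a) * sqrt (pi / (pi\<^sup>2 / c)) ^ DIM('a) = 1"
    by (simp add: power_mult_distrib[symmetric])
  have e: "- pi\<^sup>2 * (norm (x - y))\<^sup>2 / (pi\<^sup>2 / c) = - c * (norm (x - y))\<^sup>2" using c by simp
  show ?thesis unfolding fourier_gauss_wave[OF c'] e
    by (simp only: of_real_mult[symmetric] mult.assoc[symmetric] s mult_1_left)
qed

lemma borel_version:
  fixes f :: "'a::euclidean_space \<Rightarrow> complex"
  assumes f: "f \<in> borel_measurable lebesgue"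
  obtains f' where "f' \<in> borel_measurable borel" "AE x in lborel. f x = f' x"
proof -
  have "(\<lambda>x. Re (f x)) \<in> borel_measurable lebesgue" "(\<lambda>x. Im (f x)) \<in> borel_measurable lebesgue"
    using f by measurable
  then obtain u v where uv: "u \<in> borel_measurable lborel" "AE x in lborel. Re (f x) = u x"
     "v \<in> borel_measurable lborel" "AE x in lborel. Im (f x) = v x"
    using completion_ex_borel_measurable_real by metis
  have [measurable]: "u \<in> borel_measurable borel" "v \<in> borel_measurable borel" using uv by simp_all
  show ?thesis
  proof (rule that[of "\<lambda>x. of_real (u x) + \<i> * of_real (v x)"])
    show "(\<lambda>x. of_real (u x) + \<i> * of_real (v x)) \<in> borel_measurable borel" by measurable
    show "AE x in lborel. f x = of_real (u x) + \<i> * of_real (v x)"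
      using uv(2,4) by eventually_elim (simp add: complex_eq_iff)
  qed
qed

text \<open>
  Take the measure \<open>|d(y)| dy\<close> and the constant sequence \<open>sgn d\<close>. Testing with
  \<open>cnj (sgn d) exp(-|y|^2)\<close>, which is integrable for this measure, gives \<open>\<integral> |d| exp(-|y|^2) = 0\<close>.
\<close>

theorem null_of_gauss_integrals:
  fixes d :: "'a::euclidean_space \<Rightarrow> complex"
  assumes [measurable]: "d \<in> borel_measurable borel"
    and int: "\<And>c. c > 0 \<Longrightarrow> integrable lborel (\<lambda>y. d y * of_real (exp (- c * (norm y)\<^sup>2)))"
    and zero: "\<And>c x. c > 0 \<Longrightarrow> (LINT y|lborel. d y * of_real (exp (- c * (norm (x - y))\<^sup>2))) = 0"
  shows "AE y in lborel. d y = 0"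
proof -
  define \<nu> where "\<nu> = density lborel (\<lambda>y. ennreal (norm (d y)))"
  have sgn_m [measurable]: "(\<lambda>y. sgn (d y)) \<in> borel_measurable borel" unfolding sgn_div_norm by measurable
  have ds: "norm (d y) *\<^sub>R (sgn (d y) * z) = d y * z" for y z
    by (cases "d y = 0") (auto simp: sgn_div_norm)
  interpret gauss_null_family \<nu> "\<lambda>_ y. sgn (d y)" 1
  proof
    show "sets \<nu> = sets borel" by (simp add: \<nu>_def)
    show "\<exists>A. countable A \<and> A \<subseteq> sets \<nu> \<and> \<Union> A = space \<nu> \<and> (\<forall>a\<in>A. emeasure \<nu> a \<noteq> \<infinity>)"
    proof -
      have "sigma_finite_measure (density lborel (\<lambda>y. ennreal (norm (d y))))"
        by (rule sigma_finite_measure.sigma_finite_iff_density_finite[OF sigma_finite_lborel, THEN iffD2]) auto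
      then show ?thesis unfolding \<nu>_def by (rule sigma_finite_measure.sigma_finite_countable)
    qed
    show "integrable \<nu> (\<lambda>y. exp (- c * (norm y)\<^sup>2))" if "c > 0" for c
      unfolding \<nu>_def using integrable_norm[OF int[OF that]]
      by (subst integrable_density) (auto simp: norm_mult)
    show "norm (sgn (d y)) \<le> 1" for y by (simp add: norm_sgn)
    show "(\<lambda>i. LINT y|\<nu>. sgn (d y) * of_real (exp (- c * (norm (x - y))\<^sup>2))) \<longlonglongrightarrow> 0" if "c > 0" for c x
    proof -
      have "(LINT y|\<nu>. sgn (d y) * of_real (exp (- c * (norm (x - y))\<^sup>2))) = (LINT y|lborel. d y * of_real (exp (- c * (norm (x - y))\<^sup>2)))"
        unfolding \<nu>_def by (subst integral_density) (simp_all add: ds)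
      then show ?thesis using zero[OF that] by simp
    qed
  qed measurable
  let ?h = "\<lambda>y. cnj (sgn (d y)) * of_real (exp (- (norm y)\<^sup>2))"
  have g: "integrable \<nu> (\<lambda>y. exp (- (norm y)\<^sup>2))" using gauss_\<nu>[of 1] by simp
  have [measurable]: "cnj \<in> borel_measurable borel" by (intro borel_measurable_continuous_onI continuous_intros)
  have "?h \<in> borel_measurable borel" by measurable
  then have hm: "?h \<in> borel_measurable \<nu>" by (simp add: \<nu>_def)
  have "integrable \<nu> ?h"
    by (rule integrable_dominated(1)[OF g hm]) (simp add: norm_mult norm_sgn)
  from null_against_integrable[OF this] have "(LINT y|\<nu>. sgn (d y) * ?h y) = 0"
    unfolding null_against_def by (simp add: LIMSEQ_const_iff)
  also have "(LINT y|\<nu>. sgn (d y) * ?h y) = (LINT y|lborel. complex_of_real (norm (d y) * exp (- (norm y)\<^sup>2)))"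
  proof -
    have "norm (d y) *\<^sub>R (sgn (d y) * ?h y) = complex_of_real (norm (d y) * exp (- (norm y)\<^sup>2))" for y
    proof (cases "d y = 0")
      case False
      have "sgn (d y) * cnj (sgn (d y)) = 1" using False by (simp add: complex_norm_square[symmetric] norm_sgn)
      then have "sgn (d y) * ?h y = of_real (exp (- (norm y)\<^sup>2))" by (simp only: mult.assoc[symmetric] mult_1_left)
      then show ?thesis by (simp add: scaleR_conv_of_real)
    qed simp
    then show ?thesis unfolding \<nu>_def by (subst integral_density) (simp_all)
  qed
  finally have 0: "(LINT y|lborel. norm (d y) * exp (- (norm y)\<^sup>2)) = 0"
    by (simp only: integral_complex_of_real of_real_eq_0_iff)
  have "integrable lborel (\<lambda>y. norm (d y) * exp (- (norm y)\<^sup>2))"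
    using integrable_norm[OF int[of 1]] by (simp add: norm_mult)
  from integral_nonneg_eq_0_iff_AE[OF this] 0 have "AE y in lborel. norm (d y) * exp (- (norm y)\<^sup>2) = 0" by simp
  then show ?thesis by eventually_elim simp
qed

text \<open>
  Divide the integrable function \<open>k exp(-|x|^2)\<close> by the Gaussian.
\<close>

lemma inverse_fourier_measurable:
  fixes k m :: "'a::euclidean_space \<Rightarrow> complex"
  assumes "is_inverse_fourier k m"
  shows "k \<in> borel_measurable lebesgue"
proof -
  have g0: "gauss_wave 1 (0::'a) \<in> schwartz" by (rule gauss_wave_schwartz) simp
  have "integrable lebesgue (\<lambda>x. k x * gauss_wave 1 0 x)"
    using assms g0 unfolding is_inverse_fourier_def by blast
  then have m1: "(\<lambda>x. k x * gauss_wave 1 0 x) \<in> borel_measurable lebesgue" by (rule borel_measurable_integrable)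
  have m2: "gauss_wave 1 (0::'a) \<in> borel_measurable lebesgue" by (rule measurable_completion) simp
  have "gauss_wave 1 (0::'a) x \<noteq> 0" for x
    using norm_gauss_wave[of 1 "0::'a" x] by (metis exp_not_eq_zero norm_zero)
  then have eq: "k = (\<lambda>x. (k x * gauss_wave 1 0 x) / gauss_wave 1 0 x)" by (auto simp: fun_eq_iff)
  show ?thesis by (subst eq) (intro borel_measurable_divide m1 m2)
qed

lemma gauss_shift_le:
  fixes x y :: "'a::real_normed_vector"
  assumes "c > 0"
  shows "exp (- c * (norm (x - y))\<^sup>2) \<le> exp (c * (norm x)\<^sup>2) * exp (- (c / 2) * (norm y)\<^sup>2)"
proof -
  have "(norm y)\<^sup>2 \<le> 2 * (norm x)\<^sup>2 + 2 * (norm (x - y))\<^sup>2"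
    using norm_sum_squared_le[of x "y - x"] by (simp add: norm_minus_commute)
  then have "c / 2 * (norm y)\<^sup>2 \<le> c / 2 * (2 * (norm x)\<^sup>2 + 2 * (norm (x - y))\<^sup>2)" using assms by (intro mult_left_mono) auto
  then have "- c * (norm (x - y))\<^sup>2 \<le> c * (norm x)\<^sup>2 + (- (c / 2) * (norm y)\<^sup>2)" by (simp add: algebra_simps)
  then show ?thesis unfolding exp_add[symmetric] by (simp only: exp_le_cancel_iff)
qed

lemma inverse_fourier_gauss_integral:
  fixes k m :: "'a::euclidean_space \<Rightarrow> complex"
  assumes k: "is_inverse_fourier k m" and c: "c > 0"
  shows "integrable lebesgue (\<lambda>y. k y * of_real (exp (- c * (norm (x - y))\<^sup>2)))"
    and "(LINT y|lebesgue. k y * of_real (exp (- c * (norm (x - y))\<^sup>2)))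
      = of_real (sqrt (pi / c) ^ DIM('a)) * (LINT y|lebesgue. m y * gauss_wave (pi\<^sup>2 / c) x y)"
proof -
  have g0: "gauss_wave (c / 2) (0::'a) \<in> schwartz" by (rule gauss_wave_schwartz) (use c in simp)
  have i0: "integrable lebesgue (\<lambda>y. k y * gauss_wave (c / 2) 0 y)"
    using k g0 unfolding is_inverse_fourier_def by blast
  show "integrable lebesgue (\<lambda>y. k y * of_real (exp (- c * (norm (x - y))\<^sup>2)))"
  proof (rule integrable_dominated(1)[OF integrable_mult_right[OF integrable_norm[OF i0]]])
    have "(\<lambda>y. complex_of_real (exp (- c * (norm (x - y))\<^sup>2))) \<in> borel_measurable lebesgue"
      by (rule measurable_completion) simp
    then show "(\<lambda>y. k y * of_real (exp (- c * (norm (x - y))\<^sup>2))) \<in> borel_measurable lebesgue"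
      by (intro borel_measurable_times inverse_fourier_measurable[OF k])
    fix y
    have "norm (k y) * exp (- c * (norm (x - y))\<^sup>2) \<le> norm (k y) * (exp (c * (norm x)\<^sup>2) * exp (- (c / 2) * (norm y)\<^sup>2))"
      by (intro mult_left_mono gauss_shift_le c) auto
    then show "norm (k y * of_real (exp (- c * (norm (x - y))\<^sup>2))) \<le> exp (c * (norm x)\<^sup>2) * norm (k y * gauss_wave (c / 2) 0 y)"
      unfolding norm_mult norm_gauss_wave by (simp add: mult_ac)
  qed
  have c': "pi\<^sup>2 / c > 0" using c by simp
  have "fourier_dist (dist_of k) (gauss_wave (pi\<^sup>2 / c) x) = dist_of m (gauss_wave (pi\<^sup>2 / c) x)"
    using k gauss_wave_schwartz[OF c'] unfolding is_inverse_fourier_def by blast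
  then have "(LINT y|lebesgue. k y * fourier (gauss_wave (pi\<^sup>2 / c) x) y) = (LINT y|lebesgue. m y * gauss_wave (pi\<^sup>2 / c) x y)"
    by (simp only: fourier_dist_def dist_of_def)
  then show "(LINT y|lebesgue. k y * of_real (exp (- c * (norm (x - y))\<^sup>2)))
      = of_real (sqrt (pi / c) ^ DIM('a)) * (LINT y|lebesgue. m y * gauss_wave (pi\<^sup>2 / c) x y)"
    by (simp only: exp_eq_fourier_gauss_wave[OF c] mult.left_commute[of "k _" "of_real _"] integral_mult_right_zero)
qed

text \<open>
  Integrals against Gaussians are determined by \<open>m\<close>, so those of the difference vanish.
\<close>

theorem inverse_fourier_unique:
  fixes k k' m :: "'a::euclidean_space \<Rightarrow> complex"
  assumes k: "is_inverse_fourier k m" and k': "is_inverse_fourier k' m"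
  shows "AE x in lborel. k x = k' x"
proof -
  have km: "(\<lambda>x. k x - k' x) \<in> borel_measurable lebesgue"
    using inverse_fourier_measurable[OF k] inverse_fourier_measurable[OF k'] by (rule borel_measurable_diff)
  obtain d where d[measurable]: "d \<in> borel_measurable borel" and dk: "AE x in lborel. k x - k' x = d x"
    using borel_version[OF km] by blast
  have dk': "AE x in lebesgue. k x - k' x = d x" using dk by (rule AE_completion)
  have diff: "integrable lborel (\<lambda>y. d y * of_real (exp (- c * (norm (x - y))\<^sup>2))) \<and>
     (LINT y|lborel. d y * of_real (exp (- c * (norm (x - y))\<^sup>2))) = 0" if c: "c > 0" for c x
  proof -
    let ?e = "\<lambda>y. complex_of_real (exp (- c * (norm (x - y))\<^sup>2))"
    note i = inverse_fourier_gauss_integral(1)[OF k c, of x] inverse_fourier_gauss_integral(1)[OF k' c, of x]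
    have dmm: "(\<lambda>y. d y * ?e y) \<in> borel_measurable lebesgue" by (rule measurable_completion) simp
    have ae: "AE y in lebesgue. k y * ?e y - k' y * ?e y = d y * ?e y"
      using dk' by eventually_elim (simp add: left_diff_distrib[symmetric])
    have di: "integrable lebesgue (\<lambda>y. d y * ?e y)"
      using integrable_cong_AE_imp[OF Bochner_Integration.integrable_diff[OF i] dmm ae] .
    have "(LINT y|lebesgue. d y * ?e y) = (LINT y|lebesgue. k y * ?e y - k' y * ?e y)"
      using ae by (intro integral_cong_AE dmm borel_measurable_integrable[OF Bochner_Integration.integrable_diff[OF i]])
        (auto elim: eventually_mono)
    also have "\<dots> = 0"
      unfolding Bochner_Integration.integral_diff[OF i] inverse_fourier_gauss_integral(2)[OF k c] inverse_fourier_gauss_integral(2)[OF k' c] by simp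
    finally show ?thesis using di by (simp add: integrable_completion integral_completion)
  qed
  have "AE y in lborel. d y = 0"
  proof (rule null_of_gauss_integrals[OF d])
    show "integrable lborel (\<lambda>y. d y * of_real (exp (- c * (norm y)\<^sup>2)))" if "c > 0" for c
      using diff[OF that, of 0] by (simp add: norm_minus_cancel)
  qed (use diff in blast)
  with dk show ?thesis by eventually_elim simp
qed

section \<open>The kernel of the error symbol\<close>

lemma is_inverse_fourier_cong_AE:
  fixes k m m' :: "'a::euclidean_space \<Rightarrow> complex"
  assumes km: "is_inverse_fourier k m" and eq: "AE x in lborel. m x = m' x" and m': "m' \<in> borel_measurable borel"
  shows "is_inverse_fourier k m'"
proof -
  have i: "integrable lebesgue (\<lambda>x. m' x * \<phi> x)" and e: "dist_of m \<phi> = dist_of m' \<phi>" if \<phi>: "\<phi> \<in> schwartz" for \<phi>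
  proof -
    have mi: "integrable lebesgue (\<lambda>x. m x * \<phi> x)" using km \<phi> unfolding is_inverse_fourier_def by blast
    have "(\<lambda>x. m' x * \<phi> x) \<in> borel_measurable borel" by (intro borel_measurable_times m' schwartz_measurable[OF \<phi>])
    then have mm: "(\<lambda>x. m' x * \<phi> x) \<in> borel_measurable lebesgue" by (intro measurable_completion) simp
    have ae: "AE x in lebesgue. m x * \<phi> x = m' x * \<phi> x"
      using AE_completion[OF eq] by eventually_elim simp
    show "integrable lebesgue (\<lambda>x. m' x * \<phi> x)" by (rule integrable_cong_AE_imp[OF mi mm ae])
    show "dist_of m \<phi> = dist_of m' \<phi>" unfolding dist_of_def
      by (rule integral_cong_AE[OF borel_measurable_integrable[OF mi] mm ae])
  qed
  show ?thesis using km i e unfolding is_inverse_fourier_def by metis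
qed

lemma br_error_symbol_measurable [measurable]: "br_error_symbol \<delta> \<gamma> lam \<in> borel_measurable borel"
  unfolding br_error_symbol_def br_multiplier_def by measurable

text \<open>
  The kernel is assembled from \<open>symbol_subordination\<close>: the terms with \<open>(1 - s)_+^(\<delta> + j)\<close> contribute
  kernels that decay at least like \<open>|y|^(-a)\<close>, the slowest being \<open>j = 0\<close>, and the superposition
  converges with the same decay. The last conclusion transfers the bound to the kernel chosen in the
  definition of the error.
\<close>

theorem br_error_kernel_bound:
  fixes \<delta> \<gamma> lam :: real
  defines "a \<equiv> (real DIM('a::euclidean_space) + 1) / 2 + \<delta>"
  assumes \<gamma>: "\<gamma> > 0" and \<delta>: "0 < \<delta>" "\<delta> < (real DIM('a) - 1) / 2"
    and lam: "(real DIM('a) - 1) / 2 - \<delta> < lam" "lam \<le> \<gamma>"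
  obtains k :: "'a::euclidean_space \<Rightarrow> complex" and C :: real where
    "k \<in> borel_measurable borel" "is_inverse_fourier k (br_error_symbol \<delta> \<gamma> lam)"
    "\<And>y. y \<noteq> 0 \<Longrightarrow> norm (k y) \<le> C * norm y powr (- a)"
    "AE y in lborel. br_error_kernel \<delta> \<gamma> lam y = k y"
proof -
  have a: "0 < a" "a < real DIM('a)" using \<delta> by (auto simp: a_def field_simps)
  have lam0: "lam > 0" using lam \<delta> by linarith
  \<comment> \<open>The weight of the superposition behaves like \<open>u^(\<theta> - 1)\<close> at the origin and like
    \<open>u^(\<theta> - lam/2 - 1)\<close> at infinity, so \<open>0 < \<theta> < lam / 2\<close> is what convergence asks for.\<close>
  define \<theta> where "\<theta> = (real DIM('a) - a) / 2"
  have \<theta>: "0 < \<theta>" "\<theta> < lam / 2" using a lam by (auto simp: \<theta>_def a_def field_simps)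
  \<comment> \<open>Large enough for \<open>N = J - 1 \<ge> \<delta>\<close>: then the kernels in the superposition decay at least like
    \<open>|y|^(-a)\<close>.\<close>
  define J where "J = nat \<lceil>\<delta>\<rceil> + 2"
  have J: "J > 0" by (simp add: J_def)
  define N where "N = real (J - 1)"
  have N: "N \<ge> \<delta>" "N > 0"
    unfolding N_def J_def using real_nat_ceiling_ge[of \<delta>] by simp_all
  have NJ: "N = real J - 1" by (simp add: N_def J_def)
  obtain c :: "nat \<Rightarrow> complex" and \<Phi> :: "real \<Rightarrow> complex" and C :: real where \<Phi>: "\<Phi> \<in> borel_measurable borel" "C \<ge> 0"
    "\<And>u. 0 < u \<Longrightarrow> u < 1 \<Longrightarrow> norm (\<Phi> u) \<le> C * u powr (- real J)"
    "\<And>u. 1 \<le> u \<Longrightarrow> norm (\<Phi> u) \<le> C * u powr (- lam / 2 - real J)"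
    and rep: "\<And>s. s > 0 \<Longrightarrow> of_real (s powr (- lam / 2) * ((max 0 (1 - s powr (\<gamma> / 2))) powr \<delta> - 1))
       = (\<Sum>j<J. c j * of_real ((max 0 (1 - s)) powr (\<delta> + real j)))
         + (LINT u:{s<..}|lborel. (u - s) ^ (J - 1) *\<^sub>R \<Phi> u)"
    by (rule symbol_subordination[OF \<delta>(1) \<gamma> lam0 lam(2) J]) (rule that)
  note [measurable] = \<Phi>(1)
  have W: "integrable lborel (\<lambda>u. indicator {0<..} u * (norm (\<Phi> u) * u powr (N + \<theta>)))"
  proof (rule Bochner_Integration.integrable_bound)
    have "set_integrable lborel {0<..1} (\<lambda>u. u powr (\<theta> - 1))" by (rule set_integrable_powr_0) (use \<theta> in auto)
    moreover have "set_integrable lborel {1..} (\<lambda>u. u powr (\<theta> - lam / 2 - 1))" by (rule set_integrable_powr_inf) (use \<theta> in auto)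
    ultimately show "integrable lborel (\<lambda>u. C * (indicator {0<..1} u *\<^sub>R u powr (\<theta> - 1) + indicator {1..} u *\<^sub>R u powr (\<theta> - lam / 2 - 1)))"
      unfolding set_integrable_def by (intro integrable_mult_right Bochner_Integration.integrable_add)
    show "AE u in lborel. norm (indicator {0<..} u * (norm (\<Phi> u) * u powr (N + \<theta>)))
       \<le> norm (C * (indicator {0<..1} u *\<^sub>R u powr (\<theta> - 1) + indicator {1..} u *\<^sub>R u powr (\<theta> - lam / 2 - 1)))"
    proof (rule AE_I2)
      fix u :: real
      let ?R = "C * (indicator {0<..1} u *\<^sub>R u powr (\<theta> - 1) + indicator {1..} u *\<^sub>R u powr (\<theta> - lam / 2 - 1))"
      have R0: "?R \<ge> 0" using \<Phi>(2) by simp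
      consider "u \<le> 0" | "0 < u" "u < 1" | "1 \<le> u" by linarith
      then have "indicator {0<..} u * (norm (\<Phi> u) * u powr (N + \<theta>)) \<le> ?R"
      proof cases
        case 2
        have "norm (\<Phi> u) * u powr (N + \<theta>) \<le> (C * u powr (- real J)) * u powr (N + \<theta>)"
          using \<Phi>(3)[OF 2] by (intro mult_right_mono) auto
        also have "\<dots> = C * u powr (\<theta> - 1)"
        proof -
          have "- real J + (N + \<theta>) = \<theta> - 1" by (simp add: NJ)
          then show ?thesis by (simp only: mult.assoc powr_add[symmetric])
        qed
        finally show ?thesis using 2 by simp
      next
        case 3
        have "norm (\<Phi> u) * u powr (N + \<theta>) \<le> (C * u powr (- lam / 2 - real J)) * u powr (N + \<theta>)"
          using \<Phi>(4)[OF 3] by (intro mult_right_mono) auto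
        also have "\<dots> = C * u powr (\<theta> - lam / 2 - 1)"
        proof -
          have "(- lam / 2 - real J) + (N + \<theta>) = \<theta> - lam / 2 - 1" by (simp add: NJ)
          then show ?thesis by (simp only: mult.assoc powr_add[symmetric])
        qed
        also have "\<dots> \<le> ?R" using \<Phi>(2) 3 by (intro mult_left_mono) (auto simp: indicator_def)
        finally show ?thesis using 3 by simp
      qed (use R0 in simp)
      moreover have "0 \<le> indicator {0<..} u * (norm (\<Phi> u) * u powr (N + \<theta>))" by simp
      ultimately show "norm (indicator {0<..} u * (norm (\<Phi> u) * u powr (N + \<theta>))) \<le> norm ?R"
        unfolding real_norm_def by linarith
    qed
  qed measurable
  define k where "k = (\<lambda>y::'a. (\<Sum>j<J. c j * br_kernel (\<delta> + real j) y) + (LINT u|lborel. indicator {0<..} u *\<^sub>R (\<Phi> u * (of_real (u powr (N + real DIM('a) / 2)) * br_kernel N (sqrt u *\<^sub>R y)))))"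
  define m where "m = (\<lambda>x::'a. (\<Sum>j<J. c j * of_real (br_bump (\<delta> + real j) x)) + (LINT u|lborel. indicator {0<..} u *\<^sub>R (\<Phi> u * of_real (br_cap N u x))))"
  have km: "kernel_pair a k m"
    unfolding k_def m_def
  proof (rule kernel_pair_add[OF a])
    show "kernel_pair a (\<lambda>y::'a. \<Sum>j<J. c j * br_kernel (\<delta> + real j) y) (\<lambda>x. \<Sum>j<J. c j * of_real (br_bump (\<delta> + real j) x))"
      using \<delta> a by (intro kernel_pair_sum a kernel_pair_br_kernel) (auto simp: a_def)
    show "kernel_pair a (\<lambda>y::'a. LINT u|lborel. indicator {0<..} u *\<^sub>R (\<Phi> u * (of_real (u powr (N + real DIM('a) / 2)) * br_kernel N (sqrt u *\<^sub>R y))))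
       (\<lambda>x. LINT u|lborel. indicator {0<..} u *\<^sub>R (\<Phi> u * of_real (br_cap N u x)))"
      using N by (intro kernel_pair_superposition[OF a N(2) _ \<theta>_def \<Phi>(1) W]) (simp add: a_def)
  qed
  have m_eq: "m x = br_error_symbol \<delta> \<gamma> lam x" if x: "x \<noteq> 0" for x
  proof -
    define s where "s = (norm x)\<^sup>2"
    have s: "s > 0" using x by (simp add: s_def)
    have s2: "s = norm x powr 2" using x by (simp add: s_def powr_numeral)
    have p1: "s powr (\<gamma> / 2) = norm x powr \<gamma>" unfolding s2 powr_powr by simp
    have p2: "s powr (- lam / 2) = norm x powr (- lam)" unfolding s2 powr_powr by simp
    have I: "(LINT u:{s<..}|lborel. (u - s) ^ (J - 1) *\<^sub>R \<Phi> u) = (LINT u|lborel. indicator {0<..} u *\<^sub>R (\<Phi> u * of_real (br_cap N u x)))"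
      unfolding set_lebesgue_integral_def
    proof (rule Bochner_Integration.integral_cong)
      fix u :: real
      show "indicator {s<..} u *\<^sub>R ((u - s) ^ (J - 1) *\<^sub>R \<Phi> u) = indicator {0<..} u *\<^sub>R (\<Phi> u * of_real (br_cap N u x))"
      proof (cases "s < u")
        case True
        have "br_cap N u x = (u - s) powr real (J - 1)" using True by (simp add: br_cap_def s_def N_def max_def)
        also have "\<dots> = (u - s) ^ (J - 1)" using True by (intro powr_realpow) simp
        finally show ?thesis using True s by (simp add: scaleR_conv_of_real mult.commute)
      qed (simp add: br_cap_def s_def)
    qed simp
    have b: "br_bump (\<delta> + real j) x = (max 0 (1 - s)) powr (\<delta> + real j)" for j by (simp add: br_bump_def s_def)
    have "m x = of_real (s powr (- lam / 2) * ((max 0 (1 - s powr (\<gamma> / 2))) powr \<delta> - 1))"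
      unfolding m_def rep[OF s] I b ..
    also have "\<dots> = br_error_symbol \<delta> \<gamma> lam x"
      unfolding p1 p2 br_error_symbol_def br_multiplier_def by (simp add: powr_minus divide_inverse mult.commute)
    finally show ?thesis .
  qed
  have inv: "is_inverse_fourier k (br_error_symbol \<delta> \<gamma> lam)"
  proof (rule is_inverse_fourier_cong_AE[OF kernel_pair_imp_inverse_fourier[OF a km]])
    show "AE x in lborel. m x = br_error_symbol \<delta> \<gamma> lam x" using AE_lborel_nonzero by eventually_elim (rule m_eq)
  qed measurable
  have inv': "is_inverse_fourier (br_error_kernel \<delta> \<gamma> lam :: 'a \<Rightarrow> complex) (br_error_symbol \<delta> \<gamma> lam)"
    unfolding br_error_kernel_def by (rule someI[of _ k]) (rule inv)
  obtain C' where "\<And>y. y \<noteq> 0 \<Longrightarrow> norm (k y) \<le> C' * norm y powr (- a)" using km unfolding kernel_pair_def by blast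
  moreover have "k \<in> borel_measurable borel" using km unfolding kernel_pair_def by blast
  ultimately show ?thesis using inv inverse_fourier_unique[OF inv' inv] by (intro that[of k C'])
qed

text \<open>
  Bernoulli's inequality gives \<open>|(1 - w)^\<delta> - 1| \<le> K w\<close>, and \<open>lam \<le> \<gamma>\<close> makes the quotient bounded at
  the origin.
\<close>

lemma br_error_symbol_bounded:
  fixes \<delta> \<gamma> lam :: real
  assumes "\<gamma> > 0" "\<delta> > 0" "lam > 0" "lam \<le> \<gamma>"
  obtains D where "\<And>x::'a::euclidean_space. norm (br_error_symbol \<delta> \<gamma> lam x) \<le> D"
proof -
  define K where "K = nat \<lceil>\<delta>\<rceil>"
  have K: "\<delta> \<le> real K" "1 \<le> real K" using assms real_nat_ceiling_ge[of \<delta>] by (auto simp: K_def)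
  have bern: "\<bar>(max 0 (1 - w)) powr \<delta> - 1\<bar> \<le> min 1 (real K * w)" if w: "w \<ge> 0" for w :: real
  proof (cases "w < 1")
    case True
    have le1: "(1 - w) powr \<delta> \<le> 1" using True w assms by (intro powr_le1) auto
    have "1 - real K * w \<le> (1 - w) ^ K" using Bernoulli_inequality[of "- w" K] True by simp
    also have "\<dots> = (1 - w) powr real K" using True by (simp add: powr_realpow)
    also have "\<dots> \<le> (1 - w) powr \<delta>" using True w K by (intro powr_mono') auto
    finally show ?thesis using True le1 w by (auto simp: max_def)
  next
    case False
    then have "1 * 1 \<le> real K * w" using K w by (intro mult_mono) auto
    then show ?thesis using False by (auto simp: max_def)
  qed
  show ?thesis
  proof (rule that[of "real K"])
    fix x :: 'a
    show "norm (br_error_symbol \<delta> \<gamma> lam x) \<le> real K"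
    proof (cases "x = 0")
      case False
      then have x: "norm x > 0" by simp
      have eq: "norm (br_error_symbol \<delta> \<gamma> lam x) = \<bar>(max 0 (1 - norm x powr \<gamma>)) powr \<delta> - 1\<bar> / norm x powr lam"
        unfolding br_error_symbol_def norm_of_real br_multiplier_def by (simp add: abs_divide)
      show ?thesis
      proof (cases "norm x \<le> 1")
        case True
        have "\<bar>(max 0 (1 - norm x powr \<gamma>)) powr \<delta> - 1\<bar> \<le> real K * norm x powr \<gamma>" using bern[of "norm x powr \<gamma>"] by simp
        also have "\<dots> \<le> real K * norm x powr lam" using True x assms by (intro mult_left_mono powr_mono') auto
        finally show ?thesis unfolding eq using x by (simp add: divide_le_eq)
      next
        case False
        have "\<bar>(max 0 (1 - norm x powr \<gamma>)) powr \<delta> - 1\<bar> \<le> 1" using bern[of "norm x powr \<gamma>"] by simp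
        also have "1 \<le> norm x powr lam" using False assms by (intro ge_one_powr_ge_zero) auto
        finally have "norm (br_error_symbol \<delta> \<gamma> lam x) \<le> 1" unfolding eq using x by (simp add: divide_le_eq)
        then show ?thesis using K by simp
      qed
    qed (simp add: br_error_symbol_def)
  qed
qed

section \<open>Convergence almost everywhere\<close>

text \<open>
  Near the origin \<open>|y|^(-a)\<close> is integrable, so its convolution with \<open>|g|^p\<close> is finite almost
  everywhere. At infinity Young's inequality bounds the product by \<open>|y|^(-a q) + |g|^p\<close> with the dual
  exponent \<open>q\<close>, and the bound on \<open>p\<close> says precisely that \<open>a q > n\<close>.
\<close>

lemma weighted_Lp_integrable:
  fixes g :: "'a::euclidean_space \<Rightarrow> complex"
  assumes a: "0 < a" "a < real DIM('a)" and p: "1 \<le> p" "p * (real DIM('a) - a) < real DIM('a)"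
    and [measurable]: "g \<in> borel_measurable borel" and gp: "integrable lborel (\<lambda>x. norm (g x) powr p)"
  shows "AE x in lborel. integrable lborel (\<lambda>y. of_real (norm y powr (- a)) * g (x - y))"
proof -
  define u where "u = (\<lambda>y::'a. norm y powr (- a) * indicator (ball 0 1) y)"
  have u: "integrable lborel u" unfolding u_def by (rule integrable_norm_powr_near[OF a])
  have [measurable]: "u \<in> borel_measurable borel" using u by simp
  have transl: "integrable lborel (\<lambda>y. norm (g (x - y)) powr p)" "(LINT y|lborel. norm (g (x - y)) powr p) = (LINT y|lborel. norm (g y) powr p)" for x
    using integral_lborel_affine[of "\<lambda>y. norm (g y) powr p" "-1" x] gp by simp_all
  have transl': "(LINT x|lborel. norm (g (x - y)) powr p) = (LINT y|lborel. norm (g y) powr p)" "integrable lborel (\<lambda>x. norm (g (x - y)) powr p)" for y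
    using integral_lborel_affine[of "\<lambda>y. norm (g y) powr p" "1" "- y"] gp by simp_all
  have conv: "AE x in lborel. integrable lborel (\<lambda>y. u y * norm (g (x - y)) powr p)"
  proof (rule Fubini_finite(5)[where f = "\<lambda>y x. u y * norm (g (x - y)) powr p", OF sigma_finite_lborel sigma_finite_lborel])
    have u0: "u y \<ge> 0" for y by (simp add: u_def)
    have "(\<integral>\<^sup>+y. \<integral>\<^sup>+x. ennreal (norm (u y * norm (g (x - y)) powr p)) \<partial>lborel \<partial>lborel)
      = (\<integral>\<^sup>+y. \<integral>\<^sup>+x. ennreal (u y) * ennreal (norm (g (x - y)) powr p) \<partial>lborel \<partial>lborel)"
      by (intro nn_integral_cong) (simp add: ennreal_mult[symmetric] u0)
    also have "\<dots> = (\<integral>\<^sup>+y. ennreal (u y) * (\<integral>\<^sup>+x. ennreal (norm (g (x - y)) powr p) \<partial>lborel) \<partial>lborel)"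
      by (intro nn_integral_cong nn_integral_cmult) measurable
    also have "\<dots> = (\<integral>\<^sup>+y. ennreal (u y) * ennreal (LINT y|lborel. norm (g y) powr p) \<partial>lborel)"
      using transl' by (intro nn_integral_cong) (simp add: nn_integral_eq_integral)
    also have "\<dots> = (\<integral>\<^sup>+y. ennreal (u y) \<partial>lborel) * ennreal (LINT y|lborel. norm (g y) powr p)"
      by (rule nn_integral_multc) measurable
    also have "\<dots> = ennreal (integral\<^sup>L lborel u) * ennreal (LINT y|lborel. norm (g y) powr p)"
      using u u0 by (simp add: nn_integral_eq_integral)
    also have "\<dots> < \<infinity>" by (simp add: ennreal_mult_less_top)
    finally show "(\<integral>\<^sup>+y. \<integral>\<^sup>+x. ennreal (norm (u y * norm (g (x - y)) powr p)) \<partial>lborel \<partial>lborel) < \<infinity>" .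
  qed measurable
  \<comment> \<open>For \<open>p = 1\<close> the weight is simply bounded at infinity; otherwise \<open>F\<close> is the term from Young's
    inequality.\<close>
  obtain F :: "'a \<Rightarrow> real" where F: "integrable lborel F" "\<And>y. F y \<ge> 0" 
    "\<And>y t. norm y \<ge> 1 \<Longrightarrow> t \<ge> 0 \<Longrightarrow> norm y powr (- a) * t \<le> F y + t powr p"
  proof (cases "p = 1")
    case True
    show ?thesis
    proof (rule that[of "\<lambda>_. 0"])
      fix y :: 'a and t :: real assume y: "norm y \<ge> 1" "t \<ge> 0"
      have "norm y powr (- a) \<le> 1" using y a powr_mono2'[of "- a" 1 "norm y"] by simp
      then have "norm y powr (- a) * t \<le> 1 * t" using y by (intro mult_right_mono) auto
      then show "norm y powr (- a) * t \<le> 0 + t powr p" using True y by simp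
    qed auto
  next
    case False
    define q where "q = p / (p - 1)"
    have p1: "p > 1" using p False by simp
    have q: "q > 1" "1 / q + 1 / p = 1" using p1 by (auto simp: q_def field_simps)
    have aq: "a * q > real DIM('a)" using p(2) p1 by (simp add: q_def pos_less_divide_eq algebra_simps)
    show ?thesis
    proof (rule that[of "\<lambda>y. norm y powr (- (a * q)) * indicator (- ball 0 1) y"])
      show "integrable lborel (\<lambda>y::'a. norm y powr (- (a * q)) * indicator (- ball 0 1) y)"
        by (rule integrable_norm_powr_far[OF aq])
      fix y :: 'a and t :: real assume y: "norm y \<ge> 1" "t \<ge> 0"
      have "norm y powr (- a) * t \<le> (norm y powr (- a)) powr q / q + t powr p / p"
        by (rule Youngs_inequality[OF q(1) p1 q(2)]) (use y in auto)
      also have "\<dots> \<le> (norm y powr (- a)) powr q / 1 + t powr p / 1"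
        using q p1 by (intro add_mono divide_left_mono) auto
      finally show "norm y powr (- a) * t \<le> norm y powr (- (a * q)) * indicator (- ball 0 1) y + t powr p"
        using y by (simp add: powr_powr)
    qed auto
  qed
  show ?thesis using conv
  proof eventually_elim
    case (elim x)
    have W: "integrable lborel (\<lambda>y. u y + u y * norm (g (x - y)) powr p + F y + norm (g (x - y)) powr p)"
      by (intro Bochner_Integration.integrable_add u elim F transl)
    show ?case
    proof (rule integrable_dominated(1)[OF W])
      fix y :: 'a
      have nn: "u y \<ge> 0" "u y * norm (g (x - y)) powr p \<ge> 0" "F y \<ge> 0" "norm (g (x - y)) powr p \<ge> 0" by (auto simp: u_def F)
      have "norm y powr (- a) * norm (g (x - y)) \<le> u y + u y * norm (g (x - y)) powr p + F y + norm (g (x - y)) powr p"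
      proof (cases "norm y < 1")
        case True
        have "norm (g (x - y)) \<le> 1 + norm (g (x - y)) powr p"
        proof (cases "norm (g (x - y)) \<le> 1")
          case False
          then have "norm (g (x - y)) powr 1 \<le> norm (g (x - y)) powr p" using p by (intro powr_mono) auto
          then show ?thesis using False by simp
        qed (simp add: add_increasing2)
        then have "norm y powr (- a) * norm (g (x - y)) \<le> norm y powr (- a) * (1 + norm (g (x - y)) powr p)" by (intro mult_left_mono) auto
        also have "\<dots> = u y + u y * norm (g (x - y)) powr p" using True by (simp add: u_def distrib_left)
        finally show ?thesis using nn by linarith
      next
        case False
        then have "norm y powr (- a) * norm (g (x - y)) \<le> F y + norm (g (x - y)) powr p" by (intro F(3)) auto
        then show ?thesis using nn by linarith
      qed
      then show "norm (of_real (norm y powr (- a)) * g (x - y)) \<le> u y + u y * norm (g (x - y)) powr p + F y + norm (g (x - y)) powr p"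
        by (simp add: norm_mult)
    qed measurable
  qed
qed

text \<open>
  Completeness of Lebesgue measure, for functions that are not known to be Borel measurable.
\<close>

lemma measurable_lebesgue_AE:
  fixes f :: "'a::euclidean_space \<Rightarrow> complex"
  assumes f'[measurable]: "f' \<in> borel_measurable borel" and eq: "AE x in lborel. f x = f' x"
  shows "f \<in> borel_measurable lebesgue"
proof (rule measurableI)
  fix A :: "complex set" assume A[measurable]: "A \<in> sets borel"
  have 1: "Measurable.pred lebesgue (\<lambda>x. f' x \<in> A)"
    by (rule measurable_completion) simp
  have 2: "Measurable.pred lebesgue (\<lambda>x. (f x \<in> A) \<noteq> (f' x \<in> A))"
    by (rule sets_completion_AE) (use eq in \<open>auto elim: eventually_mono\<close>)
  have "Measurable.pred lebesgue (\<lambda>x. (f' x \<in> A) \<noteq> ((f x \<in> A) \<noteq> (f' x \<in> A)))"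
    using 1 2 by measurable
  then have "Measurable.pred lebesgue (\<lambda>x. f x \<in> A)" by (rule measurable_cong[THEN iffD1, rotated]) auto
  then show "f -` A \<inter> space lebesgue \<in> sets lebesgue" by (simp add: pred_def vimage_def)
qed simp

text \<open>
  The functions \<open>Q_R(y) = (R |y|)^a k(R y)\<close> are bounded by \<open>C\<close>, so with the measure \<open>|y|^(-a) dy\<close> it
  suffices to test them on Gaussians. For these, rescaling and passing to the frequency side gives an
  average of the bounded symbol against a Gaussian of total mass one, whatever \<open>R\<close> is; what remains is
  \<open>R^a\<close> from the normalization and \<open>R^(-n)\<close> from the rescaling.
\<close>

theorem dilated_kernel_limit:
  fixes k m g :: "'a::euclidean_space \<Rightarrow> complex"
  assumes a: "0 < a" "a < real DIM('a)" and k[measurable]: "k \<in> borel_measurable borel"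
    and kC: "\<And>y. y \<noteq> 0 \<Longrightarrow> norm (k y) \<le> C * norm y powr (- a)"
    and km: "is_inverse_fourier k m" and mD: "\<And>x. norm (m x) \<le> D"
    and g[measurable]: "g \<in> borel_measurable borel"
    and int: "integrable lborel (\<lambda>y. of_real (norm y powr (- a)) * g y)"
  shows "((\<lambda>R. of_real (R powr a) * (LINT y|lborel. k (R *\<^sub>R y) * g y)) \<longlongrightarrow> 0) at_top"
proof (rule tendsto_at_topI_sequentially)
  fix X :: "nat \<Rightarrow> real" assume X: "filterlim X at_top sequentially"
  \<comment> \<open>The maximum makes all dilations positive and changes only finitely many terms.\<close>
  define R where "R = (\<lambda>i. max 1 (X i))"
  have R: "R i \<ge> 1" "R i > 0" for i by (auto simp: R_def)
  have Rlim: "filterlim R at_top sequentially"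
    unfolding R_def by (rule filterlim_at_top_mono[OF X]) auto
  define Q where "Q = (\<lambda>i y. of_real ((R i * norm y) powr a) * k (R i *\<^sub>R y))"
  define \<nu> where "\<nu> = density lborel (\<lambda>y::'a. ennreal (norm y powr (- a)))"
  have C0: "C \<ge> 0"
  proof -
    obtain b :: 'a where "b \<in> Basis" using nonempty_Basis by blast
    then have "b \<noteq> 0" "norm b = 1" by auto
    then show ?thesis using kC[of b] order_trans[OF norm_ge_zero] by simp
  qed
  have Qint: "integral\<^sup>L \<nu> (\<lambda>y. Q i y * h y) = of_real (R i powr a) * (LINT y|lborel. k (R i *\<^sub>R y) * h y)"
    if [measurable]: "h \<in> borel_measurable borel" for h i
  proof -
    have [measurable]: "Q i \<in> borel_measurable borel" unfolding Q_def by measurable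
    have "integral\<^sup>L \<nu> (\<lambda>y. Q i y * h y) = (LINT y|lborel. norm y powr (- a) *\<^sub>R (Q i y * h y))"
      unfolding \<nu>_def by (subst integral_density) auto
    also have "\<dots> = (LINT y|lborel. of_real (R i powr a) * (k (R i *\<^sub>R y) * h y))"
    proof (rule integral_cong_AE)
      show "AE y in lborel. norm y powr (- a) *\<^sub>R (Q i y * h y) = of_real (R i powr a) * (k (R i *\<^sub>R y) * h y)"
        using AE_lborel_nonzero
      proof eventually_elim
        case (elim y)
        have "norm y powr (- a) * (R i * norm y) powr a = R i powr a"
          using elim R(2)[of i] by (simp add: powr_mult powr_minus)
        then have "norm y powr (- a) *\<^sub>R (Q i y * h y) = of_real (R i powr a) * (k (R i *\<^sub>R y) * h y)"
          unfolding Q_def scaleR_conv_of_real by (metis mult.assoc of_real_mult)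
        then show ?case .
      qed
    qed measurable
    finally show ?thesis by simp
  qed
  interpret gauss_null_family \<nu> Q C
  proof
    show "sets \<nu> = sets borel" by (simp add: \<nu>_def)
    show "\<exists>A. countable A \<and> A \<subseteq> sets \<nu> \<and> \<Union> A = space \<nu> \<and> (\<forall>a\<in>A. emeasure \<nu> a \<noteq> \<infinity>)"
    proof -
      have "sigma_finite_measure \<nu>" unfolding \<nu>_def
        by (rule sigma_finite_measure.sigma_finite_iff_density_finite[OF sigma_finite_lborel, THEN iffD2]) auto
      then show ?thesis by (rule sigma_finite_measure.sigma_finite_countable)
    qed
    show "integrable \<nu> (\<lambda>y. exp (- c * (norm y)\<^sup>2))" if c: "c > 0" for c
    proof -
      obtain B where "\<And>x. norm (gauss_wave c (0::'a) x) * (1 + norm x) ^ Suc DIM('a) \<le> B"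
        using schwartz_bound[OF gauss_wave_schwartz[OF c]] by blast
      from integrable_power_decay[OF a borel_measurable_gauss_wave this]
      show ?thesis unfolding \<nu>_def norm_gauss_wave by (subst integrable_density) auto
    qed
    show "Q i \<in> borel_measurable borel" for i unfolding Q_def by measurable
    show "norm (Q i y) \<le> C" for i y
    proof (cases "y = 0")
      case False
      then have ne: "R i *\<^sub>R y \<noteq> 0" using R(2)[of i] by simp
      have "norm (Q i y) = (R i * norm y) powr a * norm (k (R i *\<^sub>R y))" unfolding Q_def by (simp add: norm_mult)
      also have "\<dots> \<le> (R i * norm y) powr a * (C * norm (R i *\<^sub>R y) powr (- a))" by (intro mult_left_mono kC ne) auto
      also have "\<dots> = C" using False R(2)[of i] by (simp add: powr_minus field_simps)
      finally show ?thesis .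
    qed (use C0 a in \<open>simp add: Q_def\<close>)
    show "(\<lambda>i. LINT y|\<nu>. Q i y * of_real (exp (- c * (norm (x - y))\<^sup>2))) \<longlonglongrightarrow> 0" if c: "c > 0" for c x
    proof (rule Lim_null_comparison)
      show "(\<lambda>i. D * R i powr (a - real DIM('a))) \<longlonglongrightarrow> 0"
      proof (rule tendsto_mult_right_zero)
        show "(\<lambda>i. R i powr (a - real DIM('a))) \<longlonglongrightarrow> 0"
          by (rule tendsto_neg_powr[OF _ Rlim]) (use a in simp)
      qed
      show "\<forall>\<^sub>F i in sequentially. norm (LINT y|\<nu>. Q i y * of_real (exp (- c * (norm (x - y))\<^sup>2))) \<le> D * R i powr (a - real DIM('a))"
      proof (intro always_eventually allI)
        fix i
        define r where "r = R i"
        have r: "r > 0" using R by (simp add: r_def)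
        have c2: "c / r\<^sup>2 > 0" using c r by simp
        define c' where "c' = pi\<^sup>2 / (c / r\<^sup>2)"
        have c': "c' > 0" by (simp only: c'_def divide_pos_pos[OF _ c2] zero_less_power pi_gt_zero)
        have em: "(\<lambda>y. complex_of_real (exp (- c * (norm (x - y))\<^sup>2))) \<in> borel_measurable borel" by measurable
        have fm: "(\<lambda>y. k y * complex_of_real (exp (- (c / r\<^sup>2) * (norm (r *\<^sub>R x - y))\<^sup>2))) \<in> borel_measurable borel" by measurable
        have "(LINT y|lborel. k y * of_real (exp (- (c / r\<^sup>2) * (norm (r *\<^sub>R x - y))\<^sup>2)))
           = \<bar>r\<bar> ^ DIM('a) *\<^sub>R (LINT y|lborel. k (0 + r *\<^sub>R y) * of_real (exp (- (c / r\<^sup>2) * (norm (r *\<^sub>R x - (0 + r *\<^sub>R y)))\<^sup>2)))"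
          by (rule integral_lborel_affine(2)[OF fm]) (use r in simp)
        also have "(\<lambda>y. k (0 + r *\<^sub>R y) * complex_of_real (exp (- (c / r\<^sup>2) * (norm (r *\<^sub>R x - (0 + r *\<^sub>R y)))\<^sup>2))) = (\<lambda>y. k (r *\<^sub>R y) * of_real (exp (- c * (norm (x - y))\<^sup>2)))"
        proof
          fix y
          have "norm (r *\<^sub>R x - (0 + r *\<^sub>R y)) = r * norm (x - y)"
            using r by (simp add: scaleR_diff_right[symmetric])
          then have "- (c / r\<^sup>2) * (norm (r *\<^sub>R x - (0 + r *\<^sub>R y)))\<^sup>2 = - c * (norm (x - y))\<^sup>2"
            using r by (simp add: power_mult_distrib)
          then show "k (0 + r *\<^sub>R y) * complex_of_real (exp (- (c / r\<^sup>2) * (norm (r *\<^sub>R x - (0 + r *\<^sub>R y)))\<^sup>2)) = k (r *\<^sub>R y) * of_real (exp (- c * (norm (x - y))\<^sup>2))"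
            by (simp only: add_0_left)
        qed
        finally have scale: "(LINT y|lborel. k y * of_real (exp (- (c / r\<^sup>2) * (norm (r *\<^sub>R x - y))\<^sup>2))) = r ^ DIM('a) *\<^sub>R (LINT y|lborel. k (r *\<^sub>R y) * of_real (exp (- c * (norm (x - y))\<^sup>2)))"
          using r by simp
        have "(LINT y|lborel. k y * of_real (exp (- (c / r\<^sup>2) * (norm (r *\<^sub>R x - y))\<^sup>2)))
          = (LINT y|lebesgue. k y * of_real (exp (- (c / r\<^sup>2) * (norm (r *\<^sub>R x - y))\<^sup>2)))"
          using fm by (subst integral_completion) auto
        also have "\<dots> = of_real (sqrt (pi / (c / r\<^sup>2)) ^ DIM('a)) * (LINT y|lebesgue. m y * gauss_wave c' (r *\<^sub>R x) y)"
          unfolding c'_def by (rule inverse_fourier_gauss_integral(2)[OF km c2])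
        finally have val: "(LINT y|lborel. k y * of_real (exp (- (c / r\<^sup>2) * (norm (r *\<^sub>R x - y))\<^sup>2))) = of_real (sqrt (pi / (c / r\<^sup>2)) ^ DIM('a)) * (LINT y|lebesgue. m y * gauss_wave c' (r *\<^sub>R x) y)" .
        have gi: "integrable lborel (\<lambda>y::'a. exp (- c' * (norm y)\<^sup>2))" by (rule gauss_integrable_real[OF c'])
        have gil: "integrable lebesgue (\<lambda>y::'a. exp (- c' * (norm y)\<^sup>2))" using gi by (subst integrable_completion) auto
        have "norm (LINT y|lebesgue. m y * gauss_wave c' (r *\<^sub>R x) y) \<le> (LINT y|lebesgue. D * exp (- c' * (norm (y::'a))\<^sup>2))"
        proof (rule integrable_dominated(2)[OF integrable_mult_right[OF gil]])
          have "integrable lebesgue (\<lambda>y. m y * gauss_wave c' (r *\<^sub>R x) y)"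
            using km gauss_wave_schwartz[OF c'] unfolding is_inverse_fourier_def by blast
          then show "(\<lambda>y. m y * gauss_wave c' (r *\<^sub>R x) y) \<in> borel_measurable lebesgue" by (rule borel_measurable_integrable)
          show "norm (m y * gauss_wave c' (r *\<^sub>R x) y) \<le> D * exp (- c' * (norm y)\<^sup>2)" for y
            unfolding norm_mult norm_gauss_wave by (intro mult_right_mono mD) auto
        qed
        also have "\<dots> = D * sqrt (pi / c') ^ DIM('a)"
        proof -
          have "(LINT y|lebesgue. exp (- c' * (norm (y::'a))\<^sup>2)) = (LINT y|lborel. exp (- c' * (norm (y::'a))\<^sup>2))"
            by (rule integral_completion) simp
          then show ?thesis unfolding integral_mult_right_zero by (simp only: integral_gauss[OF c'])
        qed
        finally have mb: "norm (LINT y|lebesgue. m y * gauss_wave c' (r *\<^sub>R x) y) \<le> D * sqrt (pi / c') ^ DIM('a)" .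
        have sp: "0 \<le> sqrt (pi / (c / r\<^sup>2)) ^ DIM('a)"
          by (intro zero_le_power real_sqrt_ge_zero divide_nonneg_pos c2) simp
        have "r ^ DIM('a) * norm (LINT y|lborel. k (r *\<^sub>R y) * of_real (exp (- c * (norm (x - y))\<^sup>2)))
          = norm (LINT y|lborel. k y * of_real (exp (- (c / r\<^sup>2) * (norm (r *\<^sub>R x - y))\<^sup>2)))"
          unfolding scale using r by simp
        also have "\<dots> = sqrt (pi / (c / r\<^sup>2)) ^ DIM('a) * norm (LINT y|lebesgue. m y * gauss_wave c' (r *\<^sub>R x) y)"
          unfolding val norm_mult norm_of_real abs_of_nonneg[OF sp] ..
        also have "\<dots> \<le> sqrt (pi / (c / r\<^sup>2)) ^ DIM('a) * (D * sqrt (pi / c') ^ DIM('a))"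
          by (rule mult_left_mono[OF mb sp])
        also have "\<dots> = D * (sqrt (pi / (c / r\<^sup>2)) * sqrt (pi / c')) ^ DIM('a)" by (simp add: power_mult_distrib)
        \<comment> \<open>The Gaussian on the frequency side has total mass one.\<close>
        also have "sqrt (pi / (c / r\<^sup>2)) * sqrt (pi / c') = 1"
          using c2 r c unfolding c'_def by (simp add: real_sqrt_mult[symmetric] power2_eq_square)
        finally have fin: "r ^ DIM('a) * norm (LINT y|lborel. k (r *\<^sub>R y) * of_real (exp (- c * (norm (x - y))\<^sup>2))) \<le> D" by simp
        have "norm (LINT y|\<nu>. Q i y * of_real (exp (- c * (norm (x - y))\<^sup>2))) = r powr a * norm (LINT y|lborel. k (r *\<^sub>R y) * of_real (exp (- c * (norm (x - y))\<^sup>2)))"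
          unfolding Qint[OF em] r_def by (simp add: norm_mult)
        also have "\<dots> = r powr (a - real DIM('a)) * (r ^ DIM('a) * norm (LINT y|lborel. k (r *\<^sub>R y) * of_real (exp (- c * (norm (x - y))\<^sup>2))))"
          using r by (simp add: powr_diff powr_realpow)
        also have "\<dots> \<le> r powr (a - real DIM('a)) * D" by (intro mult_left_mono fin) auto
        finally show "norm (LINT y|\<nu>. Q i y * of_real (exp (- c * (norm (x - y))\<^sup>2))) \<le> D * R i powr (a - real DIM('a))"
          by (simp add: r_def mult.commute)
      qed
    qed
  qed
  have "integrable \<nu> g" unfolding \<nu>_def using int by (subst integrable_density) (auto simp: scaleR_conv_of_real)
  from null_against_integrable[OF this] have "(\<lambda>i. LINT y|\<nu>. Q i y * g y) \<longlonglongrightarrow> 0" by (simp add: null_against_def)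
  then have lim: "(\<lambda>i. of_real (R i powr a) * (LINT y|lborel. k (R i *\<^sub>R y) * g y)) \<longlonglongrightarrow> 0" unfolding Qint[OF g] .
  have "\<forall>\<^sub>F i in sequentially. of_real (R i powr a) * (LINT y|lborel. k (R i *\<^sub>R y) * g y) = of_real (X i powr a) * (LINT y|lborel. k (X i *\<^sub>R y) * g y)"
    using filterlim_at_top[THEN iffD1, OF X, rule_format, of 1] by eventually_elim (simp add: R_def max_def)
  with lim show "(\<lambda>i. of_real (X i powr a) * (LINT y|lborel. k (X i *\<^sub>R y) * g y)) \<longlonglongrightarrow> 0"
    by (rule Lim_transform_eventually)
qed

theorem theorem1p3:
  fixes f :: "(real ^ 'n) distribution"
    and \<gamma> \<delta> p lam :: real
  assumes "\<gamma> > 0"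
    and "0 < \<delta>" and "\<delta> < (real CARD('n) - 1) / 2"
    and "1 \<le> p" and "p < 2 * real CARD('n) / (real CARD('n) - 1 - 2 * \<delta>)"
    and "(real CARD('n) - 1) / 2 - \<delta> < lam" and "lam \<le> \<gamma>"
    and "f \<in> homogeneous_sobolev lam p"
  shows "AE x in lebesgue.
           (\<forall>R>0. integrable lebesgue (br_error_integrand \<delta> \<gamma> lam p f R x)) \<and>
           (\<lambda>R. br_error \<delta> \<gamma> lam p f R x)
             \<in> o[at_top](\<lambda>R. of_real (1 / R powr (lam + \<delta> - (real CARD('n) - 1) / 2)))"
proof -
  define n where "n = real DIM(real ^ 'n)"
  have n: "n = real CARD('n)" by (simp add: n_def)
  define a where "a = (n + 1) / 2 + \<delta>"
  have a: "0 < a" "a < real DIM(real ^ 'n)" using assms(2,3) by (auto simp: a_def n field_simps)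
  have lam0: "lam > 0" using assms(3,6) by linarith
  have a_eq: "a = (real DIM(real ^ 'n) + 1) / 2 + \<delta>" by (simp add: a_def n_def)
  have p1: "\<delta> < (real DIM(real ^ 'n) - 1) / 2" and p2: "(real DIM(real ^ 'n) - 1) / 2 - \<delta> < lam"
    using assms(3,6) by simp_all
  obtain k :: "real ^ 'n \<Rightarrow> complex" and C where k: "k \<in> borel_measurable borel" "is_inverse_fourier k (br_error_symbol \<delta> \<gamma> lam)"
    "\<And>y. y \<noteq> 0 \<Longrightarrow> norm (k y) \<le> C * norm y powr (- a)"
    "AE y in lborel. br_error_kernel \<delta> \<gamma> lam y = k y"
    unfolding a_eq by (rule br_error_kernel_bound[OF assms(1,2) p1 p2 assms(7)]) (rule that[unfolded a_eq])
  note [measurable] = k(1)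
  obtain D where D: "\<And>x::real ^ 'n. norm (br_error_symbol \<delta> \<gamma> lam x) \<le> D"
    using br_error_symbol_bounded[OF assms(1,2) lam0 assms(7)] by blast
  define g where "g = riesz_derivative lam p f"
  have "\<exists>g. g \<in> Lp_space p \<and> is_riesz_potential lam (dist_of g) f"
    using assms(8) unfolding homogeneous_sobolev_def by blast
  from someI_ex[OF this] have gL: "g \<in> Lp_space p" unfolding g_def riesz_derivative_def by blast
  then have gm: "g \<in> borel_measurable lebesgue" and gi: "integrable lebesgue (\<lambda>x. norm (g x) powr p)"
    unfolding Lp_space_def by auto
  \<comment> \<open>Replacing the chosen representatives of the \<open>L\<^sup>p\<close> function and of the kernel by Borel functions
    changes the integrand only on null sets of \<open>y\<close>, for every \<open>R > 0\<close> and every \<open>x\<close>.\<close>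
  obtain g' where g'[measurable]: "g' \<in> borel_measurable borel" and gg': "AE x in lborel. g x = g' x"
    by (rule borel_version[OF gm])
  have g'i: "integrable lborel (\<lambda>x. norm (g' x) powr p)"
  proof -
    have m': "(\<lambda>x. norm (g' x) powr p) \<in> borel_measurable lborel" by measurable
    have "integrable lebesgue (\<lambda>x. norm (g' x) powr p)"
      by (rule integrable_cong_AE_imp[OF gi measurable_completion[OF m']])
         (use AE_completion[OF gg'] in \<open>auto elim: eventually_mono\<close>)
    then show ?thesis using m' by (subst (asm) integrable_completion)
  qed
  have pa: "p * (real DIM(real ^ 'n) - a) < real DIM(real ^ 'n)"
  proof -
    have pos: "real CARD('n) - 1 - 2 * \<delta> > 0" using assms(3) by (simp add: field_simps)
    have "p * (real CARD('n) - 1 - 2 * \<delta>) < 2 * real CARD('n)" using assms(5) pos by (simp add: pos_less_divide_eq)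
    then show ?thesis unfolding n_def[symmetric] n a_def by (simp add: field_simps)
  qed
  have "AE x in lborel. integrable lborel (\<lambda>y. of_real (norm y powr (- a)) * g' (x - y))"
    by (rule weighted_Lp_integrable[OF a assms(4) pa g' g'i])
  then have "AE x in lebesgue. integrable lborel (\<lambda>y. of_real (norm y powr (- a)) * g' (x - y))" by (rule AE_completion)
  then show ?thesis
  proof eventually_elim
    case (elim x)
    let ?h = "\<lambda>y. g' (x - y)"
    let ?I = "\<lambda>R y. of_real (R ^ DIM(real ^ 'n)) * k (R *\<^sub>R y) * ?h y"
    have eqI: "AE y in lborel. br_error_integrand \<delta> \<gamma> lam p f R x y = ?I R y" if R: "R > 0" for R
    proof -
      have "AE y in lborel. br_error_kernel \<delta> \<gamma> lam (0 + R *\<^sub>R y) = k (0 + R *\<^sub>R y)"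
        by (rule AE_lborel_affine[OF k(4)]) (use R in simp)
      moreover have "AE y in lborel. g (x + (-1) *\<^sub>R y) = g' (x + (-1) *\<^sub>R y)"
        by (rule AE_lborel_affine[OF gg']) simp
      ultimately show ?thesis by eventually_elim (simp add: br_error_integrand_def g_def)
    qed
    have measI: "?I R \<in> borel_measurable borel" for R by measurable
    have intI: "integrable lborel (?I R)" if R: "R > 0" for R
    proof (rule Bochner_Integration.integrable_bound[OF integrable_mult_right[OF elim]])
      show "AE y in lborel. norm (?I R y) \<le> norm (of_real (R ^ DIM(real ^ 'n) * C * R powr (- a)) * (of_real (norm y powr (- a)) * ?h y))"
        using AE_lborel_nonzero
      proof eventually_elim
        case (elim y)
        have "norm (k (R *\<^sub>R y)) \<le> C * (R powr (- a) * norm y powr (- a))"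
          using k(3)[of "R *\<^sub>R y"] elim R by (simp add: powr_mult)
        then have "R ^ DIM(real ^ 'n) * norm (k (R *\<^sub>R y)) * norm (?h y) \<le> R ^ DIM(real ^ 'n) * (C * (R powr (- a) * norm y powr (- a))) * norm (?h y)"
          using R by (intro mult_right_mono mult_left_mono) auto
        also have "\<dots> \<le> \<bar>R ^ DIM(real ^ 'n) * C * R powr (- a)\<bar> * (norm y powr (- a) * norm (?h y))"
          by (simp only: mult.assoc[symmetric]) (intro mult_right_mono, auto)
        finally show ?case using R by (simp only: norm_mult norm_of_real abs_of_nonneg powr_ge_zero zero_le_power less_imp_le)
      qed
    qed (use measI in simp)
    have int: "integrable lebesgue (br_error_integrand \<delta> \<gamma> lam p f R x)"
      and val: "(LINT y|lebesgue. br_error_integrand \<delta> \<gamma> lam p f R x y) = integral\<^sup>L lborel (?I R)" if R: "R > 0" for R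
    proof -
      have m: "br_error_integrand \<delta> \<gamma> lam p f R x \<in> borel_measurable lebesgue"
        by (rule measurable_lebesgue_AE[OF measI eqI[OF R]])
      have ae: "AE y in lebesgue. ?I R y = br_error_integrand \<delta> \<gamma> lam p f R x y"
        using AE_completion[OF eqI[OF R]] by eventually_elim simp
      have i: "integrable lebesgue (?I R)" using intI[OF R] measI by (subst integrable_completion) auto
      show "integrable lebesgue (br_error_integrand \<delta> \<gamma> lam p f R x)"
        by (rule integrable_cong_AE_imp[OF i m ae])
      have "(LINT y|lebesgue. br_error_integrand \<delta> \<gamma> lam p f R x y) = integral\<^sup>L lebesgue (?I R)"
        by (rule integral_cong_AE[OF m borel_measurable_integrable[OF i]]) (use ae in \<open>auto elim: eventually_mono\<close>)
      also have "\<dots> = integral\<^sup>L lborel (?I R)" using measI by (intro integral_completion) simp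
      finally show "(LINT y|lebesgue. br_error_integrand \<delta> \<gamma> lam p f R x y) = integral\<^sup>L lborel (?I R)" .
    qed
    let ?e = "lam + \<delta> - (real CARD('n) - 1) / 2"
    have "((\<lambda>R. of_real (R powr a) * (LINT y|lborel. k (R *\<^sub>R y) * ?h y)) \<longlongrightarrow> 0) at_top"
      by (rule dilated_kernel_limit[OF a k(1,3,2) D _ elim]) measurable
    moreover have "\<forall>\<^sub>F R in at_top. of_real (R powr a) * (LINT y|lborel. k (R *\<^sub>R y) * ?h y) = br_error \<delta> \<gamma> lam p f R x / of_real (1 / R powr ?e)"
      using eventually_gt_at_top[of 0]
    proof eventually_elim
      case (elim R)
      have "integral\<^sup>L lborel (?I R) = of_real (R ^ DIM(real ^ 'n)) * (LINT y|lborel. k (R *\<^sub>R y) * ?h y)"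
        by (simp only: mult.assoc integral_mult_right_zero)
      then have "br_error \<delta> \<gamma> lam p f R x = of_real (R powr (- lam) * R ^ DIM(real ^ 'n)) * (LINT y|lborel. k (R *\<^sub>R y) * ?h y)"
        unfolding br_error_def val[OF elim] by (simp only: of_real_mult mult.assoc)
      then have "br_error \<delta> \<gamma> lam p f R x * of_real (R powr ?e) = of_real (R powr (- lam) * R ^ DIM(real ^ 'n) * R powr ?e) * (LINT y|lborel. k (R *\<^sub>R y) * ?h y)"
        by (simp only: of_real_mult mult_ac)
      \<comment> \<open>The claimed rate is the one for which all powers of \<open>R\<close> combine to \<open>R\<^sup>a\<close>.\<close>
      also have "R powr (- lam) * R ^ DIM(real ^ 'n) * R powr ?e = R powr a"
      proof -
        have "R ^ DIM(real ^ 'n) = R powr n" using elim by (simp add: n_def powr_realpow)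
        moreover have "- lam + n + ?e = a" unfolding a_def n by (simp add: field_simps)
        ultimately show ?thesis by (simp only: powr_add[symmetric])
      qed
      finally have "br_error \<delta> \<gamma> lam p f R x * of_real (R powr ?e) = of_real (R powr a) * (LINT y|lborel. k (R *\<^sub>R y) * ?h y)" .
      then show ?case by simp
    qed
    ultimately have "((\<lambda>R. br_error \<delta> \<gamma> lam p f R x / of_real (1 / R powr ?e)) \<longlongrightarrow> 0) at_top"
      by (rule Lim_transform_eventually)
    then have "(\<lambda>R. br_error \<delta> \<gamma> lam p f R x) \<in> o[at_top](\<lambda>R. of_real (1 / R powr ?e))"
      by (rule smalloI_tendsto) (auto intro: eventually_mono[OF eventually_gt_at_top[of 0]])
    with int show ?case by blast
  qed
qed

end
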